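(* For all integers $n\ge 1$ and $k\ge 1$, the group $\mathrm{EL}(\mathbb{Z},n,k)$ of elementary Turing machines on $n$ symbols, $k$ states and dimension $1$ is finitely generated.
   Context: Let $d,n,k\ge 1$ be integers, $\Sigma=\{0,\dots,n-1\}$ (tape symbols), $Q=\{1,\dots,k\}$ (states). The shift on $\Sigma^{\mathbb{Z}^d}$ is $(\sigma^{v}(x))_{u}=x_{u-v}$. A moving head $(\mathbb{Z}^d,n,k)$-Turing machine is a map $T:\Sigma^{\mathbb{Z}^d}\times Q\times\mathbb{Z}^d\to\Sigma^{\mathbb{Z}^d}\times Q\times\mathbb{Z}^d$ (a triple is tape, state, head position) for which there are finite sets $F_{\rm in},F_{\rm out}\subset\mathbb{Z}^d$ and a function (local rule) $f:\Sigma^{F_{\rm in}}\times Q\to\Sigma^{F_{\rm out}}\times Q\times\mathbb{Z}^d$ with finite domain such that $T=T_f$, where $T_f(x,q,v)=(\tilde x,\tilde q,v+\tilde u)$ is given as follows: $(\tilde p,\tilde q,\tilde u)=f(\sigma^{-v}(x)|_{F_{\rm in}},q)$, and $\tilde x_{u}=\tilde p_{u-v}$ if $u-v\in F_{\rm out}$, $\tilde x_u=x_u$ otherwise. $T$ is reversible if there is a $(\mathbb{Z}^d,n,k)$-Turing machine $T^{-1}$ with $T\circ T^{-1}=T^{-1}\circ T=\mathrm{id}$. The reversible ones form a group $\mathrm{RTM}(\mathbb{Z}^d,n,k)$ under composition. $\mathrm{LP}(\mathbb{Z}^d,n,k)$ (local permutations) is the subgroup of reversible machines that never move the head (the $\mathbb{Z}^d$-component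 of the local rule is always $0$). $\mathrm{RFA}(\mathbb{Z}^d,n,k)$ (reversible finite-state automata) is the subgroup of reversible machines that never change the tape (local rule of the form $f(p,q)=(p,q',v)$). $\mathrm{EL}(\mathbb{Z}^d,n,k)=\langle \mathrm{RFA}(\mathbb{Z}^d,n,k),\mathrm{LP}(\mathbb{Z}^d,n,k)\rangle$ is the group of elementary Turing machines. *)

theory Defs
  imports "HOL-Algebra.Bij" "HOL-Algebra.Generated_Groups"
begin

text \<open>
  The cell lattice is the abelian group \<^typ>\<open>'g\<close>: taking \<open>'g = int\<close> gives dimension 1, and
  \<open>'g = int ^ 'd\<close> dimension \<open>CARD('d)\<close>. All maps on configurations are extensional, i.e.
  they are \<^const>\<open>undefined\<close> outside of \<open>tm_configs n k\<close>, so that equality of machines is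
  equality of maps on the set of configurations.
\<close>

type_synonym 'g tm_config = "('g \<Rightarrow> nat) \<times> nat \<times> 'g"
type_synonym 'g local_rule = "('g \<Rightarrow> nat) \<times> nat \<Rightarrow> ('g \<Rightarrow> nat) \<times> nat \<times> 'g"

definition tape_symbols :: "nat \<Rightarrow> nat set"
  where "tape_symbols n = {..<n}"

definition tm_states :: "nat \<Rightarrow> nat set"
  where "tm_states k = {1..k}"

definition tm_configs :: "nat \<Rightarrow> nat \<Rightarrow> 'g tm_config set"
  where "tm_configs n k = (UNIV \<rightarrow>\<^sub>E tape_symbols n) \<times> tm_states k \<times> UNIV"

definition shift :: "'g::ab_group_add \<Rightarrow> ('g \<Rightarrow> nat) \<Rightarrow> 'g \<Rightarrow> nat"
  where "shift v x = (\<lambda>u. x (u - v))"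

definition is_local_rule :: "nat \<Rightarrow> nat \<Rightarrow> 'g set \<Rightarrow> 'g set \<Rightarrow> 'g local_rule \<Rightarrow> bool"
  where "is_local_rule n k Fin Fout f \<longleftrightarrow> finite Fin \<and> finite Fout \<and>
    f \<in> (Fin \<rightarrow>\<^sub>E tape_symbols n) \<times> tm_states k \<rightarrow>
          (Fout \<rightarrow>\<^sub>E tape_symbols n) \<times> tm_states k \<times> UNIV"

definition tm_map ::
    "nat \<Rightarrow> nat \<Rightarrow> 'g set \<Rightarrow> 'g set \<Rightarrow> 'g::ab_group_add local_rule \<Rightarrow> 'g tm_config \<Rightarrow> 'g tm_config"
  where "tm_map n k Fin Fout f = (\<lambda>(x, q, v)\<in>tm_configs n k.
    let (p', q', u') = f (restrict (shift (- v) x) Fin, q)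
    in (\<lambda>u. if u - v \<in> Fout then p' (u - v) else x u, q', v + u'))"

definition turing_machines :: "nat \<Rightarrow> nat \<Rightarrow> ('g::ab_group_add tm_config \<Rightarrow> 'g tm_config) set"
  where "turing_machines n k =
    {tm_map n k Fin Fout f |Fin Fout f. is_local_rule n k Fin Fout f}"

definition reversible_machines :: "nat \<Rightarrow> nat \<Rightarrow> ('g::ab_group_add tm_config \<Rightarrow> 'g tm_config) set"
  where "reversible_machines n k = {T \<in> turing_machines n k. \<exists>T'\<in>turing_machines n k.
    compose (tm_configs n k) T T' = (\<lambda>c\<in>tm_configs n k. c) \<and>
    compose (tm_configs n k) T' T = (\<lambda>c\<in>tm_configs n k. c)}"

definition RTM :: "nat \<Rightarrow> nat \<Rightarrow> ('g::ab_group_add tm_config \<Rightarrow> 'g tm_config) monoid"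
  where "RTM n k = BijGroup (tm_configs n k) \<lparr>carrier := reversible_machines n k\<rparr>"

definition LP :: "nat \<Rightarrow> nat \<Rightarrow> ('g::ab_group_add tm_config \<Rightarrow> 'g tm_config) set"
  where "LP n k = {T \<in> reversible_machines n k. \<exists>Fin Fout f.
    is_local_rule n k Fin Fout f \<and> T = tm_map n k Fin Fout f \<and>
    (\<forall>p \<in> Fin \<rightarrow>\<^sub>E tape_symbols n. \<forall>q \<in> tm_states k. snd (snd (f (p, q))) = 0)}"

text \<open>The form \<open>f (p, q) = (p, q', v)\<close> requires the input and output windows to coincide.\<close>

definition RFA :: "nat \<Rightarrow> nat \<Rightarrow> ('g::ab_group_add tm_config \<Rightarrow> 'g tm_config) set"
  where "RFA n k = {T \<in> reversible_machines n k. \<exists>F f.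
    is_local_rule n k F F f \<and> T = tm_map n k F F f \<and>
    (\<forall>p \<in> F \<rightarrow>\<^sub>E tape_symbols n. \<forall>q \<in> tm_states k. fst (f (p, q)) = p)}"

definition EL :: "nat \<Rightarrow> nat \<Rightarrow> ('g::ab_group_add tm_config \<Rightarrow> 'g tm_config) monoid"
  where "EL n k = subgroup_generated (RTM n k) (RFA n k \<union> LP n k)"

definition finitely_generated :: "('a, 'b) monoid_scheme \<Rightarrow> bool"
  where "finitely_generated G \<longleftrightarrow>
    (\<exists>S. finite S \<and> S \<subseteq> carrier G \<and> generate G S = carrier G)"


subsection \<open>The reversible machines form a group\<close>

text \<open>
  Machines are characterised semantically: they are the self-maps of the configurations that
  read and write only in a finite window around the head and have finitely many head moves.
\<close>

definition window_local ::
    "nat \<Rightarrow> nat \<Rightarrow> 'g::ab_group_add set \<Rightarrow> ('g tm_config \<Rightarrow> 'g tm_config) \<Rightarrow> bool"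
  where "window_local n k H T \<longleftrightarrow>
    (\<forall>x q v y w x' q' v' y' r' w'. (x, q, v) \<in> tm_configs n k \<longrightarrow> (y, q, w) \<in> tm_configs n k \<longrightarrow>
       (\<forall>u\<in>H. x (v + u) = y (w + u)) \<longrightarrow> T (x, q, v) = (x', q', v') \<longrightarrow> T (y, q, w) = (y', r', w') \<longrightarrow>
       q' = r' \<and> v' - v = w' - w \<and> (\<forall>u\<in>H. x' (v + u) = y' (w + u)) \<and>
       (\<forall>u. u \<notin> H \<longrightarrow> x' (v + u) = x (v + u)))"

lemma window_localD:
  assumes "window_local n k H T" "(x, q, v) \<in> tm_configs n k" "(y, q, w) \<in> tm_configs n k"
    and "\<And>u. u \<in> H \<Longrightarrow> x (v + u) = y (w + u)"
    and "T (x, q, v) = (x', q', v')" "T (y, q, w) = (y', r', w')"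
  shows "q' = r'" "v' - v = w' - w" "u \<in> H \<Longrightarrow> x' (v + u) = y' (w + u)"
    and "u \<notin> H \<Longrightarrow> x' (v + u) = x (v + u)"
  using assms unfolding window_local_def by meson+

lemma tm_map_apply:
  assumes "(x, q, v) \<in> tm_configs n k" "f (restrict (shift (- v) x) Fin, q) = (p', q', u')"
  shows "tm_map n k Fin Fout f (x, q, v) =
           (\<lambda>u. if u - v \<in> Fout then p' (u - v) else x u, q', v + u')"
  using assms by (simp add: tm_map_def)

lemma local_rule_apply:
  assumes "is_local_rule n k Fin Fout f" "(x, q, v) \<in> tm_configs n k"
  obtains p' q' u' where "f (restrict (shift (- v) x) Fin, q) = (p', q', u')"
    "p' \<in> Fout \<rightarrow>\<^sub>E tape_symbols n" "q' \<in> tm_states k"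
    "restrict (shift (- v) x) Fin \<in> Fin \<rightarrow>\<^sub>E tape_symbols n" "q \<in> tm_states k"
proof -
  have 1: "restrict (shift (- v) x) Fin \<in> Fin \<rightarrow>\<^sub>E tape_symbols n" and 2: "q \<in> tm_states k"
    using assms(2) by (auto simp: tm_configs_def shift_def PiE_iff)
  obtain p' q' u' where f: "f (restrict (shift (- v) x) Fin, q) = (p', q', u')"
    by (metis prod_cases3)
  have "f (restrict (shift (- v) x) Fin, q) \<in> (Fout \<rightarrow>\<^sub>E tape_symbols n) \<times> tm_states k \<times> UNIV"
    using assms(1) 1 2 unfolding is_local_rule_def by blast
  with f 1 2 that show ?thesis by auto
qed

lemma turing_machine_window:
  fixes T :: "'g::ab_group_add tm_config \<Rightarrow> 'g tm_config"
  assumes "T \<in> turing_machines n k"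
  obtains H U where "finite H" "finite U" "window_local n k H T"
    "T \<in> tm_configs n k \<rightarrow>\<^sub>E tm_configs n k"
    "\<And>x q v x' q' v'. (x, q, v) \<in> tm_configs n k \<Longrightarrow> T (x, q, v) = (x', q', v') \<Longrightarrow> v' - v \<in> U"
proof -
  obtain Fin Fout f where f: "is_local_rule n k Fin Fout f" and T: "T = tm_map n k Fin Fout f"
    using assms by (auto simp: turing_machines_def)
  define D where "D = (Fin \<rightarrow>\<^sub>E tape_symbols n) \<times> tm_states k"
  define U where "U = (\<lambda>z. snd (snd (f z))) ` D"
  define H where "H = Fin \<union> Fout"
  have fin: "finite Fin" "finite Fout" using f by (auto simp: is_local_rule_def)
  have "finite D"
    unfolding D_def using fin by (auto intro!: finite_PiE simp: tape_symbols_def tm_states_def)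
  then have "finite U" by (simp add: U_def)
  moreover have "finite H" using fin by (simp add: H_def)
  moreover have "window_local n k H T"
    unfolding window_local_def
  proof (intro allI impI)
    fix x q v y w x' q' v' y' r' w'
    assume c: "(x, q, v) \<in> tm_configs n k" "(y, q, w) \<in> tm_configs n k"
      and eq: "\<forall>u\<in>H. x (v + u) = y (w + u)"
      and t: "T (x, q, v) = (x', q', v')" "T (y, q, w) = (y', r', w')"
    have r: "restrict (shift (- v) x) Fin = restrict (shift (- w) y) Fin"
    proof (rule restrict_ext)
      fix u assume "u \<in> Fin"
      then have "x (v + u) = y (w + u)" using eq by (simp add: H_def)
      then show "shift (- v) x u = shift (- w) y u" by (simp add: shift_def add.commute)
    qed
    obtain p s m where p: "f (restrict (shift (- v) x) Fin, q) = (p, s, m)"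
      by (metis prod_cases3)
    have "f (restrict (shift (- w) y) Fin, q) = (p, s, m)" using p r by simp
    then have "(y', r', w') = (\<lambda>u. if u - w \<in> Fout then p (u - w) else y u, s, w + m)"
      using c t T by (simp add: tm_map_apply)
    moreover have "(x', q', v') = (\<lambda>u. if u - v \<in> Fout then p (u - v) else x u, s, v + m)"
      using c p t T by (simp add: tm_map_apply)
    ultimately show "q' = r' \<and> v' - v = w' - w \<and> (\<forall>u\<in>H. x' (v + u) = y' (w + u)) \<and>
       (\<forall>u. u \<notin> H \<longrightarrow> x' (v + u) = x (v + u))"
      using eq by (auto simp: H_def)
  qed
  moreover have "T \<in> tm_configs n k \<rightarrow>\<^sub>E tm_configs n k"
  proof (rule PiE_I)
    fix c :: "'g tm_config" assume c: "c \<in> tm_configs n k"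
    obtain x q v where xqv: "c = (x, q, v)" by (metis prod_cases3)
    obtain p s m where p: "f (restrict (shift (- v) x) Fin, q) = (p, s, m)"
      "p \<in> Fout \<rightarrow>\<^sub>E tape_symbols n" "s \<in> tm_states k"
      using local_rule_apply f c unfolding xqv by metis
    show "T c \<in> tm_configs n k"
      using p c unfolding xqv T by (auto simp: tm_map_apply tm_configs_def PiE_iff)
  qed (simp add: T tm_map_def)
  moreover have "v' - v \<in> U"
    if c: "(x, q, v) \<in> tm_configs n k" and t: "T (x, q, v) = (x', q', v')" for x q v x' q' v'
  proof -
    obtain p s m where p: "f (restrict (shift (- v) x) Fin, q) = (p, s, m)"
      "restrict (shift (- v) x) Fin \<in> Fin \<rightarrow>\<^sub>E tape_symbols n" "q \<in> tm_states k"
      using local_rule_apply f c by metis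
    have "v' = v + m" using c p t T by (simp add: tm_map_apply)
    moreover have "m \<in> U" unfolding U_def D_def
      using p by (intro image_eqI[of _ _ "(restrict (shift (- v) x) Fin, q)"]) auto
    ultimately show ?thesis by simp
  qed
  ultimately show ?thesis using that by blast
qed

lemma window_turing_machine:
  fixes T :: "'g::ab_group_add tm_config \<Rightarrow> 'g tm_config"
  assumes "n \<ge> 1" and H: "finite H" "window_local n k H T"
    and T: "T \<in> tm_configs n k \<rightarrow>\<^sub>E tm_configs n k"
  shows "T \<in> turing_machines n k"
proof -
  define ext :: "('g \<Rightarrow> nat) \<Rightarrow> 'g \<Rightarrow> nat" where "ext p = (\<lambda>u. if u \<in> H then p u else 0)" for p
  define f where "f = (\<lambda>(p, q). case T (ext p, q, 0) of (x, q', u) \<Rightarrow> (restrict x H, q', u))"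
  have ext: "(ext p, q, 0) \<in> tm_configs n k"
    if "p \<in> H \<rightarrow>\<^sub>E tape_symbols n" "q \<in> tm_states k" for p q
    using that assms(1) by (auto simp: ext_def tm_configs_def PiE_iff tape_symbols_def)
  have rule: "is_local_rule n k H H f"
    unfolding is_local_rule_def
  proof (intro conjI H Pi_I)
    fix z assume "z \<in> (H \<rightarrow>\<^sub>E tape_symbols n) \<times> tm_states k"
    then obtain p q where z: "z = (p, q)" "p \<in> H \<rightarrow>\<^sub>E tape_symbols n" "q \<in> tm_states k" by auto
    have "T (ext p, q, 0) \<in> tm_configs n k" using T ext z by (blast dest: PiE_mem)
    then show "f z \<in> (H \<rightarrow>\<^sub>E tape_symbols n) \<times> tm_states k \<times> UNIV"
      unfolding z f_def by (auto simp: tm_configs_def PiE_iff split: prod.splits)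
  qed
  have "T = tm_map n k H H f"
  proof (rule extensionalityI)
    show "T \<in> extensional (tm_configs n k)" using T by (simp add: PiE_def)
    show "tm_map n k H H f \<in> extensional (tm_configs n k)" by (simp add: tm_map_def)
    fix c :: "'g tm_config" assume c: "c \<in> tm_configs n k"
    obtain x q v where xqv: "c = (x, q, v)" by (metis prod_cases3)
    define p where "p = restrict (shift (- v) x) H"
    have cx: "(x, q, v) \<in> tm_configs n k" using c xqv by simp
    have cp: "(ext p, q, 0) \<in> tm_configs n k"
      using local_rule_apply[OF rule cx] ext unfolding p_def by metis
    obtain x' q' v' where t: "T (x, q, v) = (x', q', v')" by (metis prod_cases3)
    obtain y' r' w' where s: "T (ext p, q, 0) = (y', r', w')" by (metis prod_cases3)
    have ag: "x (v + u) = ext p (0 + u)" if "u \<in> H" for u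
      using that by (simp add: ext_def p_def shift_def add.commute)
    note L = window_localD[OF H(2) cx cp ag t s]
    have "f (p, q) = (restrict y' H, r', w')" by (simp add: f_def s)
    then have "tm_map n k H H f (x, q, v) =
        (\<lambda>u. if u - v \<in> H then restrict y' H (u - v) else x u, r', v + w')"
      unfolding p_def by (rule tm_map_apply[OF cx])
    moreover have "x' = (\<lambda>u. if u - v \<in> H then restrict y' H (u - v) else x u)"
    proof
      fix u
      show "x' u = (if u - v \<in> H then restrict y' H (u - v) else x u)"
        using L(3)[of "u - v"] L(4)[of "u - v"] by simp
    qed
    moreover have "v' = v + w'" using L(2) by (simp add: algebra_simps)
    ultimately show "T c = tm_map n k H H f c" using t L(1) unfolding xqv by simp
  qed
  with rule show ?thesis by (auto simp: turing_machines_def)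
qed

lemma turing_machine_id:
  assumes "n \<ge> 1"
  shows "(\<lambda>c\<in>tm_configs n k. c) \<in> turing_machines n k"
  by (rule window_turing_machine[OF assms, of "{}"]) (auto simp: window_local_def)

lemma turing_machine_compose:
  fixes S T :: "'g::ab_group_add tm_config \<Rightarrow> 'g tm_config"
  assumes n: "n \<ge> 1" and S: "S \<in> turing_machines n k" and T: "T \<in> turing_machines n k"
  shows "compose (tm_configs n k) S T \<in> turing_machines n k"
proof -
  obtain H1 U where 1: "finite H1" "finite U" "window_local n k H1 T"
      "T \<in> tm_configs n k \<rightarrow>\<^sub>E tm_configs n k"
    and U: "\<And>x q v x' q' v'. (x, q, v) \<in> tm_configs n k \<Longrightarrow> T (x, q, v) = (x', q', v') \<Longrightarrow> v' - v \<in> U"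
    using turing_machine_window[OF T] by metis
  obtain H2 where 2: "finite H2" "window_local n k H2 S"
      "S \<in> tm_configs n k \<rightarrow>\<^sub>E tm_configs n k"
    using turing_machine_window[OF S] by metis
  define H where "H = H1 \<union> (\<lambda>(m, u). m + u) ` (U \<times> H2)"
  have "finite H" using 1 2 by (auto simp: H_def)
  moreover have "compose (tm_configs n k) S T \<in> tm_configs n k \<rightarrow>\<^sub>E tm_configs n k"
    using 1(4) 2(3) by (auto simp: compose_def PiE_iff)
  moreover have "window_local n k H (compose (tm_configs n k) S T)"
    unfolding window_local_def
  proof (intro allI impI)
    fix x q v y w x'' q'' v'' y'' r'' w''
    assume c: "(x, q, v) \<in> tm_configs n k" "(y, q, w) \<in> tm_configs n k"
      and eq: "\<forall>u\<in>H. x (v + u) = y (w + u)"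
      and t: "compose (tm_configs n k) S T (x, q, v) = (x'', q'', v'')"
             "compose (tm_configs n k) S T (y, q, w) = (y'', r'', w'')"
    obtain x' q' v' where tx: "T (x, q, v) = (x', q', v')" by (metis prod_cases3)
    obtain y' r' w' where ty: "T (y, q, w) = (y', r', w')" by (metis prod_cases3)
    define m where "m = v' - v"
    have ag: "x (v + u) = y (w + u)" if "u \<in> H1" for u using eq that by (simp add: H_def)
    note L = window_localD[OF 1(3) c ag tx ty]
    have ag': "y (w + u) = x (v + u)" if "u \<in> H1" for u using eq that by (simp add: H_def)
    note L' = window_localD[OF 1(3) c(2,1) ag' ty tx]
    have m: "v' = v + m" "w' = w + m" "m \<in> U"
      using L(2) U[OF c(1) tx] by (auto simp: m_def algebra_simps)
    have c': "(x', q', v') \<in> tm_configs n k" "(y', q', w') \<in> tm_configs n k"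
      using PiE_mem[OF 1(4) c(1)] PiE_mem[OF 1(4) c(2)] tx ty L(1) by simp_all
    have x'y': "x' (v + u) = y' (w + u)" if "u \<in> H" for u
      using L(3,4)[of u] L'(4)[of u] eq that by metis
    have ag2: "x' (v' + u) = y' (w' + u)" if "u \<in> H2" for u
    proof -
      have "m + u \<in> H" using that m(3) by (force simp: H_def)
      from x'y'[OF this] show ?thesis by (simp add: m add.assoc)
    qed
    have sx: "S (x', q', v') = (x'', q'', v'')" and sy: "S (y', q', w') = (y'', r'', w'')"
      using t c tx ty L(1) by (simp_all add: compose_def)
    note M = window_localD[OF 2(2) c' ag2 sx sy]
    note M' = window_localD[OF 2(2) c'(2,1) ag2[symmetric] sy sx]
    have "x'' (v + u) = y'' (w + u)" if "u \<in> H" for u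
    proof -
      have "v + u = v' + (u - m)" "w + u = w' + (u - m)" by (simp_all add: m)
      then show ?thesis
        using M(3,4)[of "u - m"] M'(4)[of "u - m"] x'y'[OF that] by metis
    qed
    moreover have "x'' (v + u) = x (v + u)" if "u \<notin> H" for u
    proof -
      have "u - m \<notin> H2"
      proof
        assume "u - m \<in> H2"
        then have "m + (u - m) \<in> H" using m(3) by (force simp: H_def)
        then show False using that by simp
      qed
      moreover have "v + u = v' + (u - m)" by (simp add: m)
      moreover have "u \<notin> H1" using that by (simp add: H_def)
      ultimately show ?thesis using M(4)[of "u - m"] L(4)[of u] by metis
    qed
    moreover have "v'' - v = w'' - w" using M(2) by (simp add: m algebra_simps)
    ultimately show "q'' = r'' \<and> v'' - v = w'' - w \<and> (\<forall>u\<in>H. x'' (v + u) = y'' (w + u)) \<and>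
       (\<forall>u. u \<notin> H \<longrightarrow> x'' (v + u) = x (v + u))"
      using M(1) by blast
  qed
  ultimately show ?thesis using window_turing_machine[OF n] by blast
qed

lemma turing_machine_funcset:
  "T \<in> turing_machines n k \<Longrightarrow> T \<in> tm_configs n k \<rightarrow>\<^sub>E tm_configs n k"
  by (metis turing_machine_window)

lemma reversible_machine_Bij:
  assumes "T \<in> reversible_machines n k"
  shows "T \<in> Bij (tm_configs n k)"
proof -
  obtain T' where T: "T \<in> turing_machines n k" "T' \<in> turing_machines n k"
    and e: "compose (tm_configs n k) T T' = (\<lambda>c\<in>tm_configs n k. c)"
      "compose (tm_configs n k) T' T = (\<lambda>c\<in>tm_configs n k. c)"
    using assms by (auto simp: reversible_machines_def)
  have i: "T (T' c) = c" "T' (T c) = c" if "c \<in> tm_configs n k" for c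
    using that e by (metis compose_eq restrict_apply')+
  note F = turing_machine_funcset[OF T(1)] turing_machine_funcset[OF T(2)]
  have "bij_betw T (tm_configs n k) (tm_configs n k)"
    by (rule bij_betw_byWitness[of _ T']) (use i F in \<open>auto dest: PiE_mem\<close>)
  then show ?thesis using F by (simp add: Bij_def PiE_def)
qed

lemma reversible_machines_subgroup:
  assumes n: "n \<ge> 1"
  shows "subgroup (reversible_machines n k) (BijGroup (tm_configs n k))"
proof -
  let ?X = "tm_configs n k" and ?I = "\<lambda>c\<in>tm_configs n k. c"
  interpret B: group "BijGroup ?X" by (rule group_BijGroup)
  have mult: "S \<otimes>\<^bsub>BijGroup ?X\<^esub> T = compose ?X S T"
    if "S \<in> reversible_machines n k" "T \<in> reversible_machines n k" for S T
    using that by (simp add: BijGroup_def reversible_machine_Bij)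
  show ?thesis
  proof (rule B.subgroupI)
    show "reversible_machines n k \<subseteq> carrier (BijGroup ?X)"
      using reversible_machine_Bij by (auto simp: BijGroup_def)
    have "compose ?X ?I ?I = ?I" by (auto simp: compose_def)
    then have "?I \<in> reversible_machines n k"
      using turing_machine_id[OF n] by (auto simp: reversible_machines_def)
    then show "reversible_machines n k \<noteq> {}" by blast
  next
    fix T :: "'a tm_config \<Rightarrow> 'a tm_config" assume T: "T \<in> reversible_machines n k"
    then obtain T' where T': "T' \<in> reversible_machines n k" "compose ?X T' T = ?I"
      by (auto simp: reversible_machines_def)
    have "inv\<^bsub>BijGroup ?X\<^esub> T = T'"
    proof (rule B.inv_equality)
      show "T' \<otimes>\<^bsub>BijGroup ?X\<^esub> T = \<one>\<^bsub>BijGroup ?X\<^esub>"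
        using mult[OF T'(1) T] T'(2) by (simp add: BijGroup_def)
    qed (use T T' reversible_machine_Bij in \<open>auto simp: BijGroup_def\<close>)
    with T' show "inv\<^bsub>BijGroup ?X\<^esub> T \<in> reversible_machines n k" by simp
  next
    fix S T :: "'a tm_config \<Rightarrow> 'a tm_config"
    assume S: "S \<in> reversible_machines n k" and T: "T \<in> reversible_machines n k"
    obtain S' where S': "S' \<in> turing_machines n k" "compose ?X S S' = ?I" "compose ?X S' S = ?I"
      using S by (auto simp: reversible_machines_def)
    obtain T' where T': "T' \<in> turing_machines n k" "compose ?X T T' = ?I" "compose ?X T' T = ?I"
      using T by (auto simp: reversible_machines_def)
    have t: "S \<in> turing_machines n k" "T \<in> turing_machines n k"
      using S T by (auto simp: reversible_machines_def)
    have i: "S (S' c) = c" "S' (S c) = c" "T (T' c) = c" "T' (T c) = c" if "c \<in> ?X" for c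
      using that S' T' by (metis compose_eq restrict_apply')+
    have F: "S c \<in> ?X" "S' c \<in> ?X" "T c \<in> ?X" "T' c \<in> ?X" if "c \<in> ?X" for c
      using that turing_machine_funcset t S'(1) T'(1) by (blast dest: PiE_mem)+
    have "compose ?X (compose ?X S T) (compose ?X T' S') = ?I"
      "compose ?X (compose ?X T' S') (compose ?X S T) = ?I"
      using i F by (auto simp: compose_def restrict_def fun_eq_iff)
    then have "compose ?X S T \<in> reversible_machines n k"
      using turing_machine_compose[OF n t] turing_machine_compose[OF n T'(1) S'(1)]
      unfolding reversible_machines_def by blast
    then show "S \<otimes>\<^bsub>BijGroup ?X\<^esub> T \<in> reversible_machines n k" using mult[OF S T] by simp
  qed
qed

theorem group_RTM: "n \<ge> 1 \<Longrightarrow> group (RTM n k)"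
  unfolding RTM_def
  by (rule subgroup.subgroup_is_group[OF reversible_machines_subgroup group_BijGroup])

end

theory Submission
  imports Defs "HOL-Combinatorics.Permutations"
begin

text \<open>
  Write \<open>\<Sigma>\<close> for the set of symbols. The generators are all permutations of
  the contents of four cells together with the state, all permutations of the states, the machine
  that moves the head one cell to the right in state 1 only, and one swap that exchanges the head
  configurations (state \<open>k\<close>, cell \<open>v\<close>) and (state 1, cell \<open>v + 1\<close>) if the tape has \<open>01\<close> in the cells \<open>v\<close> and
  \<open>v + 1\<close>. Let \<open>G\<close> be the group that they generate. The interesting case is \<open>n \<ge> 2\<close>.

  \<^emph>\<open>Local permutations.\<close> \<open>G\<close> contains the shift of the head in all states, so windows may be
  translated. If \<open>G\<close> contains the even permutations of \<open>\<Sigma> \<times> P\<close> and of \<open>P \<times> \<Sigma>\<close>, where \<open>P\<close> consists of the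
  patterns of \<open>m - 1\<close> cells with the state, then commutators of 3-cycles and conjugation yield all
  even permutations of \<open>\<Sigma> \<times> P \<times> \<Sigma>\<close> (\<open>even_transpositions_product\<close>). Hence, starting from
  four cells, \<open>G\<close> contains the even permutations of all longer intervals. Odd permutations follow by a parity argument (\<open>interval_full\<close>): for
  even \<open>n\<close> each permutation becomes even when one more cell is taken into account, and for odd \<open>n\<close>
  a transposition on four cells remains odd on longer intervals.

  \<^emph>\<open>Conditional swaps.\<close> For a fixed tape, the pairs of state and cell are ordered lexicographically,
  like the integers. Let \<open>N\<close> be the successor map. A conditional swap exchanges \<open>c\<close> and \<open>N c\<close> for all
  \<open>c\<close> in a set \<open>C\<close> that is determined by a finite window and is disjoint from its image under \<open>N\<close>.
  All of these are in \<open>G\<close> (\<open>local_swap_mem\<close>). It suffices to consider a single pattern. If the pattern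
  has a state below \<open>k\<close>, the swap is a local permutation. If it extends the marker \<open>01\<close>, it
  is obtained from the swap among the generators and a transposition of patterns
  (\<open>conjugated_product_of_involutions\<close>). Any other swap is conjugate to one of these, by a local
  permutation and its conjugate by \<open>N\<close> (\<open>cylinder_swap_conjugate\<close>).

  \<^emph>\<open>Finite-state automata.\<close> Such a machine permutes the integers, for each tape, with a displacement that
  is bounded and depends only on a finite window. After division by a machine that looks at the
  state only, it is the identity on the blank tape. Let \<open>D > 0\<close> be the maximal displacement. A long
  run of displacement \<open>D\<close> is impossible: blanking the tape to the right of it leaves an injective
  map with a flow to the right which is the identity far to the right. Swapping the last elements of
  all runs with their successors is a conditional swap, and shortens all runs
  (\<open>shorten_maximal_runs\<close>). So finitely many swaps decrease \<open>D\<close>, and once no displacement is positive,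
  the machine is the identity.
\<close>

section \<open>Even products of transpositions\<close>

text \<open>
  Sets of maps are closed under changes outside of \<open>Y\<close>. This allows machines to be handled
  as total functions, composed with \<open>\<circ>\<close>, instead of as extensional maps.
\<close>

locale function_monoid =
  fixes Y :: "'a set" and H :: "('a \<Rightarrow> 'a) set"
  assumes id_mem: "id \<in> H"
    and comp_mem: "f \<in> H \<Longrightarrow> g \<in> H \<Longrightarrow> f \<circ> g \<in> H"
    and cong_mem: "f \<in> H \<Longrightarrow> (\<And>y. y \<in> Y \<Longrightarrow> f y = g y) \<Longrightarrow> g \<in> H"

lemma conjugate_transpose:
  assumes "\<And>x. h (g x) = x" "\<And>x. g (h x) = x"
  shows "g \<circ> transpose x y \<circ> h = transpose (g x) (g y)"
proof
  fix z
  show "(g \<circ> transpose x y \<circ> h) z = transpose (g x) (g y) z"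
    using assms by (cases "z = g x"; cases "z = g y") (auto simp: transpose_def)
qed

text \<open>
  In the application \<open>P\<close> stands for the contents of an interval together with the state, and
  \<open>A\<close> and \<open>B\<close> stand for the contents of two further cells. Both lifts take the extra cell as
  first component of their argument, so that they are exchanged by exchanging the two cells.
\<close>

definition lift_left :: "('a \<times> 'p \<Rightarrow> 'a \<times> 'p) \<Rightarrow> 'a \<times> 'p \<times> 'b \<Rightarrow> 'a \<times> 'p \<times> 'b" where
  "lift_left f = (\<lambda>(a, p, b). case f (a, p) of (a', p') \<Rightarrow> (a', p', b))"

definition lift_right :: "('b \<times> 'p \<Rightarrow> 'b \<times> 'p) \<Rightarrow> 'a \<times> 'p \<times> 'b \<Rightarrow> 'a \<times> 'p \<times> 'b" where
  "lift_right f = (\<lambda>(a, p, b). case f (b, p) of (b', p') \<Rightarrow> (a, p', b'))"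

lemma lift_left_comp: "lift_left (f \<circ> g) = lift_left f \<circ> lift_left g"
  by (auto simp: lift_left_def fun_eq_iff split: prod.splits)

lemma lift_right_comp: "lift_right (f \<circ> g) = lift_right f \<circ> lift_right g"
  by (auto simp: lift_right_def fun_eq_iff split: prod.splits)

lemma lift_left_id [simp]: "lift_left id = id" "lift_right id = id"
  by (auto simp: lift_left_def lift_right_def)

lemma lift_left_apply: "f (a, p) = (a', p') \<Longrightarrow> lift_left f (a, p, b) = (a', p', b)"
  by (simp add: lift_left_def)

lemma lift_right_apply: "f (b, p) = (b', p') \<Longrightarrow> lift_right f (a, p, b) = (a, p', b')"
  by (simp add: lift_right_def)

lemma three_cycle_inverse:
  "(transpose x y \<circ> transpose y z) \<circ> (transpose y z \<circ> transpose x y) = id"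
  "(transpose y z \<circ> transpose x y) \<circ> (transpose x y \<circ> transpose y z) = id"
  by (simp_all add: fun_eq_iff)

text \<open>
  These maps generate the alternating group of a finite set. Working with products of two
  transpositions, overlapping or not, avoids both the sign and a case distinction between
  3-cycles and double transpositions.
\<close>

definition even_transpositions :: "'a set \<Rightarrow> ('a \<Rightarrow> 'a) set" where
  "even_transpositions Y = {transpose x y \<circ> transpose z w |x y z w.
     x \<in> Y \<and> y \<in> Y \<and> z \<in> Y \<and> w \<in> Y \<and> x \<noteq> y \<and> z \<noteq> w}"

lemma even_transpositionsI:
  "\<lbrakk>x \<in> Y; y \<in> Y; z \<in> Y; w \<in> Y; x \<noteq> y; z \<noteq> w\<rbrakk> \<Longrightarrow> transpose x y \<circ> transpose z w \<in> even_transpositions Y"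
  by (auto simp: even_transpositions_def)

text \<open>
  A transposition is a word of odd length in the star transpositions \<open>transpose u x\<close>, hence a
  product of two transpositions is a word of even length. It therefore suffices to produce
  pairs of star transpositions, and every such pair arises from the pairs that contain
  \<open>transpose u v\<close>.
\<close>

lemma (in function_monoid) even_transpositions_from_star:
  assumes uv: "u \<in> Y" "v \<in> Y" "u \<noteq> v"
    and star: "\<And>x. x \<in> Y \<Longrightarrow> x \<noteq> u \<Longrightarrow> x \<noteq> v \<Longrightarrow> transpose u v \<circ> transpose u x \<in> H"
  shows "even_transpositions Y \<subseteq> H"
proof -
  have a: "transpose u v \<circ> transpose u x \<in> H" if "x \<in> Y" "x \<noteq> u" for x
  proof (cases "x = v")
    case False then show ?thesis using star that by simp
  qed (use id_mem in \<open>simp add: id_def o_def\<close>)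
  have b: "transpose u x \<circ> transpose u v \<in> H" if "x \<in> Y" "x \<noteq> u" for x
  proof (cases "x = v")
    case False
    then have "transpose u x \<circ> transpose u v
        = (transpose u v \<circ> transpose u x) \<circ> (transpose u v \<circ> transpose u x)"
      using that uv by (auto simp: fun_eq_iff transpose_def)
    then show ?thesis using a that comp_mem by simp
  qed (use id_mem in \<open>simp add: id_def o_def\<close>)
  have c: "transpose u x \<circ> transpose u y \<in> H" if "x \<in> Y" "y \<in> Y" "x \<noteq> u" "y \<noteq> u" for x y
  proof -
    have "transpose u x \<circ> transpose u y
        = (transpose u x \<circ> transpose u v) \<circ> (transpose u v \<circ> transpose u y)"
      by (simp add: fun_eq_iff)
    then show ?thesis using a b that comp_mem by simp
  qed
  have d: "transpose u r \<circ> transpose x y \<in> H" if "x \<in> Y" "y \<in> Y" "r \<in> Y" "r \<noteq> u" "x \<noteq> y" for x y r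
  proof (cases "x = u \<or> y = u")
    case True
    then show ?thesis using c that by (metis transpose_commute)
  next
    case False
    then have "transpose u r \<circ> transpose x y
       = (transpose u r \<circ> transpose u x) \<circ> (transpose u y \<circ> transpose u x)"
      using that by (auto simp: fun_eq_iff transpose_def)
    then show ?thesis using c that comp_mem False by simp
  qed
  show ?thesis
  proof
    fix f assume "f \<in> even_transpositions Y"
    then obtain x y z w where f: "f = transpose x y \<circ> transpose z w"
      and m: "x \<in> Y" "y \<in> Y" "z \<in> Y" "w \<in> Y" "x \<noteq> y" "z \<noteq> w"
      by (auto simp: even_transpositions_def)
    have "f \<in> H" if "x \<noteq> u" "y \<noteq> u"
    proof -
      have "f = (transpose u x \<circ> transpose u y) \<circ> (transpose u x \<circ> transpose z w)"
        using that m unfolding f by (auto simp: fun_eq_iff transpose_def)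
      then show ?thesis using c d m that comp_mem by simp
    qed
    moreover have "f \<in> H" if "x = u" using d m f that by auto
    moreover have "f \<in> H" if "y = u" using d m f that by (metis transpose_commute)
    ultimately show "f \<in> H" by blast
  qed
qed

text \<open>
  Conjugation by a map that fixes \<open>u\<close> and \<open>v\<close> replaces only the third point of the 3-cycle on
  \<open>u\<close>, \<open>v\<close>, \<open>x\<close>.
\<close>

lemma (in function_monoid) star_move:
  assumes "transpose u v \<circ> transpose u x \<in> H" "g \<in> H" "h \<in> H"
    and inv: "h \<circ> g = id" "g \<circ> h = id" and "g u = u" "g v = v" "g x = y"
  shows "transpose u v \<circ> transpose u y \<in> H"
proof -
  have inv': "h (g z) = z" "g (h z) = z" for z using inv by (metis comp_apply id_apply)+
  have "g \<circ> (transpose u v \<circ> transpose u x) \<circ> h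
      = (g \<circ> transpose u v \<circ> h) \<circ> (g \<circ> transpose u x \<circ> h)"
    using inv' by (simp add: fun_eq_iff)
  also have "\<dots> = transpose u v \<circ> transpose u y"
    using conjugate_transpose[OF inv'] assms(6-8) by simp
  finally show ?thesis using comp_mem assms(1-3) by metis
qed

lemma card_ge_obtain_new:
  assumes "card P \<ge> 5" "finite P" "length xs \<le> 4"
  obtains r where "r \<in> P" "r \<notin> set xs"
proof -
  have "card (set xs) < card P" using assms card_length[of xs] by linarith
  then have "\<not> P \<subseteq> set xs" by (meson List.finite_set card_mono leD)
  then show ?thesis using that by blast
qed

locale product_function_monoid = function_monoid "A \<times> P \<times> B" H
  for A :: "'a set" and P :: "'p set" and B :: "'b set" and H

text \<open>
  If the supports of two permutations meet in a single point, their commutator is a 3-cycle.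
  A 3-cycle on \<open>{a} \<times> P\<close>, lifted, has support in \<open>{a} \<times> P \<times> B\<close>, and one on \<open>P \<times> {b}\<close> has
  support in \<open>A \<times> P \<times> {b}\<close>. If their \<open>P\<close>-components have one element in common, the lifts meet in
  one point. Together they use five elements of \<open>P\<close>. Conjugation by further lifted 3-cycles moves
  the third point of the resulting 3-cycle to any place.
\<close>

lemma (in product_function_monoid) even_transpositions_product:
  assumes finite: "finite A" "finite P" and P: "card P \<ge> 5" and ne: "A \<noteq> {}" "B \<noteq> {}"
    and left: "lift_left ` even_transpositions (A \<times> P) \<subseteq> H"
    and right: "lift_right ` even_transpositions (B \<times> P) \<subseteq> H"
    and finB: "finite B"
  shows "even_transpositions (A \<times> P \<times> B) \<subseteq> H"
proof -
  obtain a b where ab: "a \<in> A" "b \<in> B" using ne by blast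
  obtain p where p: "p \<in> P" using card_ge_obtain_new[OF P finite(2), of "[]"] by auto
  obtain p1 where p1: "p1 \<in> P" "p1 \<noteq> p" using card_ge_obtain_new[OF P finite(2), of "[p]"] by auto
  obtain p2 where p2: "p2 \<in> P" "p2 \<noteq> p" "p2 \<noteq> p1"
    using card_ge_obtain_new[OF P finite(2), of "[p, p1]"] by auto
  obtain r where r: "r \<in> P" "r \<noteq> p" "r \<noteq> p1" "r \<noteq> p2"
    using card_ge_obtain_new[OF P finite(2), of "[p, p1, p2]"] by auto
  obtain r' where r': "r' \<in> P" "r' \<noteq> p" "r' \<noteq> p1" "r' \<noteq> p2" "r' \<noteq> r"
    using card_ge_obtain_new[OF P finite(2), of "[p, p1, p2, r]"] by auto
  define u where "u = (a, p, b)"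
  define v where "v = (a, p1, b)"
  have L: "lift_left (transpose x y \<circ> transpose z w) \<in> H"
    if "x \<in> A \<times> P" "y \<in> A \<times> P" "z \<in> A \<times> P" "w \<in> A \<times> P" "x \<noteq> y" "z \<noteq> w" for x y z w
    using left even_transpositionsI[OF that] by blast
  have R: "lift_right (transpose x y \<circ> transpose z w) \<in> H"
    if "x \<in> B \<times> P" "y \<in> B \<times> P" "z \<in> B \<times> P" "w \<in> B \<times> P" "x \<noteq> y" "z \<noteq> w" for x y z w
    using right even_transpositionsI[OF that] by blast
  have base: "transpose u v \<circ> transpose u (a, p2, b) \<in> H"
  proof -
    let ?\<pi> = "lift_left (transpose (a, p) (a, p2) \<circ> transpose (a, p2) (a, r)) :: 'a \<times> 'p \<times> 'b \<Rightarrow> _"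
    let ?\<pi>' = "lift_left (transpose (a, p2) (a, r) \<circ> transpose (a, p) (a, p2)) :: 'a \<times> 'p \<times> 'b \<Rightarrow> _"
    let ?\<rho> = "lift_right (transpose (b, p) (b, p1) \<circ> transpose (b, p1) (b, r')) :: 'a \<times> 'p \<times> 'b \<Rightarrow> _"
    let ?\<rho>' = "lift_right (transpose (b, p1) (b, r') \<circ> transpose (b, p) (b, p1)) :: 'a \<times> 'p \<times> 'b \<Rightarrow> _"
    \<comment> \<open>the commutator of two 3-cycles: \<open>?\<pi>'\<close> and \<open>?\<rho>'\<close> are the inverses of \<open>?\<pi>\<close> and \<open>?\<rho>\<close>, and
      \<open>u\<close> is the only point that both of them move\<close>
    have "?\<pi> \<circ> ?\<rho> \<circ> ?\<pi>' \<circ> ?\<rho>' = transpose u v \<circ> transpose u (a, p2, b)"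
    proof
      fix z :: "'a \<times> 'p \<times> 'b"
      obtain c s d where z: "z = (c, s, d)" by (metis prod_cases3)
      show "(?\<pi> \<circ> ?\<rho> \<circ> ?\<pi>' \<circ> ?\<rho>') z = (transpose u v \<circ> transpose u (a, p2, b)) z"
      proof -
        note distinct = p1(2) p2(2,3) r(2-4) r'(2-5)
        note neq = distinct distinct [symmetric]
        consider "s = p" | "s = p1" | "s = p2" | "s = r" | "s = r'"
          | "s \<noteq> p" "s \<noteq> p1" "s \<noteq> p2" "s \<noteq> r" "s \<noteq> r'" by blast
        then show ?thesis
          unfolding z u_def v_def lift_left_def lift_right_def
          by cases (cases "c = a"; cases "d = b"; simp add: transpose_def neq split del: if_split)+
      qed
    qed
    moreover have "?\<pi> \<in> H" "?\<pi>' \<in> H" using L ab p p1 p2 r r' by auto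
    moreover have "?\<rho> \<in> H" "?\<rho>' \<in> H" using R ab p p1 p2 r r' by auto
    ultimately show ?thesis using comp_mem by metis
  qed
  have cardA: "card (A \<times> P) \<ge> 5" and cardB: "card (B \<times> P) \<ge> 5"
    using P finite finB ne mult_le_mono[of 1 "card A" 5 "card P"] mult_le_mono[of 1 "card B" 5 "card P"]
    by (auto simp: card_cartesian_product Suc_le_eq card_gt_0_iff)
  \<comment> \<open>Only even permutations are available, so the transposition that moves \<open>(c, s)\<close> is completed
    to a 3-cycle by a point \<open>e\<close> that is distinct from the points to be fixed.\<close>
  have move_left: "transpose u v \<circ> transpose u (c', s', d) \<in> H"
    if "transpose u v \<circ> transpose u (c, s, d) \<in> H" "(c, s) \<in> A \<times> P" "(c', s') \<in> A \<times> P"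
      "(c, s) \<notin> {(a, p), (a, p1)}" "(c', s') \<notin> {(a, p), (a, p1)}" for c s c' s' d
  proof (cases "(c, s) = (c', s')")
    case False
    obtain e where e: "e \<in> A \<times> P" and "e \<notin> set [(a, p), (a, p1), (c, s), (c', s')]"
      by (rule card_ge_obtain_new[OF cardA, of "[(a, p), (a, p1), (c, s), (c', s')]"]) (use finite in simp_all)
    then have e': "e \<noteq> (a, p)" "e \<noteq> (a, p1)" "e \<noteq> (c, s)" "e \<noteq> (c', s')" by simp_all
    show ?thesis
    proof (rule star_move[OF that(1)])
      show "lift_left (transpose (c, s) (c', s') \<circ> transpose (c', s') e) \<in> H"
        "lift_left (transpose (c', s') e \<circ> transpose (c, s) (c', s')) \<in> H"
        using L e e' that(2,3) False by (metis (no_types))+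
      show "lift_left (transpose (c, s) (c', s') \<circ> transpose (c', s') e) u = u" "lift_left (transpose (c, s) (c', s') \<circ> transpose (c', s') e) v = v"
        unfolding u_def v_def using e' that(4,5) by (intro lift_left_apply; auto simp: transpose_def)+
      show "lift_left (transpose (c, s) (c', s') \<circ> transpose (c', s') e) (c, s, d) = (c', s', d)"
        using e' False by (intro lift_left_apply) (simp add: transpose_def)
    qed (simp_all only: lift_left_comp [symmetric] three_cycle_inverse lift_left_id)
  qed (use that in simp)
  have move_right: "transpose u v \<circ> transpose u (c, s', d') \<in> H"
    if "transpose u v \<circ> transpose u (c, s, d) \<in> H" "(d, s) \<in> B \<times> P" "(d', s') \<in> B \<times> P"
      "(d, s) \<notin> {(b, p), (b, p1)}" "(d', s') \<notin> {(b, p), (b, p1)}" for c s s' d d'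
  proof (cases "(d, s) = (d', s')")
    case False
    obtain e where e: "e \<in> B \<times> P" and "e \<notin> set [(b, p), (b, p1), (d, s), (d', s')]"
      by (rule card_ge_obtain_new[OF cardB, of "[(b, p), (b, p1), (d, s), (d', s')]"]) (use finite finB in simp_all)
    then have e': "e \<noteq> (b, p)" "e \<noteq> (b, p1)" "e \<noteq> (d, s)" "e \<noteq> (d', s')" by simp_all
    show ?thesis
    proof (rule star_move[OF that(1)])
      show "lift_right (transpose (d, s) (d', s') \<circ> transpose (d', s') e) \<in> H"
        "lift_right (transpose (d', s') e \<circ> transpose (d, s) (d', s')) \<in> H"
        using R e e' that(2,3) False by (metis (no_types))+
      show "lift_right (transpose (d, s) (d', s') \<circ> transpose (d', s') e) u = u" "lift_right (transpose (d, s) (d', s') \<circ> transpose (d', s') e) v = v"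
        unfolding u_def v_def using e' that(4,5) by (intro lift_right_apply; auto simp: transpose_def)+
      show "lift_right (transpose (d, s) (d', s') \<circ> transpose (d', s') e) (c, s, d) = (c, s', d')"
        using e' False by (intro lift_right_apply) (simp add: transpose_def)
    qed (simp_all only: lift_right_comp [symmetric] three_cycle_inverse lift_left_id)
  qed (use that in simp)
  show ?thesis
  proof (rule even_transpositions_from_star)
    show "u \<in> A \<times> P \<times> B" "v \<in> A \<times> P \<times> B" "u \<noteq> v" using ab p p1 by (auto simp: u_def v_def)
    fix x assume x: "x \<in> A \<times> P \<times> B" "x \<noteq> u" "x \<noteq> v"
    obtain c s d where csd: "x = (c, s, d)" "c \<in> A" "s \<in> P" "d \<in> B" using x by auto
    show "transpose u v \<circ> transpose u x \<in> H"
    proof (cases "d = b \<and> s \<in> {p, p1}")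
      case True
      \<comment> \<open>a move on the right would hit \<open>u\<close> or \<open>v\<close>, but here the left components differ\<close>
      then have "c \<noteq> a" using x csd by (auto simp: u_def v_def)
      then show ?thesis
        using move_left[OF base, of c s] ab p2 csd True by auto
    next
      case False
      have "transpose u v \<circ> transpose u (c, p2, b) \<in> H"
        using move_left[OF base, of c p2] ab p2 csd by auto
      from move_right[OF this, of d s] show ?thesis using ab p2 csd False by auto
    qed
  qed
qed

text \<open>
  The lift of a transposition is a product of \<open>card B\<close> disjoint transpositions, one for each value
  of the coordinate that is left alone. It is even or odd accordingly.
\<close>

lemma (in product_function_monoid) lift_left_transpose_parity:
  assumes even: "even_transpositions (A \<times> P \<times> B) \<subseteq> H" and fin: "finite B"
    and xy: "x \<in> A \<times> P" "y \<in> A \<times> P" "x \<noteq> y"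
    and zw: "z \<in> A \<times> P \<times> B" "w \<in> A \<times> P \<times> B" "z \<noteq> w"
  shows "if even (card B) then lift_left (transpose x y) \<in> H
    else transpose z w \<circ> lift_left (transpose x y) \<in> H"
proof -
  define f :: "'b set \<Rightarrow> 'a \<times> 'p \<times> 'b \<Rightarrow> 'a \<times> 'p \<times> 'b" where
    "f S = (\<lambda>(a, p, b). if b \<in> S then lift_left (transpose x y) (a, p, b) else (a, p, b))" for S
  obtain xa xp ya yp where e: "x = (xa, xp)" "y = (ya, yp)" by (metis surj_pair)
  have "\<forall>z w. z \<in> A \<times> P \<times> B \<longrightarrow> w \<in> A \<times> P \<times> B \<longrightarrow> z \<noteq> w \<longrightarrow>
     (if even (card S) then f S \<in> H else transpose z w \<circ> f S \<in> H)" if "finite S" "S \<subseteq> B" for S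
    using that
  proof (induction S rule: finite_induct)
    case empty
    have "f {} = id" by (auto simp: f_def fun_eq_iff)
    then show ?case using id_mem by simp
  next
    case (insert s S)
    let ?t = "transpose (xa, xp, s) (ya, yp, s)"
    have eq: "f (insert s S) = ?t \<circ> f S"
    proof
      fix v :: "'a \<times> 'p \<times> 'b"
      obtain c q d where v: "v = (c, q, d)" by (metis prod_cases3)
      show "f (insert s S) v = (?t \<circ> f S) v"
        unfolding v using insert.hyps xy(3)
        by (cases "d = s"; cases "d \<in> S"; cases "(c, q) = x"; cases "(c, q) = y")
          (auto simp: f_def lift_left_def transpose_def e)
    qed
    have s: "s \<in> B" "(xa, xp, s) \<in> A \<times> P \<times> B" "(ya, yp, s) \<in> A \<times> P \<times> B" "(xa, xp, s) \<noteq> (ya, yp, s)"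
      using insert.prems xy e by auto
    show ?case
    proof (cases "even (card S)")
      case True
      then have "f S \<in> H" using insert.IH insert.prems s(2-4) by auto
      then have "transpose z w \<circ> f (insert s S) \<in> H"
        if "z \<in> A \<times> P \<times> B" "w \<in> A \<times> P \<times> B" "z \<noteq> w" for z w
        using comp_mem[of "transpose z w \<circ> ?t" "f S"] even even_transpositionsI[OF that(1,2) s(2,3) that(3) s(4)]
        unfolding eq comp_assoc by blast
      then show ?thesis using True insert.hyps by simp
    next
      case False
      then have "?t \<circ> f S \<in> H" using insert s by auto
      then show ?thesis using False insert.hyps eq by simp
    qed
  qed
  from this[OF fin order_refl] have "if even (card B) then f B \<in> H else transpose z w \<circ> f B \<in> H"
    using zw by blast
  moreover have "f B v = lift_left (transpose x y) v" if "v \<in> A \<times> P \<times> B" for v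
    using that by (auto simp: f_def)
  ultimately show ?thesis using cong_mem by (auto split: if_splits)
qed

section \<open>Maps that act on a window around the head\<close>

text \<open>
  Cells of a window are counted from the head position. Reading and writing a window obey the
  usual laws (a written pattern is read back, the last write wins, and writing what is read
  changes nothing), which make \<open>window_map W\<close> multiplicative.
\<close>

definition patterns :: "nat \<Rightarrow> nat \<Rightarrow> int set \<Rightarrow> ((int \<Rightarrow> nat) \<times> nat) set" where
  "patterns n k W = (W \<rightarrow>\<^sub>E tape_symbols n) \<times> tm_states k"

definition read_window :: "int set \<Rightarrow> int tm_config \<Rightarrow> (int \<Rightarrow> nat) \<times> nat" where
  "read_window W = (\<lambda>(x, q, v). (\<lambda>u\<in>W. x (v + u), q))"

definition write_window :: "int set \<Rightarrow> (int \<Rightarrow> nat) \<times> nat \<Rightarrow> int tm_config \<Rightarrow> int tm_config" where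
  "write_window W = (\<lambda>(p, q') (x, q, v). (\<lambda>u. if u - v \<in> W then p (u - v) else x u, q', v))"

definition window_map ::
    "int set \<Rightarrow> ((int \<Rightarrow> nat) \<times> nat \<Rightarrow> (int \<Rightarrow> nat) \<times> nat) \<Rightarrow> int tm_config \<Rightarrow> int tm_config" where
  "window_map W \<phi> c = write_window W (\<phi> (read_window W c)) c"

lemma even_transpositionsE:
  assumes "f \<in> even_transpositions Y"
  obtains x y z w where "f = transpose x y \<circ> transpose z w" "x \<in> Y" "y \<in> Y" "z \<in> Y" "w \<in> Y"
    "x \<noteq> y" "z \<noteq> w"
  using assms unfolding even_transpositions_def mem_Collect_eq by (elim exE conjE) (rule that)

lemma restrict_eqI:
  assumes "r \<in> M \<rightarrow>\<^sub>E S" "\<And>u. u \<in> M \<Longrightarrow> f u = r u"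
  shows "restrict f M = r"
proof
  fix u show "restrict f M u = r u"
    using assms by (cases "u \<in> M") (simp_all add: PiE_def extensional_def)
qed

lemma finite_patterns: "finite W \<Longrightarrow> finite (patterns n k W)"
  by (auto simp: patterns_def tape_symbols_def tm_states_def intro: finite_PiE)

lemma card_patterns: "finite W \<Longrightarrow> card (patterns n k W) = n ^ card W * k"
  by (simp add: patterns_def card_cartesian_product card_PiE tape_symbols_def tm_states_def)

lemma read_window_patterns: "c \<in> tm_configs n k \<Longrightarrow> read_window W c \<in> patterns n k W"
  by (auto simp: read_window_def patterns_def tm_configs_def PiE_iff)

lemma write_window_configs:
  "c \<in> tm_configs n k \<Longrightarrow> i \<in> patterns n k W \<Longrightarrow> write_window W i c \<in> tm_configs n k"
  by (auto simp: write_window_def patterns_def tm_configs_def PiE_iff)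

lemma read_write_window: "i \<in> patterns n k W \<Longrightarrow> read_window W (write_window W i c) = i"
proof -
  assume i: "i \<in> patterns n k W"
  obtain p q' where i': "i = (p, q')" by (rule prod.exhaust)
  obtain x q v where c: "c = (x, q, v)" by (rule prod_cases3)
  have "(\<lambda>u\<in>W. p u) = p"
    by (rule restrict_eqI[where S = "tape_symbols n"]) (use i in \<open>auto simp: i' patterns_def\<close>)
  then show ?thesis by (simp add: i' c write_window_def read_window_def cong: restrict_cong)
qed

lemma write_write_window: "write_window W i (write_window W j c) = write_window W i c"
  by (auto simp: write_window_def split: prod.splits)

lemma write_read_window: "write_window W (read_window W c) c = c"
  by (auto simp: write_window_def read_window_def split: prod.splits)

lemma window_map_comp:
  assumes "c \<in> tm_configs n k" "\<psi> ` patterns n k W \<subseteq> patterns n k W"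
  shows "window_map W \<phi> (window_map W \<psi> c) = window_map W (\<phi> \<circ> \<psi>) c"
  using assms read_window_patterns[OF assms(1), of W]
  by (auto simp: window_map_def write_write_window read_write_window[of _ n k] image_subset_iff)

lemma window_map_cong:
  assumes "c \<in> tm_configs n k" "\<And>i. i \<in> patterns n k W \<Longrightarrow> \<phi> i = \<psi> i"
  shows "window_map W \<phi> c = window_map W \<psi> c"
  using assms read_window_patterns[OF assms(1), of W] by (simp add: window_map_def)

lemma window_map_configs:
  assumes "c \<in> tm_configs n k" "\<phi> ` patterns n k W \<subseteq> patterns n k W"
  shows "window_map W \<phi> c \<in> tm_configs n k"
  using assms read_window_patterns[OF assms(1), of W] write_window_configs[OF assms(1)]
  by (auto simp: window_map_def image_subset_iff)

lemma window_map_id: "window_map W id = id"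
  by (simp add: window_map_def write_read_window fun_eq_iff)

lemma transpose_mem: "x \<in> S \<Longrightarrow> y \<in> S \<Longrightarrow> i \<in> S \<Longrightarrow> transpose x y i \<in> S"
  by (simp add: transpose_def)

lemma transpose_maps: "x \<in> S \<Longrightarrow> y \<in> S \<Longrightarrow> transpose x y ` S \<subseteq> S"
  by (auto simp: transpose_def)

lemma even_transpositions_maps: "f \<in> even_transpositions S \<Longrightarrow> f ` S \<subseteq> S"
  by (auto simp: even_transpositions_def transpose_def)

text \<open>
  In the end \<open>G\<close> will consist of the maps that agree on configurations with an element of a finitely
  generated group of machines. As these are injective on configurations, a right inverse is an
  inverse.
\<close>

locale machine_group = function_monoid "tm_configs n k :: int tm_config set" G
  for n k :: nat and G :: "(int tm_config \<Rightarrow> int tm_config) set" +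
  assumes inv_mem: "f \<in> G \<Longrightarrow> (\<And>c. c \<in> tm_configs n k \<Longrightarrow> g c \<in> tm_configs n k) \<Longrightarrow>
      (\<And>c. c \<in> tm_configs n k \<Longrightarrow> f (g c) = c) \<Longrightarrow> g \<in> G"

section \<open>From two overlapping windows to their union\<close>

text \<open>
  Patterns of a window are split into the contents of one or two distinguished cells and a pattern
  of the remaining cells \<open>M\<close>, the state being part of the latter.
\<close>

definition pair_pattern :: "int \<Rightarrow> int set \<Rightarrow> nat \<times> (int \<Rightarrow> nat) \<times> nat \<Rightarrow> (int \<Rightarrow> nat) \<times> nat" where
  "pair_pattern a M = (\<lambda>(s, r, q). (\<lambda>u\<in>insert a M. if u = a then s else r u, q))"

definition pattern_pair :: "int \<Rightarrow> int set \<Rightarrow> (int \<Rightarrow> nat) \<times> nat \<Rightarrow> nat \<times> (int \<Rightarrow> nat) \<times> nat" where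
  "pattern_pair a M = (\<lambda>(p, q). (p a, restrict p M, q))"

definition triple_pattern ::
    "int \<Rightarrow> int \<Rightarrow> int set \<Rightarrow> nat \<times> ((int \<Rightarrow> nat) \<times> nat) \<times> nat \<Rightarrow> (int \<Rightarrow> nat) \<times> nat" where
  "triple_pattern a b M = (\<lambda>(s, (r, q), t).
     (\<lambda>u\<in>insert a (insert b M). if u = a then s else if u = b then t else r u, q))"

definition pattern_triple ::
    "int \<Rightarrow> int \<Rightarrow> int set \<Rightarrow> (int \<Rightarrow> nat) \<times> nat \<Rightarrow> nat \<times> ((int \<Rightarrow> nat) \<times> nat) \<times> nat" where
  "pattern_triple a b M = (\<lambda>(p, q). (p a, (restrict p M, q), p b))"

lemma pair_pattern_mem:
  "z \<in> tape_symbols n \<times> patterns n k M \<Longrightarrow> pair_pattern a M z \<in> patterns n k (insert a M)"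
  by (auto simp: pair_pattern_def patterns_def PiE_iff split: if_splits)

lemma pattern_pair_mem:
  "i \<in> patterns n k (insert a M) \<Longrightarrow> pattern_pair a M i \<in> tape_symbols n \<times> patterns n k M"
  by (auto simp: pattern_pair_def patterns_def PiE_iff)

lemma pattern_pair_pattern:
  assumes "a \<notin> M" "z \<in> tape_symbols n \<times> patterns n k M"
  shows "pattern_pair a M (pair_pattern a M z) = z"
proof -
  obtain s r q where z: "z = (s, r, q)" by (rule prod_cases3)
  have "restrict (\<lambda>u\<in>insert a M. if u = a then s else r u) M = r"
    by (rule restrict_eqI[where S = "tape_symbols n"]) (use assms in \<open>auto simp: z patterns_def\<close>)
  then show ?thesis by (simp add: z pair_pattern_def pattern_pair_def)
qed

lemma pair_pattern_pair:
  assumes "i \<in> patterns n k (insert a M)"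
  shows "pair_pattern a M (pattern_pair a M i) = i"
proof -
  obtain p q where i: "i = (p, q)" by (rule prod.exhaust)
  have "restrict (\<lambda>u. if u = a then p a else restrict p M u) (insert a M) = p"
    by (rule restrict_eqI[where S = "tape_symbols n"]) (use assms in \<open>auto simp: i patterns_def\<close>)
  then show ?thesis by (simp add: i pair_pattern_def pattern_pair_def)
qed

lemma triple_pattern_mem:
  "z \<in> tape_symbols n \<times> patterns n k M \<times> tape_symbols n
    \<Longrightarrow> triple_pattern a b M z \<in> patterns n k (insert a (insert b M))"
  by (auto simp: triple_pattern_def patterns_def PiE_iff split: if_splits)

lemma pattern_triple_mem:
  "i \<in> patterns n k (insert a (insert b M))
    \<Longrightarrow> pattern_triple a b M i \<in> tape_symbols n \<times> patterns n k M \<times> tape_symbols n"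
  by (auto simp: pattern_triple_def patterns_def PiE_iff)

lemma pattern_triple_pattern:
  assumes "a \<notin> M" "b \<notin> M" "a \<noteq> b" "z \<in> tape_symbols n \<times> patterns n k M \<times> tape_symbols n"
  shows "pattern_triple a b M (triple_pattern a b M z) = z"
proof -
  obtain s r q t where z: "z = (s, (r, q), t)" by (metis surj_pair)
  have "restrict (\<lambda>u\<in>insert a (insert b M). if u = a then s else if u = b then t else r u) M = r"
    by (rule restrict_eqI[where S = "tape_symbols n"]) (use assms in \<open>auto simp: z patterns_def\<close>)
  then show ?thesis using assms(3) by (simp add: z triple_pattern_def pattern_triple_def)
qed

lemma triple_pattern_triple:
  assumes "i \<in> patterns n k (insert a (insert b M))"
  shows "triple_pattern a b M (pattern_triple a b M i) = i"
proof -
  obtain p q where i: "i = (p, q)" by (rule prod.exhaust)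
  have "restrict (\<lambda>u. if u = a then p a else if u = b then p b else restrict p M u)
      (insert a (insert b M)) = p"
    by (rule restrict_eqI[where S = "tape_symbols n"]) (use assms in \<open>auto simp: i patterns_def\<close>)
  then show ?thesis by (simp add: i triple_pattern_def pattern_triple_def)
qed

lemma transpose_transport:
  assumes "d (e x) = x" "d (e y) = y" "e (d i) = i"
  shows "e (transpose x y (d i)) = transpose (e x) (e y) i"
  using assms by (cases "d i = x"; cases "d i = y") (auto simp: transpose_def)

text \<open>
  In these coordinates, regarding a map on a window as a map on a window with one more cell means
  lifting it.
\<close>

lemma window_map_lift_left:
  assumes "a \<notin> M" "b \<notin> M" "a \<noteq> b"
  shows "window_map (insert a (insert b M)) (triple_pattern a b M \<circ> lift_left \<phi> \<circ> pattern_triple a b M) c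
    = window_map (insert a M) (pair_pattern a M \<circ> \<phi> \<circ> pattern_pair a M) c"
proof -
  obtain x q v where c: "c = (x, q, v)" by (rule prod_cases3)
  have M: "insert a (insert b M) \<inter> M = M" "insert a M \<inter> M = M" by auto
  obtain s r q' where e: "\<phi> (x (v + a), restrict (\<lambda>u. x (v + u)) M, q) = (s, r, q')"
    by (rule prod_cases3)
  have "(if u - v \<in> insert a (insert b M)
        then if u - v = a then s else if u - v = b then x (v + b) else r (u - v) else x u)
      = (if u - v \<in> insert a M then if u - v = a then s else r (u - v) else x u)" for u
    using assms(1-3) by auto
  then show ?thesis
    by (simp add: window_map_def read_window_def c pattern_triple_def pattern_pair_def M e
        lift_left_def triple_pattern_def pair_pattern_def write_window_def cong: if_cong)
qed

lemma triple_pattern_swap: "triple_pattern a b M (s, i, t) = triple_pattern b a M (t, i, s)"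
  if "a \<noteq> b"
proof -
  obtain r q where i: "i = (r, q)" by (rule prod.exhaust)
  have "(if u = a then s else if u = b then t else r u) = (if u = b then t else if u = a then s else r u)" for u
    using that by simp
  then show ?thesis by (simp add: triple_pattern_def i insert_commute)
qed

lemma window_map_lift_right:
  assumes "a \<notin> M" "b \<notin> M" "a \<noteq> b"
  shows "window_map (insert a (insert b M)) (triple_pattern a b M \<circ> lift_right \<phi> \<circ> pattern_triple a b M) c
    = window_map (insert b M) (pair_pattern b M \<circ> \<phi> \<circ> pattern_pair b M) c"
proof -
  have "triple_pattern a b M \<circ> lift_right \<phi> \<circ> pattern_triple a b M
     = triple_pattern b a M \<circ> lift_left \<phi> \<circ> pattern_triple b a M"
    using triple_pattern_swap[OF assms(3)]
    by (intro ext) (simp add: lift_left_def lift_right_def pattern_triple_def split: prod.split)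
  then show ?thesis
    using window_map_lift_left[of b M a] assms by (simp add: insert_commute)
qed

context machine_group
begin

text \<open>
  An extra cell with an even number \<open>n\<close> of symbols turns every permutation of a window into an even
  permutation of the enlarged window. The induction on the length of windows is therefore
  carried out for even permutations.
\<close>

definition even_window :: "int set \<Rightarrow> bool" where
  "even_window W \<longleftrightarrow> window_map W ` even_transpositions (patterns n k W) \<subseteq> G"

definition full_window :: "int set \<Rightarrow> bool" where
  "full_window W \<longleftrightarrow> (\<forall>i\<in>patterns n k W. \<forall>j\<in>patterns n k W. window_map W (transpose i j) \<in> G)"

lemma window_map_comp_mem:
  assumes "window_map W \<phi> \<in> G" "window_map W \<psi> \<in> G" "\<psi> ` patterns n k W \<subseteq> patterns n k W"
  shows "window_map W (\<phi> \<circ> \<psi>) \<in> G"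
  using cong_mem[OF comp_mem[OF assms(1,2)]] window_map_comp[OF _ assms(3)] by simp

lemma full_window_permutes:
  assumes "full_window W" "finite W" "\<pi> permutes patterns n k W"
  shows "window_map W \<pi> \<in> G"
  using assms(3) finite_patterns[OF assms(2)]
proof (induction rule: permutes_induct)
  case id
  show ?case using id_mem by (simp add: window_map_id flip: id_def)
next
  case (swap i j \<pi>)
  then show ?case
    using assms(1) by (intro window_map_comp_mem) (auto simp: full_window_def permutes_in_image)
qed

lemma full_window_imp_even: "full_window W \<Longrightarrow> even_window W"
  unfolding even_window_def even_transpositions_def full_window_def
  using window_map_comp_mem[OF _ _ transpose_maps] by blast

text \<open>
  The pull-back of \<open>G\<close> along the coordinates for two distinguished cells.
\<close>

definition product_maps :: "int \<Rightarrow> int \<Rightarrow> int set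
    \<Rightarrow> (nat \<times> ((int \<Rightarrow> nat) \<times> nat) \<times> nat \<Rightarrow> nat \<times> ((int \<Rightarrow> nat) \<times> nat) \<times> nat) set" where
  "product_maps a b M = {\<phi>.
     \<phi> ` (tape_symbols n \<times> patterns n k M \<times> tape_symbols n) \<subseteq> tape_symbols n \<times> patterns n k M \<times> tape_symbols n \<and>
     window_map (insert a (insert b M)) (triple_pattern a b M \<circ> \<phi> \<circ> pattern_triple a b M) \<in> G}"

lemma product_maps_monoid:
  assumes ab: "a \<notin> M" "b \<notin> M" "a \<noteq> b"
  shows "product_function_monoid (tape_symbols n) (patterns n k M) (tape_symbols n) (product_maps a b M)"
proof unfold_locales
  let ?Y = "tape_symbols n \<times> patterns n k M \<times> tape_symbols n" and ?W = "insert a (insert b M)"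
  let ?e = "triple_pattern a b M" and ?d = "pattern_triple a b M"
  have cong: "window_map ?W \<psi> \<in> G" if "window_map ?W \<phi> \<in> G" "\<And>i. i \<in> patterns n k ?W \<Longrightarrow> \<phi> i = \<psi> i" for \<phi> \<psi>
    using cong_mem[OF that(1)] window_map_cong that(2) by blast
  have "window_map ?W id \<in> G" by (simp add: window_map_id id_mem)
  then have "window_map ?W (?e \<circ> id \<circ> ?d) \<in> G"
    by (rule cong) (simp add: triple_pattern_triple)
  then show "id \<in> product_maps a b M" by (simp add: product_maps_def)
  have maps: "f y \<in> ?Y" if "f \<in> product_maps a b M" "y \<in> ?Y" for f y
    using that unfolding product_maps_def by blast
  have mem: "window_map ?W (?e \<circ> f \<circ> ?d) \<in> G" if "f \<in> product_maps a b M" for f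
    using that unfolding product_maps_def by blast
  have intro: "f \<in> product_maps a b M"
    if "\<And>y. y \<in> ?Y \<Longrightarrow> f y \<in> ?Y" "window_map ?W (?e \<circ> f \<circ> ?d) \<in> G" for f
    using that unfolding product_maps_def by blast
  fix f g
  assume f: "f \<in> product_maps a b M"
  show "g \<in> product_maps a b M" if eq: "\<And>y. y \<in> ?Y \<Longrightarrow> f y = g y"
  proof (rule intro)
    show "g y \<in> ?Y" if "y \<in> ?Y" for y using maps[OF f that] eq[OF that] by simp
    show "window_map ?W (?e \<circ> g \<circ> ?d) \<in> G"
      by (rule cong[OF mem[OF f]]) (simp add: eq[OF pattern_triple_mem])
  qed
  assume g: "g \<in> product_maps a b M"
  have "window_map ?W ((?e \<circ> f \<circ> ?d) \<circ> (?e \<circ> g \<circ> ?d)) \<in> G"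
  proof (rule window_map_comp_mem[OF mem[OF f] mem[OF g]], rule image_subsetI)
    fix i assume "i \<in> patterns n k ?W"
    then show "(?e \<circ> g \<circ> ?d) i \<in> patterns n k ?W"
      using triple_pattern_mem[OF maps[OF g pattern_triple_mem]] by simp
  qed
  then have fg: "window_map ?W (?e \<circ> (f \<circ> g) \<circ> ?d) \<in> G"
  proof (rule cong)
    fix i assume "i \<in> patterns n k ?W"
    then show "((?e \<circ> f \<circ> ?d) \<circ> (?e \<circ> g \<circ> ?d)) i = (?e \<circ> (f \<circ> g) \<circ> ?d) i"
      using pattern_triple_pattern[OF ab maps[OF g pattern_triple_mem]] by simp
  qed
  show "f \<circ> g \<in> product_maps a b M"
    by (rule intro[OF _ fg]) (simp only: comp_apply maps[OF f maps[OF g]])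
qed

lemma lift_left_maps:
  assumes "\<phi> ` (A \<times> P) \<subseteq> A \<times> P"
  shows "lift_left \<phi> ` (A \<times> P \<times> B) \<subseteq> A \<times> P \<times> B"
proof (rule image_subsetI)
  fix z assume "z \<in> A \<times> P \<times> B"
  then obtain s i t where z: "z = (s, i, t)" "(s, i) \<in> A \<times> P" "t \<in> B" by blast
  then have "\<phi> (s, i) \<in> A \<times> P" using assms by blast
  then show "lift_left \<phi> z \<in> A \<times> P \<times> B"
    using z by (cases "\<phi> (s, i)") (simp add: lift_left_def)
qed

lemma lift_right_maps:
  assumes "\<phi> ` (B \<times> P) \<subseteq> B \<times> P"
  shows "lift_right \<phi> ` (A \<times> P \<times> B) \<subseteq> A \<times> P \<times> B"
proof (rule image_subsetI)
  fix z assume "z \<in> A \<times> P \<times> B"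
  then obtain s i t where z: "z = (s, i, t)" "s \<in> A" "(t, i) \<in> B \<times> P" by blast
  then have "\<phi> (t, i) \<in> B \<times> P" using assms by blast
  then show "lift_right \<phi> z \<in> A \<times> P \<times> B"
    using z by (cases "\<phi> (t, i)") (simp add: lift_right_def)
qed

lemma lift_left_product_maps:
  assumes ab: "a \<notin> M" "b \<notin> M" "a \<noteq> b"
    and \<phi>: "\<phi> ` (tape_symbols n \<times> patterns n k M) \<subseteq> tape_symbols n \<times> patterns n k M"
    and G: "window_map (insert a M) (pair_pattern a M \<circ> \<phi> \<circ> pattern_pair a M) \<in> G"
  shows "lift_left \<phi> \<in> product_maps a b M"
proof -
  have "window_map (insert a (insert b M)) (triple_pattern a b M \<circ> lift_left \<phi> \<circ> pattern_triple a b M) \<in> G"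
    by (rule cong_mem[OF G]) (simp only: window_map_lift_left[OF ab])
  then show ?thesis
    using lift_left_maps[OF \<phi>] unfolding product_maps_def by blast
qed

lemma lift_right_product_maps:
  assumes ab: "a \<notin> M" "b \<notin> M" "a \<noteq> b"
    and \<phi>: "\<phi> ` (tape_symbols n \<times> patterns n k M) \<subseteq> tape_symbols n \<times> patterns n k M"
    and G: "window_map (insert b M) (pair_pattern b M \<circ> \<phi> \<circ> pattern_pair b M) \<in> G"
  shows "lift_right \<phi> \<in> product_maps a b M"
proof -
  have "window_map (insert a (insert b M)) (triple_pattern a b M \<circ> lift_right \<phi> \<circ> pattern_triple a b M) \<in> G"
    by (rule cong_mem[OF G]) (simp only: window_map_lift_right[OF ab])
  then show ?thesis
    using lift_right_maps[OF \<phi>] unfolding product_maps_def by blast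
qed

lemma even_window_pair:
  assumes "even_window (insert a M)" "a \<notin> M" "\<phi> \<in> even_transpositions (tape_symbols n \<times> patterns n k M)"
  shows "window_map (insert a M) (pair_pattern a M \<circ> \<phi> \<circ> pattern_pair a M) \<in> G"
proof -
  let ?e = "pair_pattern a M" and ?d = "pattern_pair a M" and ?Z = "tape_symbols n \<times> patterns n k M"
  obtain x y z w where \<phi>: "\<phi> = transpose x y \<circ> transpose z w"
    and m: "x \<in> ?Z" "y \<in> ?Z" "z \<in> ?Z" "w \<in> ?Z" "x \<noteq> y" "z \<noteq> w"
    by (rule even_transpositionsE[OF assms(3)])
  note de = pattern_pair_pattern[OF assms(2)]
  have ne: "?e x \<noteq> ?e y" "?e z \<noteq> ?e w" using de m by metis+
  have "transpose (?e x) (?e y) \<circ> transpose (?e z) (?e w) \<in> even_transpositions (patterns n k (insert a M))"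
    by (rule even_transpositionsI) (use m pair_pattern_mem ne in auto)
  then have "window_map (insert a M) (transpose (?e x) (?e y) \<circ> transpose (?e z) (?e w)) \<in> G"
    using assms(1) by (auto simp: even_window_def)
  then show ?thesis
  proof (rule cong_mem)
    fix c :: "int tm_config" assume c: "c \<in> tm_configs n k"
    show "window_map (insert a M) (transpose (?e x) (?e y) \<circ> transpose (?e z) (?e w)) c
       = window_map (insert a M) (?e \<circ> \<phi> \<circ> ?d) c"
    proof (rule window_map_cong[OF c])
      fix i assume i: "i \<in> patterns n k (insert a M)"
      note ed = pair_pattern_pair[OF i]
      have "?d i \<in> ?Z" by (rule pattern_pair_mem[OF i])
      then have t: "transpose z w (?d i) \<in> ?Z" by (rule transpose_mem[OF m(3,4)])
      have "?e (transpose x y (?d (?e (transpose z w (?d i)))))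
          = transpose (?e x) (?e y) (?e (transpose z w (?d i)))"
        using de[OF t] de[OF m(1)] de[OF m(2)] by (intro transpose_transport[of ?d ?e]) simp_all
      moreover have "?e (transpose z w (?d i)) = transpose (?e z) (?e w) i"
        using ed de[OF m(3)] de[OF m(4)] by (intro transpose_transport[of ?d ?e]) simp_all
      ultimately show "(transpose (?e x) (?e y) \<circ> transpose (?e z) (?e w)) i = (?e \<circ> \<phi> \<circ> ?d) i"
        using de[OF t] by (simp add: \<phi>)
    qed
  qed
qed

text \<open>
  The windows \<open>insert a M\<close> and \<open>insert b M\<close> share the cells \<open>M\<close> and the state, which provide the
  middle factor of the product.
\<close>

lemma even_window_insert2:
  assumes n: "n \<ge> 1" and M: "finite M" "card (patterns n k M) \<ge> 5"
    and ab: "a \<notin> M" "b \<notin> M" "a \<noteq> b"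
    and a: "even_window (insert a M)" and b: "even_window (insert b M)"
  shows "even_transpositions (tape_symbols n \<times> patterns n k M \<times> tape_symbols n) \<subseteq> product_maps a b M"
    and "even_window (insert a (insert b M))"
proof -
  let ?Y = "tape_symbols n \<times> patterns n k M \<times> tape_symbols n" and ?W = "insert a (insert b M)"
  let ?e = "triple_pattern a b M" and ?d = "pattern_triple a b M"
  interpret H: product_function_monoid "tape_symbols n" "patterns n k M" "tape_symbols n" "product_maps a b M"
    by (rule product_maps_monoid[OF ab])
  show sub: "even_transpositions ?Y \<subseteq> product_maps a b M"
  proof (rule H.even_transpositions_product)
    show "lift_left ` even_transpositions (tape_symbols n \<times> patterns n k M) \<subseteq> product_maps a b M"
      using lift_left_product_maps[OF ab even_transpositions_maps even_window_pair[OF a ab(1)]] by blast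
    show "lift_right ` even_transpositions (tape_symbols n \<times> patterns n k M) \<subseteq> product_maps a b M"
      using lift_right_product_maps[OF ab even_transpositions_maps even_window_pair[OF b ab(2)]] by blast
  qed (use n M in \<open>auto simp: tape_symbols_def finite_patterns lessThan_empty_iff\<close>)
  show "even_window ?W"
    unfolding even_window_def
  proof
    fix f assume "f \<in> window_map ?W ` even_transpositions (patterns n k ?W)"
    then obtain \<phi> where f': "f = window_map ?W \<phi>" and \<phi>: "\<phi> \<in> even_transpositions (patterns n k ?W)"
      by blast
    obtain x y z w where "\<phi> = transpose x y \<circ> transpose z w"
      and m: "x \<in> patterns n k ?W" "y \<in> patterns n k ?W" "z \<in> patterns n k ?W"
        "w \<in> patterns n k ?W" "x \<noteq> y" "z \<noteq> w"
      by (rule even_transpositionsE[OF \<phi>])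
    then have f: "f = window_map ?W (transpose x y \<circ> transpose z w)" using f' by simp
    note ed = triple_pattern_triple and de = pattern_triple_pattern[OF ab]
    have "?d x \<noteq> ?d y" "?d z \<noteq> ?d w" using ed m by metis+
    then have "transpose (?d x) (?d y) \<circ> transpose (?d z) (?d w) \<in> even_transpositions ?Y"
      using m pattern_triple_mem by (intro even_transpositionsI) auto
    then have "window_map ?W (?e \<circ> (transpose (?d x) (?d y) \<circ> transpose (?d z) (?d w)) \<circ> ?d) \<in> G"
      using sub unfolding product_maps_def by blast
    then show "f \<in> G"
    proof (rule cong_mem)
      fix c :: "int tm_config" assume c: "c \<in> tm_configs n k"
      show "window_map ?W (?e \<circ> (transpose (?d x) (?d y) \<circ> transpose (?d z) (?d w)) \<circ> ?d) c = f c"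
        unfolding f
      proof (rule window_map_cong[OF c])
        fix i assume i: "i \<in> patterns n k ?W"
        have t: "transpose z w i \<in> patterns n k ?W" by (rule transpose_mem[OF m(3,4) i])
        have 1: "?d (transpose z w i) = transpose (?d z) (?d w) (?d i)"
          using ed m i by (metis transpose_apply_first transpose_apply_second transpose_apply_other)
        have "?d (transpose x y (transpose z w i)) = transpose (?d x) (?d y) (?d (transpose z w i))"
          using ed m t by (metis transpose_apply_first transpose_apply_second transpose_apply_other)
        then show "(?e \<circ> (transpose (?d x) (?d y) \<circ> transpose (?d z) (?d w)) \<circ> ?d) i
            = (transpose x y \<circ> transpose z w) i"
          using ed[OF transpose_mem[OF m(1,2) t]] 1 by simp
      qed
    qed
  qed
qed

text \<open>
  For even \<open>n\<close> the even permutations of the larger window contain all transpositions of the smaller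
  one; for odd \<open>n\<close> the latter are odd in the larger window and differ from the transpositions there
  by even permutations.
\<close>

lemma transposition_parity:
  assumes n: "n \<ge> 1" and M: "finite M" "card (patterns n k M) \<ge> 5"
    and ab: "a \<notin> M" "b \<notin> M" "a \<noteq> b"
    and a: "even_window (insert a M)" and b: "even_window (insert b M)"
    and ij: "i \<in> patterns n k (insert a M)" "j \<in> patterns n k (insert a M)" "i \<noteq> j"
    and zw: "z \<in> patterns n k (insert a (insert b M))" "w \<in> patterns n k (insert a (insert b M))" "z \<noteq> w"
  shows "if even n then window_map (insert a M) (transpose i j) \<in> G
    else window_map (insert a (insert b M)) (transpose z w) \<circ> window_map (insert a M) (transpose i j) \<in> G"
proof -
  let ?Y = "tape_symbols n \<times> patterns n k M \<times> tape_symbols n" and ?W = "insert a (insert b M)"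
  let ?e = "triple_pattern a b M" and ?d = "pattern_triple a b M"
  let ?e' = "pair_pattern a M" and ?d' = "pattern_pair a M"
  interpret H: product_function_monoid "tape_symbols n" "patterns n k M" "tape_symbols n" "product_maps a b M"
    by (rule product_maps_monoid[OF ab])
  let ?\<tau> = "transpose (?d' i) (?d' j)" and ?\<sigma> = "transpose (?d z) (?d w)"
  note ed = triple_pattern_triple and ed' = pair_pattern_pair
  have ne: "?d' i \<noteq> ?d' j" "?d z \<noteq> ?d w" using ed ed' ij zw by metis+
  have parity: "if even (card (tape_symbols n)) then lift_left ?\<tau> \<in> product_maps a b M
      else ?\<sigma> \<circ> lift_left ?\<tau> \<in> product_maps a b M"
    by (rule H.lift_left_transpose_parity)
      (use even_window_insert2(1)[OF n M ab a b] ij zw ne pattern_pair_mem pattern_triple_mem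
        in \<open>auto simp: tape_symbols_def\<close>)
  have \<tau>: "window_map ?W (?e \<circ> lift_left ?\<tau> \<circ> ?d) c = window_map (insert a M) (transpose i j) c"
    if c: "c \<in> tm_configs n k" for c
  proof -
    have "window_map (insert a M) (?e' \<circ> ?\<tau> \<circ> ?d') c = window_map (insert a M) (transpose i j) c"
    proof (rule window_map_cong[OF c])
      fix l assume l: "l \<in> patterns n k (insert a M)"
      then have "?e' (?\<tau> (?d' l)) = transpose (?e' (?d' i)) (?e' (?d' j)) l"
        using ed' ij l by (intro transpose_transport[of ?d' ?e']) simp_all
      then show "(?e' \<circ> ?\<tau> \<circ> ?d') l = transpose i j l" using ed' ij by simp
    qed
    then show ?thesis using window_map_lift_left[OF ab] by simp
  qed
  show ?thesis
  proof (cases "even n")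
    case True
    then have "window_map ?W (?e \<circ> lift_left ?\<tau> \<circ> ?d) \<in> G"
      using parity unfolding product_maps_def by (simp add: tape_symbols_def)
    then show ?thesis using True cong_mem \<tau> by simp
  next
    case False
    then have "window_map ?W (?e \<circ> (?\<sigma> \<circ> lift_left ?\<tau>) \<circ> ?d) \<in> G"
      using parity by (simp add: product_maps_def tape_symbols_def)
    then have "window_map ?W (transpose z w) \<circ> window_map (insert a M) (transpose i j) \<in> G"
    proof (rule cong_mem)
      fix c :: "int tm_config" assume c: "c \<in> tm_configs n k"
      have d'Z: "?d' i \<in> tape_symbols n \<times> patterns n k M" "?d' j \<in> tape_symbols n \<times> patterns n k M"
        using pattern_pair_mem ij by blast+
      have maps: "lift_left ?\<tau> v \<in> ?Y" if "v \<in> ?Y" for v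
        using that lift_left_maps[OF transpose_maps[OF d'Z], of "tape_symbols n"] by blast
      have "window_map ?W (transpose z w) (window_map (insert a M) (transpose i j) c)
         = window_map ?W (transpose z w) (window_map ?W (?e \<circ> lift_left ?\<tau> \<circ> ?d) c)"
        by (simp add: \<tau>[OF c])
      also have "\<dots> = window_map ?W (transpose z w \<circ> (?e \<circ> lift_left ?\<tau> \<circ> ?d)) c"
        by (rule window_map_comp[OF c])
          (simp add: image_subset_iff triple_pattern_mem[OF maps[OF pattern_triple_mem]])
      also have "\<dots> = window_map ?W (?e \<circ> (?\<sigma> \<circ> lift_left ?\<tau>) \<circ> ?d) c"
      proof (rule window_map_cong[OF c])
        fix l assume "l \<in> patterns n k ?W"
        then have y: "lift_left ?\<tau> (?d l) \<in> ?Y" by (intro maps pattern_triple_mem)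
        note e = pattern_triple_pattern[OF ab y]
        have "?e (?\<sigma> (?d (?e (lift_left ?\<tau> (?d l))))) = transpose (?e (?d z)) (?e (?d w)) (?e (lift_left ?\<tau> (?d l)))"
          using e ed zw by (intro transpose_transport[of ?d ?e]) simp_all
        then show "(transpose z w \<circ> (?e \<circ> lift_left ?\<tau> \<circ> ?d)) l = (?e \<circ> (?\<sigma> \<circ> lift_left ?\<tau>) \<circ> ?d) l"
          using e ed zw by simp
      qed
      finally show "window_map ?W (?e \<circ> (?\<sigma> \<circ> lift_left ?\<tau>) \<circ> ?d) c
          = (window_map ?W (transpose z w) \<circ> window_map (insert a M) (transpose i j)) c" by simp
    qed
    then show ?thesis using False by simp
  qed
qed

end

section \<open>Head configurations on a fixed tape, and moves between them\<close>

definition state_move :: "(nat \<Rightarrow> nat) \<Rightarrow> (nat \<Rightarrow> int) \<Rightarrow> int tm_config \<Rightarrow> int tm_config" where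
  "state_move \<pi> m = (\<lambda>(x, q, v). (x, \<pi> q, v + m q))"

text \<open>
  For a fixed tape, the pairs of state and position are ordered like the integers: by position
  first, and by state within a cell. All maps that leave the tape alone are described in terms of
  this order, whose successor map is \<open>config_shift k 1\<close>.
\<close>

definition config_index :: "nat \<Rightarrow> int tm_config \<Rightarrow> int" where
  "config_index k = (\<lambda>(x, q, v). int k * v + (int q - 1))"

definition config_at :: "nat \<Rightarrow> (int \<Rightarrow> nat) \<Rightarrow> int \<Rightarrow> int tm_config" where
  "config_at k x i = (x, Suc (nat (i mod int k)), i div int k)"

definition config_shift :: "nat \<Rightarrow> int \<Rightarrow> int tm_config \<Rightarrow> int tm_config" where
  "config_shift k j c = config_at k (fst c) (config_index k c + j)"

text \<open>
  This exchanges \<open>c\<close> with its successor for all \<open>c\<close> that satisfy \<open>C\<close>. It is an involution if \<open>C\<close> does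
  not hold for two consecutive configurations, cf. \<open>step_free\<close>.
\<close>

definition step_swap :: "nat \<Rightarrow> (int tm_config \<Rightarrow> bool) \<Rightarrow> int tm_config \<Rightarrow> int tm_config" where
  "step_swap k C c = (if C c then config_shift k 1 c
     else if C (config_shift k (- 1) c) then config_shift k (- 1) c else c)"

lemma state_move_comp:
  "state_move \<pi> m \<circ> state_move \<rho> l = state_move (\<pi> \<circ> \<rho>) (\<lambda>q. l q + m (\<rho> q))"
  by (auto simp: state_move_def)

lemma state_move_trivial: "(\<And>q. m q = 0) \<Longrightarrow> state_move (\<lambda>q. q) m = id"
  by (auto simp: state_move_def)

lemma state_move_configs:
  "\<pi> ` tm_states k \<subseteq> tm_states k \<Longrightarrow> c \<in> tm_configs n k \<Longrightarrow> state_move \<pi> m c \<in> tm_configs n k"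
  by (auto simp: state_move_def tm_configs_def)

lemma fst_config_at [simp]: "fst (config_at k x i) = x"
  by (simp add: config_at_def)

lemma config_index_at: "k \<ge> 1 \<Longrightarrow> config_index k (config_at k x i) = i"
  by (simp add: config_index_def config_at_def)

lemma config_at_index:
  assumes "c \<in> tm_configs n k" shows "config_at k (fst c) (config_index k c) = c"
proof -
  obtain x q v where c: "c = (x, q, v)" by (rule prod_cases3)
  have q: "1 \<le> q" "q \<le> k" using assms by (auto simp: c tm_configs_def tm_states_def)
  have "(int k * v + (int q - 1)) div int k = v" "(int k * v + (int q - 1)) mod int k = int q - 1"
    using q by auto
  then show ?thesis using q by (simp add: c config_at_def config_index_def)
qed

lemma config_at_configs:
  assumes "k \<ge> 1" "c \<in> tm_configs n k" shows "config_at k (fst c) i \<in> tm_configs n k"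
proof -
  have "i mod int k < int k" "0 \<le> i mod int k" using assms(1) by auto
  then have "nat (i mod int k) < k" by linarith
  then show ?thesis
    using assms(2) by (auto simp: config_at_def tm_configs_def tm_states_def)
qed

lemma config_shift_configs: "k \<ge> 1 \<Longrightarrow> c \<in> tm_configs n k \<Longrightarrow> config_shift k j c \<in> tm_configs n k"
  by (simp add: config_shift_def config_at_configs)

lemma fst_config_shift [simp]: "fst (config_shift k j c) = fst c"
  by (simp add: config_shift_def)

lemma config_index_shift: "k \<ge> 1 \<Longrightarrow> config_index k (config_shift k j c) = config_index k c + j"
  by (simp add: config_shift_def config_index_at)

lemma config_shift_shift: "k \<ge> 1 \<Longrightarrow> config_shift k i (config_shift k j c) = config_shift k (i + j) c"
  by (simp add: config_shift_def config_index_at add.assoc add.commute)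

lemma config_shift_0: "c \<in> tm_configs n k \<Longrightarrow> config_shift k 0 c = c"
  by (simp add: config_shift_def config_at_index)

lemma config_shift_inverse:
  "k \<ge> 1 \<Longrightarrow> c \<in> tm_configs n k \<Longrightarrow> config_shift k (- 1) (config_shift k 1 c) = c"
  "k \<ge> 1 \<Longrightarrow> c \<in> tm_configs n k \<Longrightarrow> config_shift k 1 (config_shift k (- 1) c) = c"
  by (simp_all add: config_shift_shift config_shift_0)

text \<open>
  The shift along the order does not look at the tape, so it is a finite-state automaton whose
  moves depend on the state only.
\<close>

lemma config_shift_eq_state_move:
  assumes "k \<ge> 1"
  shows "config_shift k j = state_move (\<lambda>q. Suc (nat ((int q - 1 + j) mod int k))) (\<lambda>q. (int q - 1 + j) div int k)"
proof
  fix c :: "int tm_config"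
  obtain x q v where c: "c = (x, q, v)" by (rule prod_cases3)
  have e: "int k * v + (int q - 1) + j = (int q - 1 + j) + int k * v" by simp
  show "config_shift k j c = state_move (\<lambda>q. Suc (nat ((int q - 1 + j) mod int k))) (\<lambda>q. (int q - 1 + j) div int k) c"
    using assms unfolding c config_shift_def config_at_def config_index_def state_move_def prod.case fst_conv e
    by simp
qed

lemma config_shift_forward:
  assumes "1 \<le> q" "q \<le> k"
  shows "config_shift k 1 (x, q, v) = (if q < k then (x, q + 1, v) else (x, 1, v + 1))"
proof (cases "q < k")
  case True
  then have "int q mod int k = int q" "int q div int k = 0" by auto
  with True assms show ?thesis by (simp add: config_shift_eq_state_move state_move_def)
next
  case False
  then show ?thesis using assms by (simp add: config_shift_eq_state_move state_move_def)
qed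

lemma config_shift_backward:
  assumes "1 \<le> q" "q \<le> k"
  shows "config_shift k (- 1) (x, q, v) = (if 1 < q then (x, q - 1, v) else (x, k, v - 1))"
proof (cases "1 < q")
  case True
  then have "(int q - 1 + - 1) mod int k = int q - 2" "(int q - 1 + - 1) div int k = 0" using assms by auto
  with True assms show ?thesis by (simp add: config_shift_eq_state_move state_move_def)
next
  case False
  then have "q = 1" using assms by simp
  moreover have "- 1 mod int k = int k - 1" "- 1 div int k = - 1"
    using assms by (auto simp: zmod_minus1 div_eq_minus1)
  ultimately show ?thesis using assms by (simp add: config_shift_eq_state_move state_move_def nat_diff_distrib)
qed

definition step_free :: "nat \<Rightarrow> nat \<Rightarrow> (int tm_config \<Rightarrow> bool) \<Rightarrow> bool" where
  "step_free n k C \<longleftrightarrow> (\<forall>c\<in>tm_configs n k. C c \<longrightarrow> \<not> C (config_shift k 1 c))"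

lemma step_swap_configs:
  "k \<ge> 1 \<Longrightarrow> c \<in> tm_configs n k \<Longrightarrow> step_swap k C c \<in> tm_configs n k"
  by (simp add: step_swap_def config_shift_configs)

lemma step_swap_involution:
  assumes "k \<ge> 1" "step_free n k C" "c \<in> tm_configs n k"
  shows "step_swap k C (step_swap k C c) = c"
proof -
  have f: "\<not> C (config_shift k 1 c)" if "C c" using assms that by (auto simp: step_free_def)
  have "\<not> C (config_shift k 1 (config_shift k 1 (config_shift k (-1) c)))" if "C (config_shift k 1 (config_shift k (-1) c))"
    using assms that config_shift_configs by (auto simp: step_free_def)
  with f show ?thesis using assms by (auto simp: step_swap_def config_shift_inverse)
qed

text \<open>
  Among the generators this one moves the head depending on the tape.
\<close>

definition adjacent_swap :: "nat \<Rightarrow> int tm_config \<Rightarrow> int tm_config" where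
  "adjacent_swap k = step_swap k (\<lambda>(x, q, v). q = k \<and> x v = 0 \<and> x (v + 1) = 1)"

text \<open>
  Four cells are enough to start the induction on windows: the three cells that \<open>{0..<4}\<close> shares with
  its translate by 1 have at least \<open>2 ^ 3\<close> patterns if \<open>n \<ge> 2\<close>, and five are needed.
\<close>

locale elementary_generators = machine_group +
  assumes n_pos: "n \<ge> 1" and k_pos: "k \<ge> 1"
    and base_window: "full_window {0..<4}"
    and state_permutation: "\<pi> permutes tm_states k \<Longrightarrow> state_move \<pi> (\<lambda>_. 0) \<in> G"
    and state_step: "state_move (\<lambda>q. q) (\<lambda>q. if q = 1 then 1 else 0) \<in> G"
    and adjacent_swap: "adjacent_swap k \<in> G"
begin

lemma state_move_single:
  assumes s: "s \<in> tm_states k"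
  shows "state_move (\<lambda>q. q) (\<lambda>q. if q = s then t else 0) \<in> G"
proof -
  let ?f = "\<lambda>t. state_move (\<lambda>q. q) (\<lambda>q. if q = 1 then t else 0)"
  have nat: "?f (int j) \<in> G" for j
  proof (induction j)
    case 0
    have "?f (int 0) = id" by (rule state_move_trivial) simp
    then show ?case using id_mem by (simp only:)
  next
    case (Suc j)
    have "?f (int (Suc j)) = ?f (int j) \<circ> ?f 1" by (auto simp: state_move_comp fun_eq_iff state_move_def)
    then show ?case using comp_mem[OF Suc state_step] by (simp only:)
  qed
  have one: "?f t \<in> G"
  proof (cases "t \<ge> 0")
    case True
    then have "int (nat t) = t" by simp
    with nat[of "nat t"] show ?thesis by (simp only:)
  next
    case False
    have "?f (int (nat (- t))) \<in> G" by (rule nat)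
    then show ?thesis
    proof (rule inv_mem)
      fix c :: "int tm_config" assume "c \<in> tm_configs n k"
      then show "?f t c \<in> tm_configs n k" by (intro state_move_configs) auto
      show "?f (int (nat (- t))) (?f t c) = c" using False by (cases c) (auto simp: state_move_def)
    qed
  qed
  have 1: "1 \<in> tm_states k" using k_pos by (simp add: tm_states_def)
  let ?p = "state_move (transpose 1 s) (\<lambda>_. 0)"
  have p: "?p \<in> G" by (rule state_permutation) (rule permutes_swap_id[OF 1 s])
  have "?p \<circ> ?f t \<circ> ?p = state_move (\<lambda>q. q) (\<lambda>q. if q = s then t else 0)"
    by (auto simp: state_move_comp fun_eq_iff state_move_def transpose_def)
  then show ?thesis using comp_mem[OF comp_mem[OF p one] p] by (simp only:)
qed

text \<open>
  The states are moved one at a time; a single state is moved by conjugating \<open>state_step\<close> with a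
  transposition of states.
\<close>

lemma state_move_mem:
  assumes \<pi>: "bij_betw \<pi> (tm_states k) (tm_states k)"
  shows "state_move \<pi> m \<in> G"
proof -
  have step: "state_move (\<lambda>q. q) (\<lambda>q. if q \<in> S then m q else 0) \<in> G" if "finite S" "S \<subseteq> tm_states k" for S
    using that
  proof (induction S rule: finite_induct)
    case empty
    have "state_move (\<lambda>q. q) (\<lambda>q. if q \<in> {} then m q else 0) = id" by (rule state_move_trivial) simp
    then show ?case using id_mem by (simp only:)
  next
    case (insert s S)
    have "state_move (\<lambda>q. q) (\<lambda>q. if q \<in> insert s S then m q else 0)
        = state_move (\<lambda>q. q) (\<lambda>q. if q \<in> S then m q else 0) \<circ> state_move (\<lambda>q. q) (\<lambda>q. if q = s then m s else 0)"
      using insert.hyps by (auto simp: state_move_comp fun_eq_iff state_move_def)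
    moreover have "state_move (\<lambda>q. q) (\<lambda>q. if q \<in> S then m q else 0) \<in> G"
      "state_move (\<lambda>q. q) (\<lambda>q. if q = s then m s else 0) \<in> G"
      using insert state_move_single by auto
    ultimately show ?case using comp_mem by (simp only:)
  qed
  define \<pi>' where "\<pi>' = (\<lambda>q. if q \<in> tm_states k then \<pi> q else q)"
  have "bij_betw \<pi>' (tm_states k) (tm_states k)"
    using \<pi> by (rule bij_betw_cong[THEN iffD1, rotated]) (simp add: \<pi>'_def)
  then have "\<pi>' permutes tm_states k" by (rule bij_imp_permutes) (simp add: \<pi>'_def)
  then have "state_move \<pi>' (\<lambda>_. 0) \<circ> state_move (\<lambda>q. q) (\<lambda>q. if q \<in> tm_states k then m q else 0) \<in> G"
    by (intro comp_mem state_permutation step) (auto simp: tm_states_def)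
  then show ?thesis
    by (rule cong_mem) (auto simp: state_move_def \<pi>'_def tm_configs_def)
qed

lemma head_shift_mem: "state_move (\<lambda>q. q) (\<lambda>_. t) \<in> G"
  by (rule state_move_mem) (simp add: bij_betw_def)

lemma config_shift_mem: "config_shift k j \<in> G"
proof -
  let ?f = "\<lambda>j q. Suc (nat ((int q - 1 + j) mod int k))"
  have m: "nat (i mod int k) < k" for i using k_pos by (simp add: nat_less_iff)
  have "?f (- j) (?f j q) = q" if q: "q \<in> tm_states k" for q j
  proof -
    have "(int q - 1 + j) mod int k \<ge> 0" using k_pos by simp
    then have "(int (?f j q) - 1 + - j) mod int k = ((int q - 1 + j) mod int k + - j) mod int k" by simp
    also have "\<dots> = (int q - 1) mod int k" by (simp add: mod_simps)
    also have "\<dots> = int q - 1" using q by (simp add: tm_states_def)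
    finally have "Suc (nat ((int (?f j q) - 1 + - j) mod int k)) = Suc (nat (int q - 1))" by (simp only:)
    then show ?thesis using q by (auto simp: tm_states_def)
  qed
  from this[of _ j] this[of _ "- j"] have "bij_betw (?f j) (tm_states k) (tm_states k)"
    using m by (intro bij_betw_byWitness[of _ "?f (- j)"]) (auto simp: tm_states_def Suc_le_eq)
  then show ?thesis unfolding config_shift_eq_state_move[OF k_pos] by (rule state_move_mem)
qed

end

section \<open>Permutations of arbitrarily long intervals\<close>

definition translate_pattern :: "int \<Rightarrow> int set \<Rightarrow> (int \<Rightarrow> nat) \<times> nat \<Rightarrow> (int \<Rightarrow> nat) \<times> nat" where
  "translate_pattern t W = (\<lambda>(p, q). (\<lambda>u\<in>(+) t ` W. p (u - t), q))"

lemma mem_translate: "u \<in> (+) t ` W \<longleftrightarrow> u - t \<in> W" for t u :: int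
  by (auto simp: image_iff algebra_simps) (metis add.commute diff_add_cancel)

lemma read_window_translate:
  "read_window ((+) t ` W) c = translate_pattern t W (read_window W (state_move (\<lambda>q. q) (\<lambda>_. t) c))"
  by (cases c) (auto simp: read_window_def translate_pattern_def state_move_def fun_eq_iff restrict_def mem_translate)

lemma write_window_translate:
  "write_window ((+) t ` W) (translate_pattern t W i) c
    = state_move (\<lambda>q. q) (\<lambda>_. - t) (write_window W i (state_move (\<lambda>q. q) (\<lambda>_. t) c))"
proof -
  obtain x q v where c: "c = (x, q, v)" by (rule prod_cases3)
  obtain p q' where i: "i = (p, q')" by (rule prod.exhaust)
  show ?thesis
    by (simp add: diff_diff_eq c i write_window_def translate_pattern_def state_move_def mem_translate restrict_def cong: if_cong)
qed

lemma translate_pattern_surj: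
  assumes "j \<in> patterns n k ((+) t ` W)"
  obtains i where "i \<in> patterns n k W" "j = translate_pattern t W i"
proof -
  obtain p q where j: "j = (p, q)" by (rule prod.exhaust)
  define i where "i = (\<lambda>u\<in>W. p (u + t), q)"
  have "i \<in> patterns n k W" using assms by (auto simp: i_def j patterns_def PiE_iff add.commute)
  moreover have "restrict (\<lambda>u. restrict (\<lambda>u. p (u + t)) W (u - t)) ((+) t ` W) = p"
    by (rule restrict_eqI[where S = "tape_symbols n"]) (use assms in \<open>auto simp: j patterns_def add.commute\<close>)
  then have "j = translate_pattern t W i" by (simp add: j translate_pattern_def i_def)
  ultimately show ?thesis by (rule that)
qed

lemma translate_pattern_inj:
  assumes "i \<in> patterns n k W" "j \<in> patterns n k W" "translate_pattern t W i = translate_pattern t W j"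
  shows "i = j"
proof -
  obtain p q p' q' where e: "i = (p, q)" "j = (p', q')" by (metis surj_pair)
  have eq: "(\<lambda>u\<in>(+) t ` W. p (u - t)) = (\<lambda>u\<in>(+) t ` W. p' (u - t))" and q: "q = q'"
    using assms(3) by (simp_all add: e translate_pattern_def)
  have "p = p'"
  proof (rule PiE_ext)
    show "p \<in> W \<rightarrow>\<^sub>E tape_symbols n" "p' \<in> W \<rightarrow>\<^sub>E tape_symbols n"
      using assms(1,2) by (simp_all add: e patterns_def)
    fix u assume "u \<in> W"
    then show "p u = p' u" using fun_cong[OF eq, of "t + u"] by simp
  qed
  then show ?thesis by (simp add: e q)
qed

lemma translate_pattern_transpose:
  assumes "i \<in> patterns n k W" "j \<in> patterns n k W" "l \<in> patterns n k W"
  shows "translate_pattern t W (transpose i j l)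
    = transpose (translate_pattern t W i) (translate_pattern t W j) (translate_pattern t W l)"
  using translate_pattern_inj[OF assms(3,1), of t] translate_pattern_inj[OF assms(3,2), of t]
  by (auto simp: transpose_def)

context elementary_generators
begin

text \<open>
  Conjugation by a shift of the head translates windows.
\<close>

lemma window_map_translate_mem:
  assumes "window_map W \<phi> \<in> G"
    and "\<And>i. i \<in> patterns n k W \<Longrightarrow> \<psi> (translate_pattern t W i) = translate_pattern t W (\<phi> i)"
  shows "window_map ((+) t ` W) \<psi> \<in> G"
proof -
  have "state_move (\<lambda>q. q) (\<lambda>_. - t) \<circ> window_map W \<phi> \<circ> state_move (\<lambda>q. q) (\<lambda>_. t) \<in> G"
    by (intro comp_mem head_shift_mem assms(1))
  then show ?thesis
  proof (rule cong_mem)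
    fix c :: "int tm_config" assume c: "c \<in> tm_configs n k"
    have "state_move (\<lambda>q. q) (\<lambda>_. t) c \<in> tm_configs n k" by (rule state_move_configs[OF _ c]) simp
    then have "\<psi> (read_window ((+) t ` W) c) = translate_pattern t W (\<phi> (read_window W (state_move (\<lambda>q. q) (\<lambda>_. t) c)))"
      by (simp add: read_window_translate assms(2) read_window_patterns)
    then show "(state_move (\<lambda>q. q) (\<lambda>_. - t) \<circ> window_map W \<phi> \<circ> state_move (\<lambda>q. q) (\<lambda>_. t)) c = window_map ((+) t ` W) \<psi> c"
      by (simp add: window_map_def write_window_translate)
  qed
qed

lemma full_window_translate:
  assumes "full_window W" shows "full_window ((+) t ` W)"
  unfolding full_window_def
proof (intro ballI)
  fix i' j' assume i': "i' \<in> patterns n k ((+) t ` W)" and j': "j' \<in> patterns n k ((+) t ` W)"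
  obtain i where i: "i \<in> patterns n k W" "i' = translate_pattern t W i" by (rule translate_pattern_surj[OF i'])
  obtain j where j: "j \<in> patterns n k W" "j' = translate_pattern t W j" by (rule translate_pattern_surj[OF j'])
  have "window_map W (transpose i j) \<in> G" using assms i(1) j(1) by (simp add: full_window_def)
  then show "window_map ((+) t ` W) (transpose i' j') \<in> G"
    by (rule window_map_translate_mem) (simp add: i j translate_pattern_transpose[OF i(1) j(1)])
qed

lemma even_window_translate:
  assumes "even_window W" shows "even_window ((+) t ` W)"
  unfolding even_window_def
proof (rule image_subsetI)
  fix \<psi> assume "\<psi> \<in> even_transpositions (patterns n k ((+) t ` W))"
  then obtain x' y' z' w' where \<psi>: "\<psi> = transpose x' y' \<circ> transpose z' w'"
    and m: "x' \<in> patterns n k ((+) t ` W)" "y' \<in> patterns n k ((+) t ` W)"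
      "z' \<in> patterns n k ((+) t ` W)" "w' \<in> patterns n k ((+) t ` W)" "x' \<noteq> y'" "z' \<noteq> w'"
    by (rule even_transpositionsE)
  obtain x where x: "x \<in> patterns n k W" "x' = translate_pattern t W x" by (rule translate_pattern_surj[OF m(1)])
  obtain y where y: "y \<in> patterns n k W" "y' = translate_pattern t W y" by (rule translate_pattern_surj[OF m(2)])
  obtain z where z: "z \<in> patterns n k W" "z' = translate_pattern t W z" by (rule translate_pattern_surj[OF m(3)])
  obtain w where w: "w \<in> patterns n k W" "w' = translate_pattern t W w" by (rule translate_pattern_surj[OF m(4)])
  have "transpose x y \<circ> transpose z w \<in> even_transpositions (patterns n k W)"
    by (rule even_transpositionsI) (use x y z w m(5,6) in auto)
  then have "window_map W (transpose x y \<circ> transpose z w) \<in> G"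
    using assms by (auto simp: even_window_def)
  then show "window_map ((+) t ` W) \<psi> \<in> G"
    by (rule window_map_translate_mem)
      (simp add: \<psi> x y z w translate_pattern_transpose[OF x(1) y(1)]
        translate_pattern_transpose[OF z(1) w(1)] transpose_mem[OF z(1) w(1)])
qed

lemma interval_patterns_card:
  assumes "n \<ge> 2" "m \<ge> 4" shows "card (patterns n k {1..<int m}) \<ge> 5"
proof -
  have "5 \<le> (2::nat) ^ 3" by simp
  also have "\<dots> \<le> 2 ^ (m - 1)" using assms(2) by (intro power_increasing) auto
  also have "\<dots> \<le> n ^ (m - 1)" using assms(1) by (rule power_mono) simp
  also have "\<dots> \<le> n ^ (m - 1) * k" using k_pos by simp
  finally show ?thesis using assms(2) by (simp add: card_patterns nat_diff_distrib)
qed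

lemma interval_insert:
  assumes "m \<ge> 4"
  shows "insert 0 {1..<int m} = {0..<int m}" "insert (int m) {1..<int m} = (+) 1 ` {0..<int m}"
    "insert 0 (insert (int m) {1..<int m}) = {0..<int (Suc m)}"
  using assms by (auto simp: image_add_atLeastLessThan)

text \<open>
  The interval of length \<open>m + 1\<close> is the union of two translates of the interval of length \<open>m\<close>, which
  share the cells \<open>1, \<dots>, m - 1\<close>.
\<close>

lemma interval_even:
  assumes n: "n \<ge> 2" and m: "m \<ge> 4" shows "even_window {0..<int m}"
  using m
proof (induction m rule: nat_induct_at_least)
  case base
  then show ?case using full_window_imp_even[OF base_window] by simp
next
  case (Suc m)
  have "even_window (insert 0 (insert (int m) {1..<int m}))"
    by (rule even_window_insert2(2))
      (use n Suc interval_patterns_card[OF n] even_window_translate[of "{0..<int m}" 1]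
        in \<open>simp_all add: interval_insert\<close>)
  then show ?case using Suc by (simp only: interval_insert(3))
qed

text \<open>
  For even \<open>n\<close> a transposition on an interval is an even permutation of the next interval. For odd
  \<open>n\<close> it stays odd when the interval grows, so that a transposition on the shorter interval supplies
  the missing odd permutation on the longer one.
\<close>

lemma interval_full:
  assumes n: "n \<ge> 2" and m: "m \<ge> 4" shows "full_window {0..<int m}"
  using m
proof (induction m rule: nat_induct_at_least)
  case base
  then show ?case using base_window by simp
next
  case (Suc m)
  have parity: "if even n then window_map (insert 0 {1..<int m}) (transpose i j) \<in> G
    else window_map (insert 0 (insert (int m) {1..<int m})) (transpose z w) \<circ> window_map (insert 0 {1..<int m}) (transpose i j) \<in> G"
    if "m \<ge> 4" "i \<in> patterns n k (insert 0 {1..<int m})" "j \<in> patterns n k (insert 0 {1..<int m})" "i \<noteq> j"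
      "z \<in> patterns n k (insert 0 (insert (int m) {1..<int m}))" "w \<in> patterns n k (insert 0 (insert (int m) {1..<int m}))" "z \<noteq> w" for i j z w m
    by (rule transposition_parity)
      (use n that interval_patterns_card[OF n] even_window_translate[of "{0..<int m}" 1] interval_even[OF n]
        in \<open>simp_all add: interval_insert\<close>)
  have two: "\<exists>z w. z \<in> patterns n k W \<and> w \<in> patterns n k W \<and> z \<noteq> w" if "finite W" "{1..<4} \<subseteq> W" for W
  proof -
    have "card {1..<4::int} \<le> card W" using that by (rule card_mono)
    then have "2 ^ 1 \<le> (2::nat) ^ card W" by (intro power_increasing) auto
    also have "\<dots> \<le> n ^ card W" using n by (rule power_mono) simp
    also have "\<dots> \<le> n ^ card W * k" using k_pos by simp
    finally have "2 \<le> card (patterns n k W)" by (simp add: card_patterns that(1))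
    then have "\<not> card (patterns n k W) \<le> Suc 0" by simp
    then show ?thesis unfolding card_le_Suc0_iff_eq[OF finite_patterns[OF that(1)]] by blast
  qed
  show ?case
    unfolding full_window_def
  proof (intro ballI)
    fix z w assume zw: "z \<in> patterns n k {0..<int (Suc m)}" "w \<in> patterns n k {0..<int (Suc m)}"
    show "window_map {0..<int (Suc m)} (transpose z w) \<in> G"
    proof (cases "z = w")
      case True
      then show ?thesis using id_mem by (simp add: window_map_id)
    next
      case ne: False
      show ?thesis
      proof (cases "even n")
        case True
        obtain z' w' where z'w': "z' \<in> patterns n k {0..<int (Suc (Suc m))}" "w' \<in> patterns n k {0..<int (Suc (Suc m))}" "z' \<noteq> w'"
          using two[of "{0..<int (Suc (Suc m))}"] Suc by auto
        show ?thesis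
          using parity[of "Suc m" z w z' w'] zw ne z'w' Suc True
          by (simp only: interval_insert(1,3) if_True le_SucI simp_thms)
      next
        case False
        obtain i j where ij: "i \<in> patterns n k {0..<int m}" "j \<in> patterns n k {0..<int m}" "i \<noteq> j"
          using two[of "{0..<int m}"] Suc by auto
        have A: "window_map {0..<int (Suc m)} (transpose z w) \<circ> window_map {0..<int m} (transpose i j) \<in> G"
          using parity[of m i j z w] zw ne ij Suc False by (simp only: interval_insert(1,3) if_False simp_thms)
        have "window_map {0..<int m} (transpose i j) \<in> G" using Suc.IH ij by (simp add: full_window_def)
        from comp_mem[OF A this] show ?thesis
        proof (rule cong_mem)
          fix c :: "int tm_config" assume c: "c \<in> tm_configs n k"
          have "window_map {0..<int m} (transpose i j) (window_map {0..<int m} (transpose i j) c) = c"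
            using window_map_comp[OF c transpose_maps[OF ij(1,2)], of "transpose i j"] by (simp add: window_map_id)
          then show "(window_map {0..<int (Suc m)} (transpose z w) \<circ> window_map {0..<int m} (transpose i j) \<circ>
             window_map {0..<int m} (transpose i j)) c = window_map {0..<int (Suc m)} (transpose z w) c"
            by simp
        qed
      qed
    qed
  qed
qed

lemma symmetric_interval_full:
  assumes n: "n \<ge> 2" and r: "r \<ge> 2" shows "full_window {- int r..<int r}"
proof -
  have "full_window ((+) (- int r) ` {0..<int (2 * r)})"
    by (rule full_window_translate[OF interval_full[OF n]]) (use r in simp)
  also have "(+) (- int r) ` {0..<int (2 * r)} = {- int r..<int r}"
    unfolding image_add_atLeastLessThan by simp
  finally show ?thesis .
qed

end

section \<open>Conditional swaps of consecutive configurations\<close>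

text \<open>
  Let \<open>h = f \<circ> g \<circ> f\<close>. Since \<open>g\<close> exchanges \<open>U\<close> and \<open>g U\<close>, fixes \<open>f U\<close>, and \<open>f\<close> fixes \<open>g U\<close>, the map \<open>h\<close>
  exchanges \<open>f U\<close> and \<open>g U\<close> and fixes \<open>U\<close>. Conjugating \<open>g\<close> by \<open>h\<close> therefore gives the map that
  exchanges \<open>U\<close> and \<open>f U\<close>: the involution \<open>f\<close>, cut down to \<open>U \<union> f U\<close>. In this way a local condition
  is added to a swap.
\<close>

lemma conjugated_product_of_involutions:
  assumes X: "\<And>c. c \<in> X \<Longrightarrow> f c \<in> X" "\<And>c. c \<in> X \<Longrightarrow> g c \<in> X"
    and ff: "\<And>c. c \<in> X \<Longrightarrow> f (f c) = c" and gg: "\<And>c. c \<in> X \<Longrightarrow> g (g c) = c"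
    and supp: "\<And>c. c \<in> X \<Longrightarrow> c \<notin> U \<Longrightarrow> g c \<notin> U \<Longrightarrow> g c = c"
    and U: "\<And>c. c \<in> X \<Longrightarrow> c \<in> U \<Longrightarrow> g (f c) = f c \<and> f (g c) = g c"
    and c: "c \<in> X"
  shows "f (g (f (g (f (g (f c)))))) = (if c \<in> U then f c else if f c \<in> U then f c else c)"
proof -
  consider (U) "c \<in> U" | (fU) "c \<notin> U" "f c \<in> U" | (gU) "c \<notin> U" "f c \<notin> U" "g c \<in> U"
    | (out) "c \<notin> U" "f c \<notin> U" "g c \<notin> U" by blast
  then show ?thesis
  proof cases
    case U
    then show ?thesis using assms(6)[OF c] ff gg c by simp
  next
    case fU
    let ?e = "f c"
    have e: "?e \<in> X" using X c by blast
    show ?thesis using U[OF e fU(2)] ff gg c e fU by simp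
  next
    case gU
    let ?e = "g c"
    have e: "?e \<in> X" using X c by blast
    have "f c = c" using U[OF e gU(3)] gg[OF c] by simp
    then show ?thesis using U[OF e gU(3)] ff gg c e gU by simp
  next
    case out
    have gc: "g c = c" using supp out c by blast
    have fc: "f c \<in> X" using X c by blast
    have "g (f c) \<notin> U"
    proof
      assume u: "g (f c) \<in> U"
      have "f (g (g (f c))) = g (g (f c))" using U[OF X(2)[OF fc] u] by blast
      then have "f c = c" using gg[OF fc] ff[OF c] by simp
      then show False using u gc out by simp
    qed
    then have "g (f c) = f c" using supp out fc by blast
    then show ?thesis using out gc ff c by simp
  qed
qed

lemma step_freeD: "step_free n k C \<Longrightarrow> c \<in> tm_configs n k \<Longrightarrow> C c \<Longrightarrow> \<not> C (config_shift k 1 c)"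
  by (simp add: step_free_def)

lemma read_window_eqD:
  assumes "read_window W (x, q, v) = (p, q')"
  shows "q = q'" "u \<in> W \<Longrightarrow> x (v + u) = p u"
  using assms by (auto simp: read_window_def)

context elementary_generators
begin

definition cylinder_swap :: "int set \<Rightarrow> (int \<Rightarrow> nat) \<times> nat \<Rightarrow> int tm_config \<Rightarrow> int tm_config" where
  "cylinder_swap W i = step_swap k (\<lambda>c. read_window W c = i)"

lemma window_map_transpose:
  "window_map W (transpose i j) c =
    (if read_window W c = i then write_window W j c
     else if read_window W c = j then write_window W i c else c)"
  by (auto simp: window_map_def transpose_def write_read_window)

lemma window_map_transpose_involution:
  assumes "c \<in> tm_configs n k" "i \<in> patterns n k W" "j \<in> patterns n k W"
  shows "window_map W (transpose i j) (window_map W (transpose i j) c) = c"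
  using window_map_comp[OF assms(1) transpose_maps[OF assms(2,3)], of "transpose i j"]
  by (simp add: window_map_id)

lemma write_window_read:
  "read_window W c = i \<Longrightarrow> write_window W i (write_window W j c) = c"
  using write_read_window[of W c] by (simp add: write_write_window)

text \<open>
  The swap \<open>adjacent_swap k\<close> is cut down to the cylinder of the pattern \<open>(p, k)\<close>, which contains the
  marker \<open>01\<close>. The auxiliary transposition exchanges this cylinder with that of the blank pattern,
  which \<open>adjacent_swap k\<close> does not move.
\<close>

lemma cylinder_swap_marked:
  assumes W: "full_window W" "0 \<in> W" "1 \<in> W"
    and i: "(p, k) \<in> patterns n k W" "p 0 = 0" "p 1 = 1"
  shows "cylinder_swap W (p, k) \<in> G"
proof -
  let ?X = "tm_configs n k :: int tm_config set"
  let ?\<alpha> = "(p, k)" and ?\<beta> = "(\<lambda>u\<in>W. 0 :: nat, k)"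
  let ?N = "config_shift k 1" and ?N' = "config_shift k (- 1)"
  define C where "C = (\<lambda>(x :: int \<Rightarrow> nat, q, v :: int). q = k \<and> x v = 0 \<and> x (v + 1) = 1)"
  have C_iff: "C (x, q, v) \<longleftrightarrow> q = k \<and> x v = 0 \<and> x (v + 1) = 1" for x q v by (simp add: C_def)
  have adjacent: "adjacent_swap k = step_swap k C" by (simp add: adjacent_swap_def C_def)
  let ?g = "window_map W (transpose ?\<alpha> ?\<beta>)" and ?f = "adjacent_swap k"
  let ?U = "{c. read_window W c = ?\<alpha>}"
  have \<beta>: "?\<beta> \<in> patterns n k W"
    using n_pos k_pos by (auto simp: patterns_def tape_symbols_def tm_states_def)
  note \<tau> = window_map_transpose[of W ?\<alpha> ?\<beta>]
  have X: "?N c \<in> ?X" "?N' c \<in> ?X" if "c \<in> ?X" for c using that k_pos config_shift_configs by blast+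
  have NN: "?N' (?N c) = c" "?N (?N' c) = c" if "c \<in> ?X" for c
    using that k_pos config_shift_inverse by blast+
  have fC: "step_free n k C"
    unfolding step_free_def
  proof (intro ballI impI)
    fix c :: "int tm_config" assume c: "c \<in> ?X" "C c"
    obtain x q v where e: "c = (x, q, v)" by (rule prod_cases3)
    show "\<not> C (?N c)" using c k_pos by (simp add: e C_iff config_shift_forward)
  qed
  have alpha: "C c" if "read_window W c = ?\<alpha>" for c
  proof -
    obtain x q v where e: "c = (x, q, v)" by (rule prod_cases3)
    show ?thesis using read_window_eqD(1)[OF that[unfolded e]] read_window_eqD(2)[OF that[unfolded e], of 0] read_window_eqD(2)[OF that[unfolded e], of 1] W i
      by (simp add: e C_iff)
  qed
  \<comment> \<open>one step further the head stands on the symbol 1, whereas both patterns have 0 there\<close>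
  have step: "read_window W (?N c) \<noteq> ?\<alpha>" "read_window W (?N c) \<noteq> ?\<beta>" if "c \<in> ?X" "C c" for c
  proof -
    obtain x q v where e: "c = (x, q, v)" by (rule prod_cases3)
    have N: "?N c = (x, 1, v + 1)" and x: "x (v + 1) = 1" using that k_pos by (auto simp: e C_iff config_shift_forward)
    have "fst (read_window W (?N c)) 0 = 1" unfolding N using x W by (simp add: read_window_def)
    then show "read_window W (?N c) \<noteq> ?\<alpha>" "read_window W (?N c) \<noteq> ?\<beta>" using i W by auto
  qed
  have beta: "\<not> C c \<and> \<not> C (?N' c)" if c: "c \<in> ?X" "read_window W c = ?\<beta>" for c
  proof -
    obtain x q v where e: "c = (x, q, v)" by (rule prod_cases3)
    have q: "q = k" and r: "(\<lambda>u\<in>W. x (v + u)) = (\<lambda>u\<in>W. 0)" using c by (auto simp: e read_window_def)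
    have "x v = 0" "x (v + 1) = 0" using W fun_cong[OF r, of 0] fun_cong[OF r, of 1] by simp_all
    then show ?thesis using q k_pos by (auto simp: e C_iff config_shift_backward)
  qed
  have fN: "?f c = ?N c" if "C c" for c using that by (simp add: adjacent step_swap_def)
  have f1: "?f c = c" if "\<not> C c" "\<not> C (?N' c)" for c using that by (simp add: adjacent step_swap_def)
  have ff: "?f (?f c) = c" if "c \<in> ?X" for c
    unfolding adjacent by (rule step_swap_involution[OF k_pos fC that])
  have fX: "?f c \<in> ?X" if "c \<in> ?X" for c
    unfolding adjacent by (rule step_swap_configs[OF k_pos that])
  have gX: "?g c \<in> ?X" if "c \<in> ?X" for c
    by (rule window_map_configs[OF that transpose_maps[OF i(1) \<beta>]])
  have key: "?f (?g (?f (?g (?f (?g (?f c)))))) = (if c \<in> ?U then ?f c else if ?f c \<in> ?U then ?f c else c)"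
    if c: "c \<in> ?X" for c
  proof (rule conjugated_product_of_involutions[OF fX gX ff _ _ _ c])
    show "?g (?g d) = d" if "d \<in> ?X" for d by (rule window_map_transpose_involution[OF that i(1) \<beta>])
    show "?g d = d" if "d \<in> ?X" "d \<notin> ?U" "?g d \<notin> ?U" for d
    proof -
      have "read_window W d \<noteq> ?\<beta>"
      proof
        assume "read_window W d = ?\<beta>"
        then have "?g d = write_window W ?\<alpha> d" using \<tau> that(2) by simp
        then show False using that(3) read_write_window[OF i(1)] by simp
      qed
      then show ?thesis using \<tau> that(2) by simp
    qed
    show "?g (?f d) = ?f d \<and> ?f (?g d) = ?g d" if d: "d \<in> ?X" "d \<in> ?U" for d
    proof
      have C: "C d" by (rule alpha) (use d in simp)
      have fd: "?f d = ?N d" by (rule fN[OF C])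
      show "?g (?f d) = ?f d" unfolding fd using \<tau> step[OF d(1) C] by (simp only: if_False)
      have gd: "?g d = write_window W ?\<beta> d" using \<tau> d(2) by simp
      have "read_window W (?g d) = ?\<beta>" unfolding gd by (rule read_write_window[OF \<beta>])
      then show "?f (?g d) = ?g d" using beta[OF gX[OF d(1)]] by (intro f1) simp_all
    qed
  qed
  have "?f \<circ> ?g \<circ> ?f \<circ> ?g \<circ> ?f \<circ> ?g \<circ> ?f \<in> G"
    using W(1) i(1) \<beta> adjacent_swap by (intro comp_mem) (auto simp: full_window_def)
  then show ?thesis
  proof (rule cong_mem)
    fix c :: "int tm_config" assume c: "c \<in> ?X"
    have 1: "?f c \<in> ?U \<longleftrightarrow> read_window W (?N' c) = ?\<alpha>" and 2: "?f c \<in> ?U \<Longrightarrow> ?f c = ?N' c" if "c \<notin> ?U"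
    proof -
      show 2: "?f c = ?N' c" if "?f c \<in> ?U"
      proof -
        have "?f (?f c) = ?N (?f c)" by (rule fN[OF alpha]) (use that in simp)
        then have "c = ?N (?f c)" using ff[OF c] by simp
        then show ?thesis using NN(1)[OF fX[OF c]] by simp
      qed
      show "?f c \<in> ?U \<longleftrightarrow> read_window W (?N' c) = ?\<alpha>"
      proof
        assume "read_window W (?N' c) = ?\<alpha>"
        then have "C (?N' c)" by (rule alpha)
        moreover from this have "\<not> C c" using step_freeD[OF fC X(2)[OF c]] NN(2)[OF c] by simp
        ultimately have "?f c = ?N' c" unfolding adjacent step_swap_def by (simp only: if_False if_True)
        then show "?f c \<in> ?U" using \<open>read_window W (?N' c) = ?\<alpha>\<close> by simp
      qed (use 2 in auto)
    qed
    show "(?f \<circ> ?g \<circ> ?f \<circ> ?g \<circ> ?f \<circ> ?g \<circ> ?f) c = cylinder_swap W ?\<alpha> c"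
      using key[OF c] 1 2 fN alpha by (auto simp: cylinder_swap_def step_swap_def)
  qed
qed

text \<open>
  Let \<open>N = config_shift k 1\<close>, and let \<open>\<tau>\<close> exchange the cylinders of \<open>i\<close> and \<open>j\<close>. Then \<open>N \<tau> N\<^sup>-\<^sup>1\<close> exchanges
  their images under \<open>N\<close>, and \<open>\<tau> N \<tau> N\<^sup>-\<^sup>1\<close> takes the cylinder of \<open>j\<close> to that of \<open>i\<close> and commutes with
  \<open>N\<close> on it. So it conjugates the swap for \<open>j\<close> into the swap for \<open>i\<close>. This needs that the cylinder of
  \<open>j\<close> and the image of the cylinder of \<open>i\<close> under \<open>N\<close> are disjoint; otherwise the two factors would
  interfere.
\<close>

lemma cylinder_swap_conjugate:
  assumes W: "full_window W" and ij: "i \<in> patterns n k W" "j \<in> patterns n k W"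
    and free: "step_free n k (\<lambda>c. read_window W c = i)" "step_free n k (\<lambda>c. read_window W c = j)"
    and sep: "\<And>c. c \<in> tm_configs n k \<Longrightarrow> read_window W (config_shift k 1 c) = j \<Longrightarrow> read_window W c \<noteq> i"
    and j: "cylinder_swap W j \<in> G"
  shows "cylinder_swap W i \<in> G"
proof (cases "i = j")
  case ne: False
  let ?X = "tm_configs n k :: int tm_config set"
  let ?N = "config_shift k 1" and ?N' = "config_shift k (- 1)"
  let ?\<tau> = "window_map W (transpose i j)"
  let ?\<rho> = "?N \<circ> ?\<tau> \<circ> ?N'"
  let ?r = "read_window W"
  note \<tau> = window_map_transpose[of W i j]
  have X: "?N c \<in> ?X" "?N' c \<in> ?X" "?\<tau> c \<in> ?X" if "c \<in> ?X" for c
    using that k_pos config_shift_configs window_map_configs[OF that transpose_maps[OF ij]] by blast+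
  have NN: "?N' (?N c) = c" "?N (?N' c) = c" if "c \<in> ?X" for c
    using that k_pos config_shift_inverse by blast+
  have \<tau>\<tau>: "?\<tau> (?\<tau> c) = c" if "c \<in> ?X" for c by (rule window_map_transpose_involution[OF that ij])
  have backward: "?r c \<noteq> i \<or> ?r (?N' c) \<noteq> i" "?r c \<noteq> j \<or> ?r (?N' c) \<noteq> j" "?r c \<noteq> j \<or> ?r (?N' c) \<noteq> i" if "c \<in> ?X" for c
  proof -
    note d = X(2)[OF that]
    show "?r c \<noteq> i \<or> ?r (?N' c) \<noteq> i" using step_freeD[OF free(1) d] NN(2)[OF that] by auto
    show "?r c \<noteq> j \<or> ?r (?N' c) \<noteq> j" using step_freeD[OF free(2) d] NN(2)[OF that] by auto
    show "?r c \<noteq> j \<or> ?r (?N' c) \<noteq> i" using sep[OF d] NN(2)[OF that] by auto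
  qed
  define g where "g = ?\<tau> \<circ> ?\<rho>"
  define h where "h = ?\<rho> \<circ> ?\<tau>"
  have \<tau>G: "?\<tau> \<in> G" using W ij by (auto simp: full_window_def)
  then have \<rho>G: "?\<rho> \<in> G" by (intro comp_mem config_shift_mem)
  have gh: "h (g c) = c" "g (h c) = c" "h c \<in> ?X" if "c \<in> ?X" for c
    unfolding g_def h_def using that X NN \<tau>\<tau> by simp_all
  have g1: "g c = write_window W i c" "g (?N c) = ?N (write_window W i c)" if c: "c \<in> ?X" "?r c = j" for c
  proof -
    have "?\<tau> (?N' c) = ?N' c" using backward[OF c(1)] c(2) \<tau> by simp
    then have "?\<rho> c = c" using NN[OF c(1)] by simp
    moreover have \<tau>c: "?\<tau> c = write_window W i c" using \<tau> c(2) ne by simp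
    ultimately show "g c = write_window W i c" by (simp add: g_def)
    let ?d = "write_window W i c"
    have d: "?d \<in> ?X" "?r ?d = i" using write_window_configs[OF c(1) ij(1)] read_write_window[OF ij(1)] by auto
    have "?\<rho> (?N c) = ?N ?d" using NN[OF c(1)] \<tau>c by simp
    moreover have "?r (?N ?d) \<noteq> i" "?r (?N ?d) \<noteq> j"
      using free(1) sep[OF d(1)] d by (auto simp: step_free_def)
    ultimately show "g (?N c) = ?N ?d" using \<tau> by (simp add: g_def)
  qed
  have "g \<circ> cylinder_swap W j \<circ> h \<in> G"
    unfolding g_def h_def by (intro comp_mem \<tau>G \<rho>G j)
  then show ?thesis
  proof (rule cong_mem)
    fix c :: "int tm_config" assume c: "c \<in> ?X"
    have inI: "h d = write_window W j d" "g (?N (write_window W j d)) = ?N d" "write_window W j d \<in> ?X"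
        "?r (write_window W j d) = j" if d: "d \<in> ?X" "?r d = i" for d
    proof -
      let ?e = "write_window W j d"
      show e: "?e \<in> ?X" "?r ?e = j" using write_window_configs[OF d(1) ij(2)] read_write_window[OF ij(2)] by auto
      have w: "write_window W i ?e = d" using write_window_read d(2) by blast
      show "h d = ?e" using gh(1)[OF e(1)] g1(1)[OF e] w by simp
      show "g (?N ?e) = ?N d" using g1(2)[OF e] w by simp
    qed
    consider (i) "?r c = i" | (b) "?r c \<noteq> i" "?r (?N' c) = i" | (o) "?r c \<noteq> i" "?r (?N' c) \<noteq> i" by blast
    then show "(g \<circ> cylinder_swap W j \<circ> h) c = cylinder_swap W i c"
    proof cases
      case i
      then show ?thesis using inI[OF c i] by (simp add: cylinder_swap_def step_swap_def)
    next
      case b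
      let ?d = "?N' c"
      note d = inI[OF X(2)[OF c] b(2)]
      let ?e = "write_window W j ?d"
      have "h c = ?N ?e" using d(2) gh(1)[OF X(1)[OF d(3)]] NN(2)[OF c] by simp
      moreover have "?r (?N ?e) \<noteq> j" using free(2) d(3,4) by (simp add: step_free_def)
      ultimately have "cylinder_swap W j (h c) = ?e"
        using NN(1)[OF d(3)] d(4) by (simp add: cylinder_swap_def step_swap_def)
      moreover have "g ?e = ?d" using d(1) gh(2)[OF X(2)[OF c]] by simp
      ultimately show ?thesis using b by (simp add: cylinder_swap_def step_swap_def)
    next
      case o
      note hX = gh(3)[OF c]
      have "?r (h c) \<noteq> j"
      proof
        assume "?r (h c) = j"
        then have "c = write_window W i (h c)" using g1(1)[OF hX] gh(2)[OF c] by simp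
        then have "?r c = i" using read_write_window[OF ij(1)] by metis
        then show False using o by simp
      qed
      moreover have "?r (?N' (h c)) \<noteq> j"
      proof
        assume a: "?r (?N' (h c)) = j"
        have "c = ?N (write_window W i (?N' (h c)))"
          using g1(2)[OF X(2)[OF hX] a] gh(2)[OF c] NN(2)[OF hX] by simp
        then have "?N' c = write_window W i (?N' (h c))"
          using NN(1)[OF write_window_configs[OF X(2)[OF hX] ij(1)]] by metis
        then have "?r (?N' c) = i" using read_write_window[OF ij(1)] by metis
        then show False using o by simp
      qed
      ultimately show ?thesis using gh(2)[OF c] o by (simp add: cylinder_swap_def step_swap_def)
    qed
  qed
qed (use j in simp)

text \<open>
  In a state below \<open>k\<close> the successor is in the same cell, so the swap is a local permutation.
\<close>

lemma cylinder_swap_same_head: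
  assumes W: "full_window W" and i: "(p, q) \<in> patterns n k W" and q: "q < k"
  shows "cylinder_swap W (p, q) \<in> G"
proof -
  have j: "(p, q + 1) \<in> patterns n k W" using i q by (auto simp: patterns_def tm_states_def)
  then have "window_map W (transpose (p, q) (p, q + 1)) \<in> G" using W i by (auto simp: full_window_def)
  then show ?thesis
  proof (rule cong_mem)
    fix c :: "int tm_config" assume c: "c \<in> tm_configs n k"
    obtain x s v where e: "c = (x, s, v)" by (rule prod_cases3)
    have s: "1 \<le> s" "s \<le> k" using c by (auto simp: e tm_configs_def tm_states_def)
    have q1: "1 \<le> q" using i by (auto simp: patterns_def tm_states_def)
    have w: "write_window W (p, q') (x, s', v) = (x, q', v)" if "(\<lambda>u\<in>W. x (v + u)) = p" for q' s'
      using that by (auto simp: write_window_def)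
    show "window_map W (transpose (p, q) (p, q + 1)) c = cylinder_swap W (p, q) c"
      using s q q1 unfolding window_map_transpose cylinder_swap_def step_swap_def
      unfolding e config_shift_forward[OF s] config_shift_backward[OF s]
      by (auto simp: w read_window_def)
  qed
qed

lemma cylinder_swap_mem:
  assumes n: "n \<ge> 2" and W: "full_window W" "{0..3} \<subseteq> W" and i: "i \<in> patterns n k W"
    and free: "step_free n k (\<lambda>c. read_window W c = i)"
  shows "cylinder_swap W i \<in> G"
proof -
  obtain p q where e: "i = (p, q)" by (rule prod.exhaust)
  show ?thesis
  proof (cases "q < k")
    case True
    then show ?thesis using cylinder_swap_same_head[OF W(1)] i e by simp
  next
    case False
    then have q: "q = k" using i by (auto simp: e patterns_def tm_states_def)
    have W': "0 \<in> W" "1 \<in> W" "2 \<in> W" "3 \<in> W" using W(2) by auto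
    \<comment> \<open>Cells 0 and 1 carry the marker. The symbol in cell 2 is chosen different from \<open>p 3\<close>, hence no
      configuration matches \<open>p'\<close> and has a predecessor that matches \<open>p\<close>.\<close>
    define p' :: "int \<Rightarrow> nat" where "p' = (\<lambda>u\<in>W. if u = 1 \<or> u = 2 \<and> p 3 = 0 then 1 else 0)"
    have p': "p' 0 = 0" "p' 1 = 1" "p' 2 \<noteq> p 3" using W' by (auto simp: p'_def)
    have j: "(p', k) \<in> patterns n k W"
      using n k_pos by (auto simp: p'_def patterns_def tape_symbols_def tm_states_def)
    have read: "(\<lambda>u\<in>W. x (v + u)) = r \<Longrightarrow> u \<in> W \<Longrightarrow> x (v + u) = r u" for x :: "int \<Rightarrow> nat" and v r u
      by auto
    show ?thesis
    proof (rule cylinder_swap_conjugate[OF W(1) i j free _ _ cylinder_swap_marked[OF W(1) W'(1,2) j p'(1,2)]])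
      show "step_free n k (\<lambda>c. read_window W c = (p', k))"
        unfolding step_free_def
      proof (intro ballI impI notI)
        fix c :: "int tm_config" assume c: "read_window W c = (p', k)" "read_window W (config_shift k 1 c) = (p', k)"
        obtain x s v where e: "c = (x, s, v)" by (rule prod_cases3)
        \<comment> \<open>a second match in the next cell would require 0 where the first one requires 1\<close>
        have "s = k" "x (v + 1) = 1" using c(1) read[of x v p' 1] W' p' by (auto simp: e read_window_def)
        moreover from this have "x (v + 1 + 0) = 0"
          using c(2) read[of x "v + 1" p' 0] W' p' k_pos by (auto simp: e read_window_def config_shift_forward)
        ultimately show False by simp
      qed
      fix c :: "int tm_config"
      assume c: "c \<in> tm_configs n k" "read_window W (config_shift k 1 c) = (p', k)"
      show "read_window W c \<noteq> i"
      proof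
        assume c': "read_window W c = i"
        obtain x s v where e': "c = (x, s, v)" by (rule prod_cases3)
        have "s = k" "x (v + 3) = p 3" using c' read[of x v p 3] W' by (auto simp: e e' q read_window_def)
        moreover from this have "x (v + 1 + 2) = p' 2"
          using c(2) read[of x "v + 1" p' 2] W' k_pos by (auto simp: e' read_window_def config_shift_forward)
        ultimately show False using p' by (simp add: add.commute)
      qed
    qed
  qed
qed

text \<open>
  The swap for a set of patterns is the product of the swaps for the single patterns: these have
  disjoint supports, as the set contains no two consecutive configurations.
\<close>

lemma window_swap_mem:
  assumes n: "n \<ge> 2" and W: "full_window W" "{0..3} \<subseteq> W"
    and J: "finite J" "J \<subseteq> patterns n k W" "step_free n k (\<lambda>c. read_window W c \<in> J)"
  shows "step_swap k (\<lambda>c. read_window W c \<in> J) \<in> G"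
  using J
proof (induction J rule: finite_induct)
  case empty
  then show ?case by (intro cong_mem[OF id_mem]) (simp add: step_swap_def)
next
  case (insert i J)
  let ?X = "tm_configs n k :: int tm_config set"
  let ?N = "config_shift k 1" and ?N' = "config_shift k (- 1)"
  let ?r = "read_window W"
  have free: "?r (?N c) \<notin> insert i J" if "c \<in> ?X" "?r c \<in> insert i J" for c
    using insert.prems(2) that by (auto simp: step_free_def)
  have "step_free n k (\<lambda>c. ?r c \<in> J)" "step_free n k (\<lambda>c. ?r c = i)"
    using free by (auto simp: step_free_def)
  then have "step_swap k (\<lambda>c. ?r c \<in> J) \<in> G" "cylinder_swap W i \<in> G"
    using insert cylinder_swap_mem[OF n W] by auto
  from comp_mem[OF this] show ?case
  proof (rule cong_mem)
    fix c :: "int tm_config" assume c: "c \<in> ?X"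
    have X: "?N c \<in> ?X" "?N' c \<in> ?X" "?N' (?N' c) \<in> ?X" using c k_pos config_shift_configs by blast+
    have NN: "?N' (?N c) = c" "?N (?N' c) = c" "?N (?N' (?N' c)) = ?N' c"
      using c X k_pos config_shift_inverse by blast+
    have "?r (?N c) \<notin> insert i J" if "?r c \<in> insert i J" using free[OF c that] .
    moreover have "?r c \<notin> insert i J" if "?r (?N' c) \<in> insert i J" using free[OF X(2) that] NN by simp
    moreover have "?r (?N' c) \<notin> insert i J" if "?r (?N' (?N' c)) \<in> insert i J" using free[OF X(3) that] NN by simp
    ultimately show "(step_swap k (\<lambda>c. ?r c \<in> J) \<circ> cylinder_swap W i) c = step_swap k (\<lambda>c. ?r c \<in> insert i J) c"
      using insert.hyps NN unfolding step_swap_def cylinder_swap_def by (auto split: if_splits)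
  qed
qed

end

text \<open>
  The value depends on the state and on the contents of a bounded window around the head.
\<close>

definition local_fun :: "nat \<Rightarrow> nat \<Rightarrow> (int tm_config \<Rightarrow> 'b) \<Rightarrow> bool" where
  "local_fun n k d \<longleftrightarrow> (\<exists>F. finite F \<and> (\<forall>c\<in>tm_configs n k. \<forall>c'\<in>tm_configs n k.
     read_window F c = read_window F c' \<longrightarrow> d c = d c'))"

lemma read_window_mono:
  assumes "F \<subseteq> W" "read_window W c = read_window W c'" shows "read_window F c = read_window F c'"
proof -
  obtain x q v y r w where e: "c = (x, q, v)" "c' = (y, r, w)" by (metis prod_cases3)
  have eq: "(\<lambda>u\<in>W. x (v + u)) = (\<lambda>u\<in>W. y (w + u))" and q: "q = r" using assms(2) by (auto simp: e read_window_def)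
  have "x (v + u) = y (w + u)" if "u \<in> F" for u using fun_cong[OF eq, of u] that assms(1) by auto
  then show ?thesis by (auto simp: e read_window_def q intro: restrict_ext)
qed

lemma finite_subset_symmetric_interval:
  assumes "finite (F :: int set)"
  obtains r :: nat where "r \<ge> m" "F \<subseteq> {- int r..<int r}"
proof -
  define b where "b = Max (insert 0 (abs ` F)) + 1"
  have b: "\<bar>u\<bar> < b" if "u \<in> F" for u
  proof -
    have "\<bar>u\<bar> \<le> Max (insert 0 (abs ` F))" using that assms by (intro Max_ge) auto
    then show ?thesis by (simp add: b_def)
  qed
  let ?r = "max m (nat b)"
  have "F \<subseteq> {- int ?r..<int ?r}"
  proof
    fix u assume "u \<in> F"
    then show "u \<in> {- int ?r..<int ?r}" using b[of u] by auto
  qed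
  then show ?thesis using that[of ?r] by simp
qed

lemma (in elementary_generators) local_swap_mem:
  assumes n: "n \<ge> 2" and C: "local_fun n k C" "step_free n k C"
  shows "step_swap k C \<in> G"
proof -
  let ?X = "tm_configs n k :: int tm_config set"
  obtain F where F: "finite F"
    and l: "\<And>c c'. c \<in> ?X \<Longrightarrow> c' \<in> ?X \<Longrightarrow> read_window F c = read_window F c' \<Longrightarrow> C c = C c'"
    using C(1) by (auto simp: local_fun_def)
  obtain r where r: "r \<ge> 4" "F \<subseteq> {- int r..<int r}" by (rule finite_subset_symmetric_interval[OF F])
  let ?W = "{- int r..<int r}"
  define J where "J = read_window ?W ` {c \<in> ?X. C c}"
  have J: "J \<subseteq> patterns n k ?W" using read_window_patterns by (auto simp: J_def)
  have eq: "read_window ?W c \<in> J \<longleftrightarrow> C c" if c: "c \<in> ?X" for c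
  proof
    assume "read_window ?W c \<in> J"
    then obtain c' where c': "c' \<in> ?X" "C c'" "read_window ?W c = read_window ?W c'" by (auto simp: J_def)
    show "C c" using l[OF c c'(1) read_window_mono[OF r(2) c'(3)]] c'(2) by simp
  qed (use c in \<open>auto simp: J_def\<close>)
  have X: "config_shift k j c \<in> ?X" if "c \<in> ?X" for c j using that k_pos config_shift_configs by blast
  have "step_swap k (\<lambda>c. read_window ?W c \<in> J) \<in> G"
  proof (rule window_swap_mem[OF n symmetric_interval_full[OF n]])
    show "finite J" using J finite_patterns[of ?W n k] by (auto intro: finite_subset)
    show "step_free n k (\<lambda>c. read_window ?W c \<in> J)" using C(2) eq X by (auto simp: step_free_def)
  qed (use r J in auto)
  then show ?thesis by (rule cong_mem) (simp add: step_swap_def eq X)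
qed

section \<open>Local functions of the configuration\<close>

lemma read_window_agreeD:
  assumes "read_window W (x, q, v) = read_window W (y, r, w)"
  shows "q = r" "u \<in> W \<Longrightarrow> x (v + u) = y (w + u)"
proof -
  have eq: "(\<lambda>u\<in>W. x (v + u)) = (\<lambda>u\<in>W. y (w + u))" and "q = r"
    using assms by (simp_all add: read_window_def)
  then show "q = r" by simp
  show "x (v + u) = y (w + u)" if "u \<in> W" using fun_cong[OF eq, of u] that by simp
qed

lemma local_fun_state: "local_fun n k (\<lambda>c. fst (snd c))"
  unfolding local_fun_def by (intro exI[of _ "{}"]) (auto simp: read_window_def split: prod.splits)

lemma local_fun_combine:
  assumes "local_fun n k d" "local_fun n k e"
  shows "local_fun n k (\<lambda>c. h (d c) (e c))"
proof -
  obtain F where F: "finite F" "\<And>c c'. c \<in> tm_configs n k \<Longrightarrow> c' \<in> tm_configs n k \<Longrightarrow> read_window F c = read_window F c' \<Longrightarrow> d c = d c'"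
    using assms(1) unfolding local_fun_def by auto
  obtain F' where F': "finite F'" "\<And>c c'. c \<in> tm_configs n k \<Longrightarrow> c' \<in> tm_configs n k \<Longrightarrow> read_window F' c = read_window F' c' \<Longrightarrow> e c = e c'"
    using assms(2) unfolding local_fun_def by auto
  show ?thesis unfolding local_fun_def
  proof (intro exI[of _ "F \<union> F'"] conjI ballI impI)
    fix c c' :: "int tm_config"
    assume c: "c \<in> tm_configs n k" "c' \<in> tm_configs n k" and r: "read_window (F \<union> F') c = read_window (F \<union> F') c'"
    have "d c = d c'" by (rule F(2)[OF c]) (rule read_window_mono[OF _ r], simp)
    moreover have "e c = e c'" by (rule F'(2)[OF c]) (rule read_window_mono[OF _ r], simp)
    ultimately show "h (d c) (e c) = h (d c') (e c')" by simp
  qed (use F F' in simp)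
qed

lemma local_fun_shift:
  assumes "k \<ge> 1" "local_fun n k d"
  shows "local_fun n k (\<lambda>c. d (config_shift k j c))"
proof -
  obtain F where F: "finite F" "\<And>c c'. c \<in> tm_configs n k \<Longrightarrow> c' \<in> tm_configs n k \<Longrightarrow> read_window F c = read_window F c' \<Longrightarrow> d c = d c'"
    using assms(2) unfolding local_fun_def by auto
  define m where "m = (\<lambda>q :: nat. (int q - 1 + j) div int k)"
  define F' where "F' = (\<Union>q\<in>tm_states k. (+) (m q) ` F)"
  show ?thesis unfolding local_fun_def
  proof (intro exI[of _ F'] conjI ballI impI)
    show "finite F'" using F(1) by (auto simp: F'_def tm_states_def)
    fix c c' :: "int tm_config"
    assume c: "c \<in> tm_configs n k" "c' \<in> tm_configs n k" and r: "read_window F' c = read_window F' c'"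
    obtain x q v where e: "c = (x, q, v)" by (rule prod_cases3)
    obtain y q' w where e': "c' = (y, q', w)" by (rule prod_cases3)
    have q: "q' = q" "q \<in> tm_states k"
      using read_window_agreeD(1)[OF r[unfolded e e']] c(1) by (auto simp: e tm_configs_def)
    have "x (v + m q + u) = y (w + m q + u)" if "u \<in> F" for u
    proof -
      have "m q + u \<in> F'" using that q(2) by (auto simp: F'_def)
      from read_window_agreeD(2)[OF r[unfolded e e'] this] show ?thesis by (simp add: add.assoc)
    qed
    then have "read_window F (config_shift k j c) = read_window F (config_shift k j c')"
      unfolding config_shift_eq_state_move[OF assms(1)] e e' q state_move_def read_window_def m_def
      by (auto intro!: restrict_ext)
    then show "d (config_shift k j c) = d (config_shift k j c')"
      by (intro F(2) config_shift_configs assms(1) c)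
  qed
qed

lemma local_fun_finite_range:
  assumes "local_fun n k d" shows "finite (d ` tm_configs n k)"
proof -
  let ?X = "tm_configs n k :: int tm_config set"
  obtain F where F: "finite F" "\<And>c c'. c \<in> ?X \<Longrightarrow> c' \<in> ?X \<Longrightarrow> read_window F c = read_window F c' \<Longrightarrow> d c = d c'"
    using assms unfolding local_fun_def by auto
  have "finite (read_window F ` ?X)"
    by (rule finite_subset[OF _ finite_patterns[OF F(1)]]) (use read_window_patterns in blast)
  moreover have "d ` ?X \<subseteq> (\<lambda>i. d (inv_into ?X (read_window F) i)) ` read_window F ` ?X"
  proof
    fix y assume "y \<in> d ` ?X"
    then obtain c where c: "c \<in> ?X" "y = d c" by blast
    have "d c = d (inv_into ?X (read_window F) (read_window F c))"
      using c(1) by (intro F(2)) (auto simp: inv_into_into f_inv_into_f)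
    then show "y \<in> (\<lambda>i. d (inv_into ?X (read_window F) i)) ` read_window F ` ?X" using c by blast
  qed
  ultimately show ?thesis by (meson finite_imageI finite_subset)
qed

section \<open>Finite-state automata\<close>

definition displacement :: "nat \<Rightarrow> (int tm_config \<Rightarrow> int tm_config) \<Rightarrow> int tm_config \<Rightarrow> int" where
  "displacement k T c = config_index k (T c) - config_index k c"

text \<open>
  The machines in \<^const>\<open>RFA\<close> have these properties. On each tape such a map permutes the linearly
  ordered head configurations.
\<close>

definition head_map :: "nat \<Rightarrow> nat \<Rightarrow> (int tm_config \<Rightarrow> int tm_config) \<Rightarrow> bool" where
  "head_map n k T \<longleftrightarrow> bij_betw T (tm_configs n k) (tm_configs n k) \<and>
     (\<forall>c\<in>tm_configs n k. fst (T c) = fst c) \<and> local_fun n k (displacement k T)"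

definition fixes_blank :: "nat \<Rightarrow> nat \<Rightarrow> (int tm_config \<Rightarrow> int tm_config) \<Rightarrow> bool" where
  "fixes_blank n k T \<longleftrightarrow> (\<forall>c\<in>tm_configs n k. fst c = (\<lambda>_. 0) \<longrightarrow> T c = c)"

lemma head_mapD:
  assumes "head_map n k T" "c \<in> tm_configs n k"
  shows "T c \<in> tm_configs n k" "fst (T c) = fst c" "T c = config_at k (fst c) (config_index k c + displacement k T c)"
proof -
  show 1: "T c \<in> tm_configs n k" using assms by (auto simp: head_map_def bij_betw_def)
  show 2: "fst (T c) = fst c" using assms by (auto simp: head_map_def)
  show "T c = config_at k (fst c) (config_index k c + displacement k T c)"
    using config_at_index[OF 1] 2 by (simp add: displacement_def)
qed

text \<open>
  The map sends \<open>{a..}\<close> into \<open>{a + D..}\<close> and is the identity far to the right. Cutting both sets off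
  there contradicts injectivity by counting: a long run of displacement \<open>D\<close> would be a positive
  flow to the right which has nowhere to go.
\<close>

lemma int_injection_long_run:
  fixes f :: "int \<Rightarrow> int"
  assumes "inj f" and R: "\<And>i. i - R \<le> f i" and D: "D \<le> R" "D > 0"
    and run: "\<And>i. a \<le> i \<Longrightarrow> i \<le> a + 2 * R \<Longrightarrow> f i = i + D"
    and far: "\<And>i. i \<ge> M \<Longrightarrow> f i = i"
  shows False
proof -
  define M' where "M' = max M (a + D)"
  have "f ` {a..<M'} \<subseteq> {a + D..<M'}"
  proof (rule image_subsetI)
    fix i assume i: "i \<in> {a..<M'}"
    \<comment> \<open>beyond the run, a displacement of at least \<open>- R\<close> cannot lead back below \<open>a + R\<close>\<close>
    have "a + D \<le> f i" using run[of i] R[of i] i D by (cases "i \<le> a + 2 * R") auto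
    moreover have "f i < M'"
    proof (rule ccontr)
      assume "\<not> f i < M'"
      then have "f (f i) = f i" using far by (simp add: M'_def)
      then have "f i = i" using assms(1) by (simp add: inj_eq)
      then show False using i \<open>\<not> f i < M'\<close> by simp
    qed
    ultimately show "f i \<in> {a + D..<M'}" by simp
  qed
  then have "card {a..<M'} \<le> card {a + D..<M'}"
    using assms(1) by (intro card_inj_on_le) (auto intro: inj_on_subset)
  then show False using D by (simp add: M'_def)
qed

lemma int_injection_descending:
  fixes f :: "int \<Rightarrow> int"
  assumes "inj f" "\<And>i. f i \<le> i" "\<And>i. i \<le> M \<Longrightarrow> f i = i"
  shows "f i = i"
proof (cases "i \<le> M")
  case False
  then have "M \<le> i" by simp
  then have "\<forall>j\<le>i. f j = j"
  proof (induction i rule: int_ge_induct)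
    case (step i)
    have "f (i + 1) = i + 1"
    proof (rule ccontr)
      assume "f (i + 1) \<noteq> i + 1"
      then have "f (i + 1) \<le> i" using assms(2)[of "i + 1"] by simp
      then have "f (f (i + 1)) = f (i + 1)" using step.IH by simp
      then have "f (i + 1) = i + 1" using assms(1) by (simp add: inj_eq)
      then show False using \<open>f (i + 1) \<noteq> i + 1\<close> by simp
    qed
    then show ?case using step.IH by (metis zle_add1_eq_le order_le_less)
  qed (use assms(3) in simp)
  then show ?thesis by simp
qed (use assms(3) in simp)

text \<open>
  A map that is the identity on the blank tape has displacement 0 wherever the head sees only
  blanks. As the displacement is local, the tape may be blanked far away from the head without
  changing it at a given configuration. After that, the map is the identity far out.
\<close>

locale blank_fixing_head_map =
  fixes n k :: nat and T :: "int tm_config \<Rightarrow> int tm_config"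
  assumes n_pos: "n \<ge> 1" and k_pos: "k \<ge> 1" and T: "head_map n k T" "fixes_blank n k T"
begin

abbreviation "X \<equiv> tm_configs n k :: int tm_config set"
abbreviation "d \<equiv> displacement k T"

definition tape :: "(int \<Rightarrow> nat) \<Rightarrow> bool" where "tape x \<longleftrightarrow> (\<forall>u. x u < n)"

lemma config_at_X: "tape x \<Longrightarrow> config_at k x i \<in> X"
proof -
  assume "tape x"
  then have "(x, 1, 0) \<in> X" using k_pos by (auto simp: tape_def tm_configs_def tape_symbols_def tm_states_def)
  from config_at_configs[OF k_pos this] show ?thesis by simp
qed

lemma tape_fst: "c \<in> X \<Longrightarrow> tape (fst c)"
  by (auto simp: tape_def tm_configs_def tape_symbols_def)

lemma read_config_at:
  "(\<And>u. u \<in> F \<Longrightarrow> x (i div int k + u) = y (i div int k + u)) \<Longrightarrow>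
    read_window F (config_at k x i) = read_window F (config_at k y i)"
  by (auto simp: config_at_def read_window_def intro: restrict_ext)

lemma displacement_radius:
  obtains r :: nat where
    "\<And>x y i. tape x \<Longrightarrow> tape y \<Longrightarrow> (\<And>u. \<bar>u - i div int k\<bar> \<le> int r \<Longrightarrow> x u = y u)
       \<Longrightarrow> d (config_at k x i) = d (config_at k y i)"
proof -
  obtain F where F: "finite F" "\<And>c c'. c \<in> X \<Longrightarrow> c' \<in> X \<Longrightarrow> read_window F c = read_window F c' \<Longrightarrow> d c = d c'"
    using T(1) unfolding head_map_def local_fun_def by auto
  obtain r :: nat where r: "F \<subseteq> {- int r..<int r}" using finite_subset_symmetric_interval[OF F(1)] by metis
  have "d (config_at k x i) = d (config_at k y i)"
    if "tape x" "tape y" and eq: "\<And>u. \<bar>u - i div int k\<bar> \<le> int r \<Longrightarrow> x u = y u" for x y i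
  proof (rule F(2)[OF config_at_X[OF that(1)] config_at_X[OF that(2)]], rule read_config_at, rule eq)
    fix u assume "u \<in> F"
    then have "u \<in> {- int r..<int r}" using r by blast
    then show "\<bar>i div int k + u - i div int k\<bar> \<le> int r" by auto
  qed
  then show ?thesis by (rule that)
qed

lemma blank_displacement: "d (config_at k (\<lambda>_. 0) i) = 0"
proof -
  have "config_at k (\<lambda>_. 0) i \<in> X" using n_pos by (intro config_at_X) (simp add: tape_def)
  then show ?thesis using T(2) by (simp add: fixes_blank_def displacement_def)
qed

lemma orbit_inj:
  assumes "tape x" shows "inj (\<lambda>i. i + d (config_at k x i))"
proof (rule injI)
  fix i j assume eq: "i + d (config_at k x i) = j + d (config_at k x j)"
  have "T (config_at k x i) = T (config_at k x j)"
    using head_mapD(3)[OF T(1) config_at_X[OF assms, of i]] head_mapD(3)[OF T(1) config_at_X[OF assms, of j]] eq k_pos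
    by (simp add: config_index_at)
  then have "config_at k x i = config_at k x j"
    using T(1) config_at_X[OF assms] by (auto simp: head_map_def bij_betw_def inj_on_eq_iff)
  then show "i = j" using config_index_at[OF k_pos] by metis
qed

lemma div_int_bounds: "i \<le> int k * m \<Longrightarrow> i div int k \<le> m" "i \<ge> int k * m \<Longrightarrow> i div int k \<ge> m"
proof -
  assume "i \<le> int k * m" then show "i div int k \<le> m" using zdiv_mono1[of i "int k * m" "int k"] k_pos by simp
next
  assume "i \<ge> int k * m" then show "i div int k \<ge> m" using zdiv_mono1[of "int k * m" i "int k"] k_pos by simp
qed

text \<open>
  The tape is blanked to the left of the window that determines the displacement of \<open>c\<close>. An
  injection that never increases and is the identity far to the left is the identity.
\<close>

lemma nonpositive_displacement_id:
  assumes "\<And>c. c \<in> X \<Longrightarrow> d c \<le> 0" and c: "c \<in> X"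
  shows "T c = c"
proof -
  obtain r where r: "\<And>x y i. tape x \<Longrightarrow> tape y \<Longrightarrow> (\<And>u. \<bar>u - i div int k\<bar> \<le> int r \<Longrightarrow> x u = y u)
       \<Longrightarrow> d (config_at k x i) = d (config_at k y i)" by (rule displacement_radius) blast
  let ?x = "fst c" and ?i = "config_index k c"
  let ?b = "?i div int k - int r"
  define y where "y = (\<lambda>u. if u < ?b then 0 else ?x u)"
  have ty: "tape y" and t0: "tape (\<lambda>_. 0)" using tape_fst[OF c] n_pos by (auto simp: y_def tape_def)
  have "?i + d (config_at k y ?i) = ?i"
  proof (rule int_injection_descending[where M = "int k * (?b - int r - 1)"])
    show "inj (\<lambda>i. i + d (config_at k y i))" by (rule orbit_inj[OF ty])
    show "i + d (config_at k y i) \<le> i" for i using assms(1)[OF config_at_X[OF ty]] by simp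
    fix i assume "i \<le> int k * (?b - int r - 1)"
    then have "i div int k \<le> ?b - int r - 1" by (rule div_int_bounds)
    then have "d (config_at k y i) = d (config_at k (\<lambda>_. 0) i)" by (intro r[OF ty t0]) (auto simp: y_def)
    then show "i + d (config_at k y i) = i" by (simp add: blank_displacement)
  qed
  moreover have "d (config_at k y ?i) = d (config_at k ?x ?i)"
    by (rule r[OF ty tape_fst[OF c]]) (auto simp: y_def)
  ultimately have "d c = 0" by (simp add: config_at_index[OF c])
  then show ?thesis using head_mapD(3)[OF T(1) c] by (simp add: config_at_index[OF c])
qed

text \<open>
  Here the tape is blanked to the right of the run.
\<close>

lemma maximal_runs_bounded:
  assumes D: "D > 0" "\<And>c. c \<in> X \<Longrightarrow> d c \<le> D"
  obtains l :: nat where "\<And>c. c \<in> X \<Longrightarrow> \<exists>j\<le>l. d (config_shift k (int j) c) \<noteq> D"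
proof -
  obtain r where r: "\<And>x y i. tape x \<Longrightarrow> tape y \<Longrightarrow> (\<And>u. \<bar>u - i div int k\<bar> \<le> int r \<Longrightarrow> x u = y u)
       \<Longrightarrow> d (config_at k x i) = d (config_at k y i)" by (rule displacement_radius) blast
  have "finite (d ` X)" using T(1) local_fun_finite_range by (auto simp: head_map_def)
  define R where "R = Max (insert D (abs ` d ` X))"
  have R: "\<bar>d c\<bar> \<le> R" if "c \<in> X" for c unfolding R_def using \<open>finite (d ` X)\<close> that by (intro Max_ge) auto
  have DR: "D \<le> R" unfolding R_def using \<open>finite (d ` X)\<close> by (intro Max_ge) auto
  have "\<exists>j\<le>nat (2 * R). d (config_shift k (int j) c) \<noteq> D" if c: "c \<in> X" for c
  proof (rule ccontr)
    assume "\<not> ?thesis"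
    then have run: "d (config_shift k (int j) c) = D" if "j \<le> nat (2 * R)" for j using that by blast
    let ?x = "fst c" and ?a = "config_index k c"
    let ?b = "(?a + 2 * R) div int k + int r"
    define y where "y = (\<lambda>u. if u > ?b then 0 else ?x u)"
    have ty: "tape y" and t0: "tape (\<lambda>_. 0)" using tape_fst[OF c] n_pos by (auto simp: y_def tape_def)
    show False
    proof (rule int_injection_long_run[where M = "int k * (?b + int r + 1)"])
      show "inj (\<lambda>i. i + d (config_at k y i))" by (rule orbit_inj[OF ty])
      show "i - R \<le> i + d (config_at k y i)" for i using R[OF config_at_X[OF ty, of i]] by linarith
      show "D \<le> R" "D > 0" by fact+
    next
      fix i assume i: "?a \<le> i" "i \<le> ?a + 2 * R"
      have "d (config_at k y i) = d (config_at k ?x i)"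
        by (rule r[OF ty tape_fst[OF c]])
          (use zdiv_mono1[OF i(2), of "int k"] k_pos in \<open>auto simp: y_def\<close>)
      also have "config_at k ?x i = config_shift k (int (nat (i - ?a))) c" using i by (simp add: config_shift_def)
      also have "d \<dots> = D" using i by (intro run) simp
      finally show "i + d (config_at k y i) = i + D" by simp
    next
      fix i assume "i \<ge> int k * (?b + int r + 1)"
      then have "i div int k \<ge> ?b + int r + 1" by (rule div_int_bounds)
      then have "d (config_at k y i) = d (config_at k (\<lambda>_. 0) i)" by (intro r[OF ty t0]) (auto simp: y_def)
      then show "i + d (config_at k y i) = i" by (simp add: blank_displacement)
    qed
  qed
  then show ?thesis by (rule that)
qed

end

lemma fst_step_swap [simp]: "fst (step_swap k C c) = fst c"
  by (simp add: step_swap_def)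

lemma step_swap_bij:
  assumes "k \<ge> 1" "step_free n k C"
  shows "bij_betw (step_swap k C) (tm_configs n k) (tm_configs n k)"
  by (rule bij_betw_byWitness[of _ "step_swap k C"])
    (use step_swap_involution[OF assms] step_swap_configs[OF assms(1)] in auto)

text \<open>
  One round of bubble sort. \<open>C\<close> selects the last configurations of the maximal runs of displacement \<open>D\<close>.
  The displacement of the successor of such a configuration is at most \<open>D - 2\<close>, because with \<open>D - 1\<close>
  the two would have the same image. After swapping the two, both displacements are below \<open>D\<close>.
  Thus each run loses its last element and no new run arises.
\<close>

lemma shorten_maximal_runs:
  fixes n k :: nat and T D
  defines "d \<equiv> displacement k T"
  defines "C \<equiv> \<lambda>c. d c = D \<and> d (config_shift k 1 c) \<noteq> D"
  assumes k: "k \<ge> 1" and T: "head_map n k T" "fixes_blank n k T"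
    and D: "D > 0" "\<forall>c\<in>tm_configs n k. d c \<le> D"
  shows "local_fun n k C" "step_free n k C" "head_map n k (T \<circ> step_swap k C)"
    "fixes_blank n k (T \<circ> step_swap k C)"
    "\<And>c. c \<in> tm_configs n k \<Longrightarrow> displacement k (T \<circ> step_swap k C) c \<le> D"
    "\<And>c. c \<in> tm_configs n k \<Longrightarrow> displacement k (T \<circ> step_swap k C) c = D \<Longrightarrow>
       d c = D \<and> d (config_shift k 1 c) = D"
proof -
  let ?X = "tm_configs n k :: int tm_config set"
  let ?N = "config_shift k 1" and ?N' = "config_shift k (- 1)"
  have ld: "local_fun n k d" using T(1) by (simp add: head_map_def d_def)
  have lN: "local_fun n k (\<lambda>c. d (?N c))" "local_fun n k (\<lambda>c. d (?N' c))" by (rule local_fun_shift[OF k ld])+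
  show lC: "local_fun n k C"
    unfolding C_def by (rule local_fun_combine[OF ld lN(1), of "\<lambda>a b. a = D \<and> b \<noteq> D"])
  show free: "step_free n k C" by (simp add: step_free_def C_def)
  have X: "?N c \<in> ?X" "?N' c \<in> ?X" if "c \<in> ?X" for c using that k config_shift_configs by blast+
  have NN: "?N' (?N c) = c" "?N (?N' c) = c" if "c \<in> ?X" for c using that k config_shift_inverse by blast+
  have form: "displacement k (T \<circ> step_swap k C) c
      = (if C c then d (?N c) + 1 else if C (?N' c) then d (?N' c) - 1 else d c)" for c
    using k by (simp add: displacement_def d_def step_swap_def config_index_shift)
  have gap: "d (?N c) \<le> D - 2" if c: "c \<in> ?X" "C c" for c
  proof -
    have "d (?N c) \<noteq> D - 1"
    proof
      assume a: "d (?N c) = D - 1"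
      have "T (?N c) = T c"
        using head_mapD(3)[OF T(1) c(1)] head_mapD(3)[OF T(1) X(1)[OF c(1)]] a c(2) k
        by (simp add: C_def d_def config_index_shift)
      moreover have "inj_on T ?X" using T(1) by (simp add: head_map_def bij_betw_def)
      ultimately have "?N c = c" using X(1)[OF c(1)] c(1) by (simp add: inj_on_eq_iff)
      then show False using config_index_shift[OF k, of 1 c] by simp
    qed
    moreover have "d (?N c) \<noteq> D" using c by (simp add: C_def)
    ultimately show ?thesis using bspec[OF D(2) X(1)[OF c(1)]] by simp
  qed
  show "displacement k (T \<circ> step_swap k C) c \<le> D" if c: "c \<in> ?X" for c
    using gap[OF c] bspec[OF D(2) c] bspec[OF D(2) X(2)[OF c]] by (auto simp: form)
  show "d c = D \<and> d (?N c) = D" if c: "c \<in> ?X" "displacement k (T \<circ> step_swap k C) c = D" for c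
    using c(2) gap[OF c(1)] bspec[OF D(2) X(2)[OF c(1)]] unfolding form by (auto split: if_splits simp: C_def)
  show "head_map n k (T \<circ> step_swap k C)"
    unfolding head_map_def
  proof (intro conjI ballI)
    show "bij_betw (T \<circ> step_swap k C) ?X ?X"
      using step_swap_bij[OF k free] T(1) by (auto simp: head_map_def intro: bij_betw_trans)
    show "fst ((T \<circ> step_swap k C) c) = fst c" if "c \<in> ?X" for c
      using head_mapD(2)[OF T(1) step_swap_configs[OF k that]] by simp
    have lC': "local_fun n k (\<lambda>c. C (?N' c))" by (rule local_fun_shift[OF k lC])
    have "local_fun n k (\<lambda>c. if C (?N' c) then d (?N' c) - 1 else d c)"
      using local_fun_combine[OF local_fun_combine[OF lC' lN(2), of Pair] ld, of "\<lambda>(a, b) c. if a then b - 1 else c"] by simp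
    from local_fun_combine[OF local_fun_combine[OF lC lN(1), of Pair] this, of "\<lambda>(a, b) c. if a then b + 1 else c"]
    show "local_fun n k (displacement k (T \<circ> step_swap k C))"
      unfolding form[abs_def] by simp
  qed
  show "fixes_blank n k (T \<circ> step_swap k C)"
    unfolding fixes_blank_def
  proof (intro ballI impI)
    fix c :: "int tm_config" assume c: "c \<in> ?X" "fst c = (\<lambda>_. 0)"
    have "d c' = 0" if "c' \<in> ?X" "fst c' = (\<lambda>_. 0)" for c'
      using T(2) that by (simp add: fixes_blank_def d_def displacement_def)
    then have "\<not> C c" "\<not> C (?N' c)" using c X D(1) by (auto simp: C_def)
    then show "(T \<circ> step_swap k C) c = c" using T(2) c by (simp add: step_swap_def fixes_blank_def)
  qed
qed

context elementary_generators
begin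

text \<open>
  Induction on the maximal displacement \<open>D\<close> and, for fixed \<open>D\<close>, on a bound for the length of the runs
  of displacement \<open>D\<close>.
\<close>

lemma blank_fixing_head_map_mem:
  assumes n: "n \<ge> 2" and T: "head_map n k T" "fixes_blank n k T"
  shows "T \<in> G"
proof -
  let ?X = "tm_configs n k :: int tm_config set"
  have main: "\<forall>T. head_map n k T \<longrightarrow> fixes_blank n k T \<longrightarrow> (\<forall>c\<in>?X. displacement k T c \<le> int D) \<longrightarrow> T \<in> G" for D
  proof (induction D)
    case 0
    show ?case
    proof (intro allI impI)
      fix T assume T: "head_map n k T" "fixes_blank n k T"
        and le: "\<forall>c\<in>?X. displacement k T c \<le> int 0"
      interpret blank_fixing_head_map n k T by unfold_locales (use n k_pos T in auto)
      have "T c = c" if "c \<in> ?X" for c by (rule nonpositive_displacement_id[OF _ that]) (use le in simp)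
      then show "T \<in> G" by (intro cong_mem[OF id_mem]) simp
    qed
  next
    case (Suc D)
    let ?D = "int (Suc D)"
    have inner: "\<forall>T. head_map n k T \<longrightarrow> fixes_blank n k T \<longrightarrow> (\<forall>c\<in>?X. displacement k T c \<le> ?D) \<longrightarrow>
        (\<forall>c\<in>?X. \<exists>j\<le>l. displacement k T (config_shift k (int j) c) \<noteq> ?D) \<longrightarrow> T \<in> G" for l
    proof (induction l)
      case 0
      show ?case
      proof (intro allI impI)
        fix T assume T: "head_map n k T" "fixes_blank n k T" "\<forall>c\<in>?X. displacement k T c \<le> ?D"
          and run: "\<forall>c\<in>?X. \<exists>j\<le>0. displacement k T (config_shift k (int j) c) \<noteq> ?D"
        have "displacement k T c \<le> int D" if c: "c \<in> ?X" for c
        proof -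
          have "displacement k T c \<noteq> ?D" using run c config_shift_0[OF c] by auto
          moreover have "displacement k T c \<le> ?D" using T(3) c by blast
          ultimately show ?thesis by simp
        qed
        then show "T \<in> G" using Suc.IH T by blast
      qed
    next
      case (Suc l)
      show ?case
      proof (intro allI impI)
        fix T assume T: "head_map n k T" "fixes_blank n k T" "\<forall>c\<in>?X. displacement k T c \<le> ?D"
          and run: "\<forall>c\<in>?X. \<exists>j\<le>Suc l. displacement k T (config_shift k (int j) c) \<noteq> ?D"
        define C where "C = (\<lambda>c. displacement k T c = ?D \<and> displacement k T (config_shift k 1 c) \<noteq> ?D)"
        have D0: "?D > 0" by simp
        note S = shorten_maximal_runs[OF k_pos T(1,2) D0 T(3), folded C_def]
        let ?S = "step_swap k C"
        have SG: "?S \<in> G" by (rule local_swap_mem[OF n S(1,2)])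
        have "\<exists>j\<le>l. displacement k (T \<circ> ?S) (config_shift k (int j) c) \<noteq> ?D" if c: "c \<in> ?X" for c
        proof (rule ccontr)
          assume "\<not> ?thesis"
          then have a: "displacement k (T \<circ> ?S) (config_shift k (int j) c) = ?D" if "j \<le> l" for j using that by blast
          have b: "displacement k T (config_shift k (int j) c) = ?D"
            "displacement k T (config_shift k (int (Suc j)) c) = ?D" if "j \<le> l" for j
            using S(6)[OF config_shift_configs[OF k_pos c] a[OF that]] k_pos by (simp_all add: config_shift_shift add.commute)
          obtain j where j: "j \<le> Suc l" "displacement k T (config_shift k (int j) c) \<noteq> ?D" using run c by blast
          then show False using b(1)[of j] b(2)[of l] by (cases "j \<le> l") (auto simp: le_Suc_eq)
        qed
        then have "T \<circ> ?S \<in> G" using Suc.IH S(3,4,5) by blast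
        from comp_mem[OF this SG] show "T \<in> G"
          by (rule cong_mem) (simp add: step_swap_involution[OF k_pos S(2)])
      qed
    qed
    show ?case
    proof (intro allI impI)
      fix T assume T': "head_map n k T" "fixes_blank n k T"
        and le: "\<forall>c\<in>?X. displacement k T c \<le> ?D"
      interpret blank_fixing_head_map n k T by unfold_locales (use n k_pos T' in auto)
      obtain l where "\<And>c. c \<in> ?X \<Longrightarrow> \<exists>j\<le>l. displacement k T (config_shift k (int j) c) \<noteq> ?D"
        by (rule maximal_runs_bounded[of ?D]) (use le in auto)
      then show "T \<in> G" using inner[of l] T' le by blast
    qed
  qed
  have fin: "finite (displacement k T ` ?X)" using T(1) local_fun_finite_range by (auto simp: head_map_def)
  define D where "D = nat (Max (insert 0 (displacement k T ` ?X)))"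
  have "displacement k T c \<le> int D" if "c \<in> ?X" for c
  proof -
    have "displacement k T c \<le> Max (insert 0 (displacement k T ` ?X))" using fin that by (intro Max_ge) auto
    then show ?thesis by (simp add: D_def)
  qed
  then show ?thesis using main[of D] T by blast
qed

text \<open>
  On the blank tape a head map acts through the state only, so there it coincides with some
  \<open>state_move\<close>, which is divided out. If \<open>n = 1\<close>, the blank tape is the only tape.
\<close>

lemma head_map_mem:
  assumes T: "head_map n k T"
  shows "T \<in> G"
proof -
  let ?X = "tm_configs n k :: int tm_config set" and ?Q = "tm_states k"
  let ?d = "displacement k T"
  define z :: "int \<Rightarrow> nat" where "z = (\<lambda>_. 0)"
  have z0: "z u = 0" for u by (simp add: z_def)
  have zX: "(z, q, v) \<in> ?X \<longleftrightarrow> q \<in> ?Q" for q v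
    using n_pos by (auto simp: z_def tm_configs_def tape_symbols_def)
  obtain F where F: "\<And>c c'. c \<in> ?X \<Longrightarrow> c' \<in> ?X \<Longrightarrow> read_window F c = read_window F c' \<Longrightarrow> ?d c = ?d c'"
    using T unfolding head_map_def local_fun_def by auto
  define e where "e = (\<lambda>q. ?d (z, q, 0))"
  define \<pi> where "\<pi> = (\<lambda>q. Suc (nat ((int q - 1 + e q) mod int k)))"
  define m where "m = (\<lambda>q. (int q - 1 + e q) div int k)"
  have Tz: "T (z, q, v) = (z, \<pi> q, v + m q)" if q: "q \<in> ?Q" for q v
  proof -
    have "?d (z, q, v) = e q"
      unfolding e_def using q z0 by (intro F) (simp_all add: zX read_window_def)
    then have "T (z, q, v) = config_shift k (e q) (z, q, v)"
      using head_mapD(3)[OF T, of "(z, q, v)"] q by (simp add: zX config_shift_def)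
    then show ?thesis by (simp add: config_shift_eq_state_move[OF k_pos] state_move_def \<pi>_def m_def)
  qed
  have \<pi>Q: "\<pi> q \<in> ?Q" if "q \<in> ?Q" for q
    using head_mapD(1)[OF T, of "(z, q, 0)"] Tz[OF that, of 0] that by (simp add: zX)
  have "inj_on \<pi> ?Q"
  proof (rule inj_onI)
    fix q r assume qr: "q \<in> ?Q" "r \<in> ?Q" "\<pi> q = \<pi> r"
    have "T (z, q, 0) = T (z, r, m q - m r)" using Tz qr by simp
    then have "(z, q, 0) = (z, r, m q - m r)"
      using T qr by (auto simp: head_map_def bij_betw_def inj_on_eq_iff zX)
    then show "q = r" by simp
  qed
  moreover have "\<pi> ` ?Q = ?Q"
    by (rule endo_inj_surj) (use \<pi>Q calculation in \<open>auto simp: tm_states_def\<close>)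
  ultimately have bij: "bij_betw \<pi> ?Q ?Q" by (simp add: bij_betw_def)
  define \<rho> where "\<rho> = inv_into ?Q \<pi>"
  have \<rho>: "bij_betw \<rho> ?Q ?Q" unfolding \<rho>_def by (rule bij_betw_inv_into[OF bij])
  have \<pi>\<rho>: "\<rho> (\<pi> q) = q" "\<pi> (\<rho> q) = q" "\<rho> q \<in> ?Q" if "q \<in> ?Q" for q
    using bij that \<rho> unfolding \<rho>_def by (auto simp: bij_betw_inv_into_left bij_betw_inv_into_right bij_betw_apply)
  define E where "E = state_move \<pi> m"
  define E' where "E' = state_move \<rho> (\<lambda>q. - m (\<rho> q))"
  have EX: "E c \<in> ?X" "E' c \<in> ?X" if "c \<in> ?X" for c
    unfolding E_def E'_def by (rule state_move_configs[OF _ that]; use \<pi>Q \<pi>\<rho> in blast)+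
  have EE: "E (E' c) = c" "E' (E c) = c" if "c \<in> ?X" for c
    using that \<pi>\<rho> by (auto simp: E_def E'_def state_move_def tm_configs_def)
  have "E \<in> G" unfolding E_def by (rule state_move_mem[OF bij])
  have blank: "fixes_blank n k (E' \<circ> T)"
    unfolding fixes_blank_def
  proof (intro ballI impI)
    fix c :: "int tm_config" assume c: "c \<in> ?X" "fst c = (\<lambda>_. 0)"
    obtain x q v where e: "c = (x, q, v)" by (rule prod_cases3)
    have x: "x = z" using c(2) by (simp add: e z_def)
    have q: "q \<in> ?Q" using c(1) by (simp add: e x zX)
    show "(E' \<circ> T) c = c" using Tz[OF q, of v] \<pi>\<rho>(1)[OF q] by (simp add: e x E'_def state_move_def)
  qed
  have head: "head_map n k (E' \<circ> T)"
    unfolding head_map_def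
  proof (intro conjI ballI)
    have "bij_betw E' ?X ?X" by (rule bij_betw_byWitness[of _ E]) (use EE EX in auto)
    then show "bij_betw (E' \<circ> T) ?X ?X" using T by (auto simp: head_map_def intro: bij_betw_trans)
    show "fst ((E' \<circ> T) c) = fst c" if "c \<in> ?X" for c
      using head_mapD(2)[OF T that] by (auto simp: E'_def state_move_def split: prod.splits)
    define w where "w = (\<lambda>q. int k * - m (\<rho> q) + (int (\<rho> q) - int q))"
    define s where "s = (\<lambda>q a. a + w (Suc (nat ((int q - 1 + a) mod int k))))"
    have w: "config_index k (E' c) = config_index k c + w (fst (snd c))" for c
      by (cases c) (simp add: E'_def state_move_def config_index_def w_def algebra_simps)
    have l: "local_fun n k (\<lambda>c. s (fst (snd c)) (?d c))"
      by (rule local_fun_combine[OF local_fun_state]) (use T in \<open>simp add: head_map_def\<close>)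
    have "displacement k (E' \<circ> T) c = s (fst (snd c)) (?d c)" if c: "c \<in> ?X" for c
    proof -
      have "fst (snd (T c)) = Suc (nat ((config_index k c + ?d c) mod int k))"
        by (subst head_mapD(3)[OF T c]) (simp add: config_at_def)
      also have "(config_index k c + ?d c) mod int k = (int (fst (snd c)) - 1 + ?d c) mod int k"
      proof -
        obtain x q v where e: "c = (x, q, v)" by (rule prod_cases3)
        have "config_index k c + ?d c = (int q - 1 + ?d c) + int k * v" by (simp add: e config_index_def)
        moreover have "fst (snd c) = q" by (simp add: e)
        ultimately show ?thesis by (simp only: mod_mult_self2)
      qed
      finally show ?thesis by (simp add: s_def displacement_def w)
    qed
    then show "local_fun n k (displacement k (E' \<circ> T))" using l unfolding local_fun_def by (metis (no_types, lifting))
  qed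
  have "E' \<circ> T \<in> G"
  proof (cases "n \<ge> 2")
    case True
    then show ?thesis using blank_fixing_head_map_mem head blank by blast
  next
    case False
    then have "n = 1" using n_pos by simp
    then have "fst c = (\<lambda>_. 0)" if "c \<in> ?X" for c
      using that by (auto simp: tm_configs_def tape_symbols_def PiE_iff fun_eq_iff)
    then have "id c = (E' \<circ> T) c" if "c \<in> ?X" for c using blank that by (simp add: fixes_blank_def)
    then show ?thesis by (intro cong_mem[OF id_mem])
  qed
  from comp_mem[OF \<open>E \<in> G\<close> this] show ?thesis
    by (rule cong_mem) (simp add: EE head_mapD(1)[OF T])
qed

end

section \<open>Elementary machines\<close>

lemma read_window_shift: "(restrict (shift (- v) x) F, q) = read_window F (x, q, v)"
  by (auto simp: shift_def read_window_def add.commute)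

lemma tm_map_eq:
  assumes "(x, q, v) \<in> tm_configs n k" "f (read_window Fin (x, q, v)) = (p', q', u')"
  shows "tm_map n k Fin Fout f (x, q, v) = (\<lambda>u. if u - v \<in> Fout then p' (u - v) else x u, q', v + u')"
  using assms by (intro tm_map_apply) (simp_all only: read_window_shift)

lemma tm_map_local_displacement: "local_fun n k (displacement k (tm_map n k Fin Fout f))"
  if "finite Fin"
  unfolding local_fun_def
proof (intro exI[of _ Fin] conjI ballI impI)
  define h where "h = (\<lambda>(p, q). case f (p, q) of (_, q', u) \<Rightarrow> int k * u + int q' - int q)"
  have h: "displacement k (tm_map n k Fin Fout f) c = h (read_window Fin c)" if c: "c \<in> tm_configs n k" for c
  proof -
    obtain x q v where e: "c = (x, q, v)" by (rule prod_cases3)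
    obtain p' q' u where f: "f (read_window Fin (x, q, v)) = (p', q', u)" by (rule prod_cases3)
    then have "h (read_window Fin (x, q, v)) = int k * u + int q' - int q"
      by (simp add: h_def read_window_def)
    then show ?thesis using tm_map_eq[where f = f and Fin = Fin, of x q v, OF _ f] c
      by (simp add: e displacement_def config_index_def algebra_simps)
  qed
  fix c c' :: "int tm_config"
  assume c: "c \<in> tm_configs n k" "c' \<in> tm_configs n k" and "read_window Fin c = read_window Fin c'"
  then show "displacement k (tm_map n k Fin Fout f) c = displacement k (tm_map n k Fin Fout f) c'"
    by (simp add: h)
qed (use that in simp)

lemma reversible_head_map:
  assumes T: "T \<in> reversible_machines n k" and "\<And>c. c \<in> tm_configs n k \<Longrightarrow> fst (T c) = fst c"
  shows "head_map n k T"
proof -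
  obtain Fin Fout f where "is_local_rule n k Fin Fout f" "T = tm_map n k Fin Fout f"
    using T by (auto simp: reversible_machines_def turing_machines_def)
  then have "local_fun n k (displacement k T)"
    using tm_map_local_displacement by (auto simp: is_local_rule_def)
  then show ?thesis
    using reversible_machine_Bij[OF T] assms(2) by (auto simp: head_map_def Bij_def)
qed

lemma RFA_head_map:
  assumes "T \<in> RFA n k"
  shows "head_map n k (T :: int tm_config \<Rightarrow> int tm_config)"
proof (rule reversible_head_map)
  show "T \<in> reversible_machines n k" using assms by (simp add: RFA_def)
  obtain F f where f: "T = tm_map n k F F f"
    "\<And>p q. p \<in> F \<rightarrow>\<^sub>E tape_symbols n \<Longrightarrow> q \<in> tm_states k \<Longrightarrow> fst (f (p, q)) = p"
    using assms by (auto simp: RFA_def)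
  fix c :: "int tm_config" assume c: "c \<in> tm_configs n k"
  obtain x q v where e: "c = (x, q, v)" by (rule prod_cases3)
  obtain p' q' u where fr: "f (read_window F (x, q, v)) = (p', q', u)" by (rule prod_cases3)
  have "fst (f (read_window F (x, q, v))) = fst (read_window F (x, q, v))"
    using read_window_patterns[OF c, of F] f(2) by (cases "read_window F c") (simp add: e patterns_def)
  then have p': "p' = (\<lambda>u\<in>F. x (v + u))" using fr by (simp add: read_window_def)
  have "(\<lambda>u. if u - v \<in> F then p' (u - v) else x u) = x" by (auto simp: p')
  then show "fst (T c) = fst c" using tm_map_eq[of x q v n k f F p' q' u F] c fr by (simp add: e f(1))
qed

context elementary_generators
begin

text \<open>
  For \<open>n \<ge> 2\<close> a local permutation is a permutation of the patterns of any interval that contains its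
  windows; for \<open>n = 1\<close> it does not change the tape and is a head map.
\<close>

lemma LP_mem:
  assumes "T \<in> LP n k" shows "T \<in> G"
proof (cases "n \<ge> 2")
  case False
  then have "n = 1" using n_pos by simp
  have T: "T \<in> reversible_machines n k" using assms by (simp add: LP_def)
  have "fst c = (\<lambda>_. 0)" if "c \<in> tm_configs n k" for c :: "int tm_config"
    using that \<open>n = 1\<close> by (auto simp: tm_configs_def tape_symbols_def PiE_iff fun_eq_iff)
  moreover have "T c \<in> tm_configs n k" if "c \<in> tm_configs n k" for c
    using reversible_machine_Bij[OF T] that by (auto simp: Bij_def bij_betw_def)
  ultimately show ?thesis by (intro head_map_mem reversible_head_map[OF T]) simp
next
  case n: True
  let ?X = "tm_configs n k :: int tm_config set"
  have T: "T \<in> reversible_machines n k" using assms by (simp add: LP_def)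
  obtain Fin Fout f where f: "is_local_rule n k Fin Fout f" "T = tm_map n k Fin Fout f"
    and stay: "\<And>p q. p \<in> Fin \<rightarrow>\<^sub>E tape_symbols n \<Longrightarrow> q \<in> tm_states k \<Longrightarrow> snd (snd (f (p, q))) = 0"
    using assms by (auto simp: LP_def)
  have "finite (Fin \<union> Fout)" using f(1) by (auto simp: is_local_rule_def)
  then obtain r where r: "r \<ge> 2" "Fin \<union> Fout \<subseteq> {- int r..<int r}" by (rule finite_subset_symmetric_interval)
  define W where "W = {- int r..<int r}"
  define \<phi> where "\<phi> = (\<lambda>(p, q). case f (restrict p Fin, q) of (p', q', _) \<Rightarrow>
    (\<lambda>u\<in>W. if u \<in> Fout then p' u else p u, q'))"
  have W: "finite W" "Fin \<subseteq> W" "Fout \<subseteq> W" using r by (auto simp: W_def)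
  have full: "full_window W" unfolding W_def by (rule symmetric_interval_full[OF n r(1)])
  have T\<phi>: "T c = window_map W \<phi> c" if c: "c \<in> ?X" for c
  proof -
    obtain x q v where e: "c = (x, q, v)" by (rule prod_cases3)
    have R: "read_window Fin (x, q, v) = (\<lambda>u\<in>Fin. x (v + u), q)" by (simp add: read_window_def)
    obtain p' q' u where fr: "f (read_window Fin (x, q, v)) = (p', q', u)" by (rule prod_cases3)
    have "(\<lambda>u\<in>Fin. x (v + u)) \<in> Fin \<rightarrow>\<^sub>E tape_symbols n" "q \<in> tm_states k"
      using read_window_patterns[OF c, of Fin] by (simp_all add: e R patterns_def)
    from stay[OF this] have u: "u = 0" using fr by (simp add: R)
    have "T c = (\<lambda>u. if u - v \<in> Fout then p' (u - v) else x u, q', v)"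
      using tm_map_eq[where f = f and Fin = Fin and Fout = Fout, OF c[unfolded e] fr] by (simp add: e f(2) u)
    moreover have "\<phi> (read_window W (x, q, v)) = (\<lambda>u\<in>W. if u \<in> Fout then p' u else x (v + u), q')"
    proof -
      have "W \<inter> Fin = Fin" using W(2) by blast
      moreover have "(\<lambda>u\<in>W. if u \<in> Fout then p' u else (\<lambda>u\<in>W. x (v + u)) u)
          = (\<lambda>u\<in>W. if u \<in> Fout then p' u else x (v + u))" by (rule restrict_ext) simp
      ultimately show ?thesis using fr by (simp add: \<phi>_def read_window_def)
    qed
    then have "window_map W \<phi> c = (\<lambda>u. if u - v \<in> Fout then p' (u - v) else x u, q', v)"
      using W(3) by (auto simp: window_map_def e write_window_def fun_eq_iff)
    ultimately show ?thesis by simp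
  qed
  have \<phi>P: "\<phi> i \<in> patterns n k W" if i: "i \<in> patterns n k W" for i
  proof -
    obtain p q where e: "i = (p, q)" by (rule prod.exhaust)
    have p: "restrict p Fin \<in> Fin \<rightarrow>\<^sub>E tape_symbols n" "p \<in> W \<rightarrow>\<^sub>E tape_symbols n" "q \<in> tm_states k"
      using i W(2) by (auto simp: e patterns_def)
    obtain p' q' u where fr: "f (restrict p Fin, q) = (p', q', u)" by (rule prod_cases3)
    have "f (restrict p Fin, q) \<in> (Fout \<rightarrow>\<^sub>E tape_symbols n) \<times> tm_states k \<times> UNIV"
      using f(1) p unfolding is_local_rule_def by blast
    then show ?thesis using p(2) by (auto simp: e \<phi>_def patterns_def fr)
  qed
  have inj: "inj_on \<phi> (patterns n k W)"
  proof (rule inj_onI)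
    fix i j assume ij: "i \<in> patterns n k W" "j \<in> patterns n k W" "\<phi> i = \<phi> j"
    \<comment> \<open>an arbitrary configuration into which the two patterns are written\<close>
    define c :: "int tm_config" where "c = (\<lambda>_. 0, 1, 0)"
    have c: "c \<in> ?X" using n_pos k_pos by (auto simp: c_def tm_configs_def tape_symbols_def tm_states_def)
    have cX: "write_window W i c \<in> ?X" "write_window W j c \<in> ?X" using write_window_configs[OF c] ij by blast+
    have eq: "T (write_window W i c) = T (write_window W j c)"
      using ij by (simp add: T\<phi> cX window_map_def read_write_window[OF ij(1)] read_write_window[OF ij(2)] write_write_window)
    have "write_window W i c = write_window W j c"
      by (rule inj_onD[OF _ eq cX]) (use reversible_machine_Bij[OF T] in \<open>simp add: Bij_def bij_betw_def\<close>)
    then show "i = j" using read_write_window[OF ij(1)] read_write_window[OF ij(2)] by metis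
  qed
  define \<pi> where "\<pi> = (\<lambda>i. if i \<in> patterns n k W then \<phi> i else i)"
  have "\<phi> ` patterns n k W = patterns n k W"
    by (rule endo_inj_surj[OF finite_patterns[OF W(1)] _ inj]) (use \<phi>P in blast)
  then have "bij_betw \<pi> (patterns n k W) (patterns n k W)"
    using inj by (auto simp: bij_betw_def \<pi>_def inj_on_def)
  then have "\<pi> permutes patterns n k W" by (rule bij_imp_permutes) (simp add: \<pi>_def)
  from full_window_permutes[OF full W(1) this] show ?thesis
  proof (rule cong_mem)
    fix c assume c: "c \<in> ?X"
    show "window_map W \<pi> c = T c"
      unfolding T\<phi>[OF c] by (rule window_map_cong[OF c]) (simp add: \<pi>_def)
  qed
qed

lemma RFA_mem: "T \<in> RFA n k \<Longrightarrow> T \<in> G"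
  by (rule head_map_mem[OF RFA_head_map])

end

section \<open>The finite generating set\<close>

lemma tm_map_turing_machine:
  "is_local_rule n k Fin Fout f \<Longrightarrow> tm_map n k Fin Fout f \<in> turing_machines n k"
  unfolding turing_machines_def mem_Collect_eq by (intro exI conjI) (rule refl)

lemma tm_map_LP:
  assumes "is_local_rule n k Fin Fout f" "tm_map n k Fin Fout f \<in> reversible_machines n k"
    and "\<And>p q. snd (snd (f (p, q))) = 0"
  shows "tm_map n k Fin Fout f \<in> LP n k"
  unfolding LP_def mem_Collect_eq using assms by (intro conjI exI[of _ Fin] exI[of _ Fout] exI[of _ f]) simp_all

lemma tm_map_RFA:
  assumes "is_local_rule n k F F f" "tm_map n k F F f \<in> reversible_machines n k"
    and "\<And>p q. fst (f (p, q)) = p"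
  shows "tm_map n k F F f \<in> RFA n k"
  unfolding RFA_def mem_Collect_eq using assms by (intro conjI exI[of _ F] exI[of _ f]) simp_all

lemma restrict_reversible:
  fixes f g :: "int tm_config \<Rightarrow> int tm_config"
  assumes "restrict f (tm_configs n k) \<in> turing_machines n k" "restrict g (tm_configs n k) \<in> turing_machines n k"
    and "\<And>c. c \<in> tm_configs n k \<Longrightarrow> f (g c) = c" "\<And>c. c \<in> tm_configs n k \<Longrightarrow> g (f c) = c"
    and "\<And>c. c \<in> tm_configs n k \<Longrightarrow> f c \<in> tm_configs n k" "\<And>c. c \<in> tm_configs n k \<Longrightarrow> g c \<in> tm_configs n k"
  shows "restrict f (tm_configs n k) \<in> reversible_machines n k"
proof -
  have "compose (tm_configs n k) (restrict f (tm_configs n k)) (restrict g (tm_configs n k)) = (\<lambda>c\<in>tm_configs n k. c)"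
    "compose (tm_configs n k) (restrict g (tm_configs n k)) (restrict f (tm_configs n k)) = (\<lambda>c\<in>tm_configs n k. c)"
    using assms(3-6) by (auto simp: compose_def fun_eq_iff)
  then show ?thesis using assms(1,2) unfolding reversible_machines_def by blast
qed

lemma window_map_tm_map:
  "restrict (window_map W \<phi>) (tm_configs n k) = tm_map n k W W (\<lambda>i. (fst (\<phi> i), snd (\<phi> i), 0))"
proof (rule ext)
  fix c :: "int tm_config"
  show "restrict (window_map W \<phi>) (tm_configs n k) c = tm_map n k W W (\<lambda>i. (fst (\<phi> i), snd (\<phi> i), 0)) c"
  proof (cases "c \<in> tm_configs n k")
    case True
    obtain x q v where e: "c = (x, q, v)" by (rule prod_cases3)
    have "tm_map n k W W (\<lambda>i. (fst (\<phi> i), snd (\<phi> i), 0)) (x, q, v)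
        = (\<lambda>u. if u - v \<in> W then fst (\<phi> (read_window W (x, q, v))) (u - v) else x u, snd (\<phi> (read_window W (x, q, v))), v + 0)"
      by (rule tm_map_eq) (use True e in simp_all)
    then show ?thesis
      using True by (cases "\<phi> (read_window W (x, q, v))") (simp add: e window_map_def write_window_def cong: if_cong)
  qed (simp add: tm_map_def)
qed

lemma window_map_LP:
  assumes W: "finite W" and \<pi>: "\<pi> permutes patterns n k W"
  shows "restrict (window_map W \<pi>) (tm_configs n k) \<in> LP n k"
proof -
  have rule: "is_local_rule n k W W (\<lambda>i. (fst (\<rho> i), snd (\<rho> i), 0))" if "\<rho> permutes patterns n k W" for \<rho>
    unfolding is_local_rule_def
  proof (intro conjI W Pi_I)
    fix i assume "i \<in> (W \<rightarrow>\<^sub>E tape_symbols n) \<times> tm_states k"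
    then have "\<rho> i \<in> patterns n k W" using permutes_in_image[OF that] by (simp add: patterns_def)
    then show "(fst (\<rho> i), snd (\<rho> i), 0) \<in> (W \<rightarrow>\<^sub>E tape_symbols n) \<times> tm_states k \<times> UNIV"
      by (cases "\<rho> i") (simp add: patterns_def)
  qed
  have tm: "restrict (window_map W \<rho>) (tm_configs n k) \<in> turing_machines n k" if "\<rho> permutes patterns n k W" for \<rho>
    unfolding window_map_tm_map by (rule tm_map_turing_machine[OF rule[OF that]])
  have maps: "\<rho> ` patterns n k W \<subseteq> patterns n k W" if "\<rho> permutes patterns n k W" for \<rho>
    using permutes_image[OF that] by simp
  have inverse: "window_map W \<rho> (window_map W (inv_into UNIV \<rho>) c) = c" "window_map W (inv_into UNIV \<rho>) (window_map W \<rho> c) = c"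
    if "\<rho> permutes patterns n k W" "c \<in> tm_configs n k" for \<rho> c
    using window_map_comp[OF that(2) maps[OF permutes_inv[OF that(1)]], of \<rho>]
      window_map_comp[OF that(2) maps[OF that(1)], of "inv_into UNIV \<rho>"] permutes_inv_o[OF that(1)]
    by (simp_all add: window_map_id)
  have "restrict (window_map W \<pi>) (tm_configs n k) \<in> reversible_machines n k"
    by (rule restrict_reversible[OF tm[OF \<pi>] tm[OF permutes_inv[OF \<pi>]]])
      (simp_all add: inverse[OF \<pi>] window_map_configs[OF _ maps[OF \<pi>]]
        window_map_configs[OF _ maps[OF permutes_inv[OF \<pi>]]])
  then show ?thesis
    unfolding window_map_tm_map by (rule tm_map_LP[OF rule[OF \<pi>]]) simp
qed

lemma state_move_tm_map:
  "restrict (state_move \<pi> m) (tm_configs n k) = tm_map n k {} {} (\<lambda>(p, q). (p, \<pi> q, m q))"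
proof (rule ext)
  fix c :: "int tm_config"
  show "restrict (state_move \<pi> m) (tm_configs n k) c = tm_map n k {} {} (\<lambda>(p, q). (p, \<pi> q, m q)) c"
  proof (cases "c \<in> tm_configs n k")
    case True
    obtain x q v where e: "c = (x, q, v)" by (rule prod_cases3)
    have "tm_map n k {} {} (\<lambda>(p, q). (p, \<pi> q, m q)) (x, q, v)
        = (\<lambda>u. if u - v \<in> {} then undefined else x u, \<pi> q, v + m q)"
      by (rule tm_map_eq) (use True e in \<open>simp_all add: read_window_def restrict_def\<close>)
    then show ?thesis using True by (simp add: e state_move_def)
  qed (simp add: tm_map_def)
qed

lemma state_move_RFA:
  assumes \<pi>: "\<pi> permutes tm_states k"
  shows "restrict (state_move \<pi> m) (tm_configs n k) \<in> RFA n k"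
proof -
  have rule: "is_local_rule n k {} {} (\<lambda>(p, q). (p, \<rho> q, l q))" if "\<rho> permutes tm_states k" for \<rho> l
    using permutes_in_image[OF that] by (auto simp: is_local_rule_def)
  have tm: "restrict (state_move \<rho> l) (tm_configs n k) \<in> turing_machines n k" if "\<rho> permutes tm_states k" for \<rho> l
    unfolding state_move_tm_map by (rule tm_map_turing_machine[OF rule[OF that]])
  let ?\<rho> = "inv_into UNIV \<pi>" and ?l = "\<lambda>q. - m (inv_into UNIV \<pi> q)"
  have "restrict (state_move \<pi> m) (tm_configs n k) \<in> reversible_machines n k"
  proof (rule restrict_reversible[OF tm[OF \<pi>] tm[OF permutes_inv[OF \<pi>], of ?l]])
    fix c :: "int tm_config" assume c: "c \<in> tm_configs n k"
    show "state_move \<pi> m (state_move ?\<rho> ?l c) = c" "state_move ?\<rho> ?l (state_move \<pi> m c) = c"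
      using permutes_inverses[OF \<pi>] by (cases c; simp add: state_move_def)+
    show "state_move \<pi> m c \<in> tm_configs n k" "state_move ?\<rho> ?l c \<in> tm_configs n k"
      using permutes_image[OF \<pi>] permutes_image[OF permutes_inv[OF \<pi>]] by (intro state_move_configs c; simp)+
  qed
  then show ?thesis
    unfolding state_move_tm_map by (rule tm_map_RFA[OF rule[OF \<pi>]]) simp
qed

lemma adjacent_swap_RFA:
  assumes k: "k \<ge> 1"
  shows "restrict (adjacent_swap k) (tm_configs n k) \<in> RFA n k"
proof -
  let ?W = "{- 1, 0, 1} :: int set"
  \<comment> \<open>The first case is a step from \<open>c\<close> to its successor, the second one a step back to the
    predecessor, whose head is one cell to the left.\<close>
  define f where "f = (\<lambda>(p :: int \<Rightarrow> nat, q). if q = k \<and> p 0 = 0 \<and> p 1 = 1 then (p, 1, 1 :: int)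
    else if q = 1 \<and> p (- 1) = 0 \<and> p 0 = 1 then (p, k, - 1) else (p, q, 0))"
  have rule: "is_local_rule n k ?W ?W f"
    using k by (auto simp: is_local_rule_def f_def tm_states_def)
  have eq: "restrict (adjacent_swap k) (tm_configs n k) = tm_map n k ?W ?W f"
  proof (rule ext)
    fix c :: "int tm_config"
    show "restrict (adjacent_swap k) (tm_configs n k) c = tm_map n k ?W ?W f c"
    proof (cases "c \<in> tm_configs n k")
      case True
      obtain x q v where e: "c = (x, q, v)" by (rule prod_cases3)
      have q: "1 \<le> q" "q \<le> k" using True by (auto simp: e tm_configs_def tm_states_def)
      obtain p' q' u where fr: "f (read_window ?W (x, q, v)) = (p', q', u)" by (rule prod_cases3)
      have p': "p' = (\<lambda>u\<in>?W. x (v + u))"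
        using fr by (auto simp: f_def read_window_def split: if_splits)
      have id: "(\<lambda>u. if u - v \<in> ?W then p' (u - v) else x u) = x" by (auto simp: p' restrict_def)
      have "tm_map n k ?W ?W f c = (x, q', v + u)"
        using tm_map_eq[where f = f and Fin = ?W and Fout = ?W, OF True[unfolded e] fr] unfolding id e .
      moreover have "adjacent_swap k c = (x, q', v + u)"
        using fr unfolding adjacent_swap_def step_swap_def e config_shift_forward[OF q] config_shift_backward[OF q]
        using q by (auto simp: f_def read_window_def split: if_splits)
      ultimately show ?thesis using True by simp
    qed (simp add: tm_map_def)
  qed
  have free: "step_free n k (\<lambda>(x, q, v). q = k \<and> x v = 0 \<and> x (v + 1) = 1)"
    unfolding step_free_def using k by (auto simp: config_shift_forward)
  have tm: "restrict (adjacent_swap k) (tm_configs n k) \<in> turing_machines n k"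
    unfolding eq by (rule tm_map_turing_machine[OF rule])
  have "restrict (adjacent_swap k) (tm_configs n k) \<in> reversible_machines n k"
    using step_swap_involution[OF k free] step_swap_configs[OF k]
    by (intro restrict_reversible[OF tm tm]) (simp_all add: adjacent_swap_def)
  then show ?thesis
    unfolding eq by (rule tm_map_RFA[OF rule]) (simp add: f_def)
qed

definition elementary_generator_maps :: "nat \<Rightarrow> nat \<Rightarrow> (int tm_config \<Rightarrow> int tm_config) set" where
  "elementary_generator_maps n k =
     window_map {0..<4} ` {\<pi>. \<pi> permutes patterns n k {0..<4}}
     \<union> (\<lambda>\<pi>. state_move \<pi> (\<lambda>_. 0)) ` {\<pi>. \<pi> permutes tm_states k}
     \<union> {state_move (\<lambda>q. q) (\<lambda>q. if q = 1 then 1 else 0), adjacent_swap k}"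

lemma finite_elementary_generator_maps: "finite (elementary_generator_maps n k)"
  unfolding elementary_generator_maps_def
  by (intro finite_UnI finite_imageI finite_permutations finite_patterns) (auto simp: tm_states_def)

lemma elementary_generator_maps_elementary:
  assumes "k \<ge> 1" "f \<in> elementary_generator_maps n k"
  shows "restrict f (tm_configs n k) \<in> RFA n k \<union> LP n k"
proof -
  consider (window) \<pi> where "\<pi> permutes patterns n k {0..<4}" "f = window_map {0..<4} \<pi>"
    | (state) \<pi> where "\<pi> permutes tm_states k" "f = state_move \<pi> (\<lambda>_. 0)"
    | (step) "f = state_move (\<lambda>q. q) (\<lambda>q. if q = 1 then 1 else 0)"
    | (swap) "f = adjacent_swap k"
    using assms(2) unfolding elementary_generator_maps_def by blast
  then show ?thesis
  proof cases
    case window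
    then show ?thesis using window_map_LP[OF _ window(1)] by simp
  next
    case state
    then show ?thesis using state_move_RFA[OF state(1)] by simp
  next
    case step
    then show ?thesis using state_move_RFA[OF permutes_id[unfolded id_def]] by simp
  next
    case swap
    then show ?thesis using adjacent_swap_RFA[OF assms(1)] by simp
  qed
qed

lemma elementary_generators_of_generated_group:
  fixes n k :: nat
  assumes n: "n \<ge> 1" and k: "k \<ge> 1"
  defines "S \<equiv> (\<lambda>f. restrict f (tm_configs n k)) ` elementary_generator_maps n k"
  shows "elementary_generators n k {f. restrict f (tm_configs n k) \<in> generate (RTM n k) S}"
proof -
  let ?X = "tm_configs n k :: int tm_config set"
  let ?R = "RTM n k :: (int tm_config \<Rightarrow> int tm_config) monoid"
  let ?G = "generate ?R S"
  interpret R: group ?R by (rule group_RTM[OF n])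
  have S: "S \<subseteq> carrier ?R"
  proof
    fix T assume "T \<in> S"
    then obtain f where "T = restrict f ?X" "f \<in> elementary_generator_maps n k" unfolding S_def by blast
    then have "T \<in> RFA n k \<union> LP n k" using elementary_generator_maps_elementary[OF k] by blast
    then show "T \<in> carrier ?R" by (auto simp: RTM_def RFA_def LP_def)
  qed
  have rev: "f \<in> reversible_machines n k" if "f \<in> ?G" for f
  proof -
    have "f \<in> carrier ?R" by (rule R.generate_in_carrier[OF S that])
    then show ?thesis by (simp add: RTM_def)
  qed
  have Bij: "f \<in> Bij ?X" if "f \<in> ?G" for f
    by (rule reversible_machine_Bij[OF rev[OF that]])
  have mult: "f \<otimes>\<^bsub>?R\<^esub> g = compose ?X f g" if "f \<in> ?G" "g \<in> ?G" for f g
    using Bij[OF that(1)] Bij[OF that(2)] by (simp add: RTM_def BijGroup_def)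
  have one: "\<one>\<^bsub>?R\<^esub> = (\<lambda>c\<in>?X. c)" by (simp add: RTM_def BijGroup_def)
  have maps: "f c \<in> ?X" if "restrict f ?X \<in> ?G" "c \<in> ?X" for f c
  proof -
    have "restrict f ?X ` ?X = ?X" using Bij[OF that(1)] by (simp add: Bij_def bij_betw_def)
    then have "restrict f ?X c \<in> ?X" using that(2) by blast
    then show ?thesis using that(2) by simp
  qed
  have mem: "f \<in> {f. restrict f ?X \<in> ?G}" if "f \<in> elementary_generator_maps n k" for f
    using generate.incl[of "restrict f ?X" S ?R] that unfolding S_def by blast
  interpret M: machine_group n k "{f. restrict f ?X \<in> ?G}"
  proof unfold_locales
    show "id \<in> {f. restrict f ?X \<in> ?G}"
      using generate.one[of ?R S] by (simp add: one id_def)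
    fix f g :: "int tm_config \<Rightarrow> int tm_config" assume f: "f \<in> {f. restrict f ?X \<in> ?G}"
    show "g \<in> {f. restrict f ?X \<in> ?G}" if "\<And>c. c \<in> ?X \<Longrightarrow> f c = g c"
    proof -
      have "restrict g ?X = restrict f ?X" using that by (intro restrict_ext) simp
      then show ?thesis using f by simp
    qed
    show "f \<circ> g \<in> {f. restrict f ?X \<in> ?G}" if g: "g \<in> {f. restrict f ?X \<in> ?G}"
    proof -
      have "restrict (f \<circ> g) ?X = compose ?X (restrict f ?X) (restrict g ?X)"
        using maps g by (auto simp: compose_def)
      also have "\<dots> = restrict f ?X \<otimes>\<^bsub>?R\<^esub> restrict g ?X" using mult f g by simp
      finally show ?thesis using generate.eng[of _ ?R S] f g by simp
    qed
    show "g \<in> {f. restrict f ?X \<in> ?G}"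
      if gX: "\<And>c. c \<in> ?X \<Longrightarrow> g c \<in> ?X" and fg: "\<And>c. c \<in> ?X \<Longrightarrow> f (g c) = c"
    proof -
      let ?h = "inv\<^bsub>?R\<^esub> (restrict f ?X)"
      have h: "?h \<in> ?G" using R.generate_m_inv_closed[OF S] f by simp
      have eq: "compose ?X ?h (restrict f ?X) = (\<lambda>c\<in>?X. c)"
      proof -
        have f': "restrict f ?X \<in> ?G" using f by simp
        then show ?thesis
          using R.l_inv[OF R.generate_in_carrier[OF S f']] mult[OF h f'] one by (simp only:)
      qed
      have "?h c = g c" if c: "c \<in> ?X" for c
        using fun_cong[OF eq, of "g c"] gX[OF c] fg[OF c] by (simp add: compose_eq)
      then have "restrict g ?X = restrict ?h ?X" by (intro restrict_ext) simp
      also have "\<dots> = ?h" using Bij[OF h] by (simp add: Bij_def extensional_restrict)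
      finally show ?thesis using h by simp
    qed
  qed
  show ?thesis
  proof unfold_locales
    have 1: "window_map {0..<4} \<pi> \<in> {f. restrict f ?X \<in> ?G}" if "\<pi> permutes patterns n k {0..<4}" for \<pi>
      by (rule mem) (use that in \<open>simp add: elementary_generator_maps_def\<close>)
    show "M.full_window {0..<4}"
      unfolding M.full_window_def by (intro ballI 1 permutes_swap_id)
    show "state_move \<pi> (\<lambda>_. 0) \<in> {f. restrict f ?X \<in> ?G}" if "\<pi> permutes tm_states k" for \<pi>
      by (rule mem) (use that in \<open>simp add: elementary_generator_maps_def\<close>)
    show "state_move (\<lambda>q. q) (\<lambda>q. if q = 1 then 1 else 0) \<in> {f. restrict f ?X \<in> ?G}"
      by (rule mem) (simp add: elementary_generator_maps_def)
    show "adjacent_swap k \<in> {f. restrict f ?X \<in> ?G}"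
      by (rule mem) (simp add: elementary_generator_maps_def)
  qed (use n k in simp_all)
qed

text \<open>
  The generators are themselves elementary, and the group that they generate contains \<^const>\<open>RFA\<close> and
  \<^const>\<open>LP\<close>.
\<close>

theorem theorem1p1:
  fixes n k :: nat
  assumes "n \<ge> 1" and "k \<ge> 1"
  shows "finitely_generated (EL n k :: (int tm_config \<Rightarrow> int tm_config) monoid)"
proof -
  let ?X = "tm_configs n k :: int tm_config set"
  let ?R = "RTM n k :: (int tm_config \<Rightarrow> int tm_config) monoid"
  let ?A = "RFA n k \<union> LP n k :: (int tm_config \<Rightarrow> int tm_config) set"
  define S where "S = (\<lambda>f. restrict f ?X) ` elementary_generator_maps n k"
  interpret R: group ?R by (rule group_RTM[OF assms(1)])
  interpret E: elementary_generators n k "{f. restrict f ?X \<in> generate ?R S}"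
    unfolding S_def by (rule elementary_generators_of_generated_group[OF assms])
  have A: "?A \<subseteq> carrier ?R" by (auto simp: RTM_def RFA_def LP_def)
  have SA: "S \<subseteq> ?A" using elementary_generator_maps_elementary[OF assms(2)] by (auto simp: S_def)
  have "?A \<subseteq> generate ?R S"
  proof
    fix T assume T: "T \<in> ?A"
    have "T \<in> reversible_machines n k" using T by (auto simp: RFA_def LP_def)
    from reversible_machine_Bij[OF this] have "restrict T ?X = T" by (simp add: Bij_def extensional_restrict)
    moreover have "T \<in> {f. restrict f ?X \<in> generate ?R S}" using T E.RFA_mem E.LP_mem by blast
    ultimately show "T \<in> generate ?R S" by simp
  qed
  then have "generate ?R ?A \<subseteq> generate ?R S"
    by (rule R.generate_subgroup_incl[OF _ R.generate_is_subgroup]) (use SA A in blast)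
  moreover have "generate ?R S \<subseteq> generate ?R ?A" by (rule R.mono_generate[OF SA])
  ultimately have eq: "generate ?R S = generate ?R ?A" by blast
  have EL: "(EL n k :: (int tm_config \<Rightarrow> int tm_config) monoid) = ?R\<lparr>carrier := generate ?R ?A\<rparr>"
    using A by (simp add: EL_def subgroup_generated_def Int_absorb1)
  have "S \<subseteq> generate ?R ?A" using SA generate.incl[of _ ?A ?R] by blast
  moreover have "generate (?R\<lparr>carrier := generate ?R ?A\<rparr>) S = generate ?R S"
    by (rule R.generate_consistent[OF \<open>S \<subseteq> generate ?R ?A\<close> R.generate_is_subgroup[OF A]])
  moreover have "finite S" unfolding S_def by (rule finite_imageI[OF finite_elementary_generator_maps])
  ultimately show ?thesis unfolding finitely_generated_def EL by (intro exI[of _ S]) (simp add: eq)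
qed

end
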